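(* For every positive integer $c\leq 5$, the graded ideal zeta function $\zeta_{\mathfrak{f}_{c,2}}^{\triangleleft_{\mathrm{gr}}}(s)$ is $\mathbb{F}_p$-uniform; that is, there exists a polynomial $W_c(X,Y)\in\mathbb{Q}[X,Y]$ such that for all but finitely many primes $p$, $$\zeta_{\mathfrak{f}_{c,2}(\mathbb{F}_p)}^{\triangleleft_{\mathrm{gr}}}(s)=W_c(p,p^{-s}).$$
   Context: $\mathfrak{f}_{c,2}$ is the free nilpotent Lie ring of class $c$ on $2$ generators $X_1,X_2$ over $\mathbb{Z}$, and $\mathfrak{f}_{c,2}(\mathbb{F}_p)=\mathfrak{f}_{c,2}\otimes\mathbb{F}_p$ is the free nilpotent Lie algebra of class $c$ on $2$ generators over $\mathbb{F}_p$. Write $L=\mathfrak{f}_{c,2}(\mathbb{F}_p)=L_1\oplus\cdots\oplus L_c$, where $L_k$ is the homogeneous component of degree $k$ (spanned by Lie monomials of degree $k$ in $X_1,X_2$), equivalently $L_k\cong\gamma_k(L)/\gamma_{k+1}(L)$ with $\gamma_k$ the lower central series. An ideal $I$ of $L$ is graded, written $I\triangleleft_{\mathrm{gr}}L$, if $I=\bigoplus_{k=1}^{c}(I\cap L_k)$. The graded ideal zeta function is the finite Dirichlet polynomial $$\zeta_{L}^{\triangleleft_{\mathrm{gr}}}(s)=\sum_{I\triangleleft_{\mathrm{gr}}L}|L:I|^{-s},$$ where $|L:I|=p^{\dim L-\dim I}$ and $s$ is a complex variable. *)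

theory Defs
  imports "HOL-Analysis.Complex_Transcendental" "HOL-Algebra.Module" "HOL-Algebra.QuotRing" "HOL-Number_Theory.Residues"
    "HOL-Computational_Algebra.Polynomial"
begin

text \<open>
  A (not necessarily associative) algebra over a commutative ring \<open>R\<close> is a
  \<^type>\<open>module_ext\<close> record whose multiplication is the bilinear product; for a Lie algebra
  this is the bracket. The field \<open>one\<close> of the record has no meaning here, since these algebras
  have no unit.
\<close>

definition span_of :: "('a, 'r) ring_scheme \<Rightarrow> ('a, 'b, 'm) module_scheme \<Rightarrow> 'b set \<Rightarrow> 'b set"
  where "span_of R A S = (\<lambda>N. submodule N R A) hull S"

definition alg_ideal :: "('a, 'r) ring_scheme \<Rightarrow> ('a, 'b, 'm) module_scheme \<Rightarrow> 'b set \<Rightarrow> bool"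
  where "alg_ideal R A I \<longleftrightarrow> submodule I R A \<and>
    (\<forall>x\<in>carrier A. \<forall>a\<in>I. x \<otimes>\<^bsub>A\<^esub> a \<in> I \<and> a \<otimes>\<^bsub>A\<^esub> x \<in> I)"

definition quot_alg :: "('a, 'b, 'm) module_scheme \<Rightarrow> 'b set \<Rightarrow> ('a, 'b set) module"
  where "quot_alg A I =
    \<lparr>carrier = a_rcosets\<^bsub>A\<^esub> I, monoid.mult = rcoset_mult A I,
     one = undefined, zero = I, add = set_add A,
     module.smult = (\<lambda>r B. \<Union>b\<in>B. I +>\<^bsub>A\<^esub> (r \<odot>\<^bsub>A\<^esub> b))\<rparr>"

text \<open>The lower central series, numbered so that \<open>\<gamma>\<^sub>1 = L\<close> and
  \<open>\<gamma>\<^sub>k\<^sub>+\<^sub>1 = [\<gamma>\<^sub>k, L]\<close>; the value at \<open>0\<close> is a dummy.\<close>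

primrec lower_central ::
    "('a, 'r) ring_scheme \<Rightarrow> ('a, 'b, 'm) module_scheme \<Rightarrow> nat \<Rightarrow> 'b set"
  where
    "lower_central R L 0 = carrier L"
  | "lower_central R L (Suc k) =
      (if k = 0 then carrier L
       else span_of R L {x \<otimes>\<^bsub>L\<^esub> y |x y. x \<in> lower_central R L k \<and> y \<in> carrier L})"


text \<open>Elements of the free magma on \<open>'x\<close>, i.e. the bracket monomials.\<close>

datatype 'x fmagma = Gen 'x | Br "'x fmagma" "'x fmagma"

primrec degree_of :: "'x fmagma \<Rightarrow> nat"
  where
    "degree_of (Gen x) = 1"
  | "degree_of (Br s t) = degree_of s + degree_of t"

primrec eval_monomial :: "('a, 'b, 'm) module_scheme \<Rightarrow> ('x \<Rightarrow> 'b) \<Rightarrow> 'x fmagma \<Rightarrow> 'b"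
  where
    "eval_monomial L g (Gen x) = g x"
  | "eval_monomial L g (Br s t) = eval_monomial L g s \<otimes>\<^bsub>L\<^esub> eval_monomial L g t"

text \<open>
  The free non-associative \<open>R\<close>-algebra on \<open>'x\<close>: finitely supported \<open>R\<close>-valued functions on
  the free magma. Since every monomial \<open>Br s t\<close> factors uniquely, the convolution product
  has only one summand.
\<close>

definition free_na_alg :: "('a, 'r) ring_scheme \<Rightarrow> ('a, 'x fmagma \<Rightarrow> 'a) module"
  where "free_na_alg R =
    \<lparr>carrier = {f. range f \<subseteq> carrier R \<and> finite {t. f t \<noteq> \<zero>\<^bsub>R\<^esub>}},
     monoid.mult = (\<lambda>f g t. case t of Gen x \<Rightarrow> \<zero>\<^bsub>R\<^esub> | Br u v \<Rightarrow> f u \<otimes>\<^bsub>R\<^esub> g v),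
     one = undefined,
     zero = (\<lambda>t. \<zero>\<^bsub>R\<^esub>),
     add = (\<lambda>f g t. f t \<oplus>\<^bsub>R\<^esub> g t),
     module.smult = (\<lambda>r f t. r \<otimes>\<^bsub>R\<^esub> f t)\<rparr>"

definition free_na_gen :: "('a, 'r) ring_scheme \<Rightarrow> 'x \<Rightarrow> 'x fmagma \<Rightarrow> 'a"
  where "free_na_gen R x = (\<lambda>t. if t = Gen x then \<one>\<^bsub>R\<^esub> else \<zero>\<^bsub>R\<^esub>)"

definition lie_relations :: "('a, 'b, 'm) module_scheme \<Rightarrow> 'b set"
  where "lie_relations A =
    {x \<otimes>\<^bsub>A\<^esub> x |x. x \<in> carrier A} \<union>
    {x \<otimes>\<^bsub>A\<^esub> (y \<otimes>\<^bsub>A\<^esub> z) \<oplus>\<^bsub>A\<^esub> y \<otimes>\<^bsub>A\<^esub> (z \<otimes>\<^bsub>A\<^esub> x) \<oplus>\<^bsub>A\<^esub> z \<otimes>\<^bsub>A\<^esub> (x \<otimes>\<^bsub>A\<^esub> y) |x y z.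
      x \<in> carrier A \<and> y \<in> carrier A \<and> z \<in> carrier A}"

definition lie_relation_ideal :: "('a, 'r) ring_scheme \<Rightarrow> ('x fmagma \<Rightarrow> 'a) set"
  where "lie_relation_ideal R =
    alg_ideal R (free_na_alg R) hull lie_relations (free_na_alg R)"

definition free_lie :: "('a, 'r) ring_scheme \<Rightarrow> ('a, ('x fmagma \<Rightarrow> 'a) set) module"
  where "free_lie R = quot_alg (free_na_alg R) (lie_relation_ideal R)"

definition free_lie_gen :: "('a, 'r) ring_scheme \<Rightarrow> 'x \<Rightarrow> ('x fmagma \<Rightarrow> 'a) set"
  where "free_lie_gen R x = lie_relation_ideal R +>\<^bsub>free_na_alg R\<^esub> free_na_gen R x"

text \<open>
  The free nilpotent Lie \<open>R\<close>-algebra of class \<open>c\<close> on \<open>'x\<close>. For \<open>R\<close> the ring of integers this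
  is the free nilpotent Lie ring, and the construction commutes with base change, so that
  tensoring that Lie ring with \<open>R\<close> gives the algebra below.
\<close>

definition free_nilp_lie ::
    "('a, 'r) ring_scheme \<Rightarrow> nat \<Rightarrow> ('a, ('x fmagma \<Rightarrow> 'a) set set) module"
  where "free_nilp_lie R c = quot_alg (free_lie R) (lower_central R (free_lie R) (c + 1))"

definition free_nilp_gen ::
    "('a, 'r) ring_scheme \<Rightarrow> nat \<Rightarrow> 'x \<Rightarrow> ('x fmagma \<Rightarrow> 'a) set set"
  where "free_nilp_gen R c x =
    lower_central R (free_lie R) (c + 1) +>\<^bsub>free_lie R\<^esub> free_lie_gen R x"


definition homogeneous_component ::
    "('a, 'r) ring_scheme \<Rightarrow> ('a, 'b, 'm) module_scheme \<Rightarrow> ('x \<Rightarrow> 'b) \<Rightarrow> nat \<Rightarrow> 'b set"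
  where "homogeneous_component R L g k =
    span_of R L {eval_monomial L g t |t. degree_of t = k}"

definition internal_direct_sum ::
    "('a, 'b, 'm) module_scheme \<Rightarrow> 'i set \<Rightarrow> ('i \<Rightarrow> 'b set) \<Rightarrow> 'b set \<Rightarrow> bool"
  where "internal_direct_sum L K N M \<longleftrightarrow>
    bij_betw (\<lambda>x. finsum L x K) (\<Pi>\<^sub>E k\<in>K. N k) M"

text \<open>Graded ideals of an algebra \<open>L\<close> generated by the family \<open>g\<close>, of nilpotency class \<open>c\<close>.\<close>

definition graded_ideal ::
    "('a, 'r) ring_scheme \<Rightarrow> ('a, 'b, 'm) module_scheme \<Rightarrow> ('x \<Rightarrow> 'b) \<Rightarrow> nat \<Rightarrow> 'b set \<Rightarrow> bool"
  where "graded_ideal R L g c I \<longleftrightarrow> alg_ideal R L I \<and>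
    internal_direct_sum L {1..c} (\<lambda>k. I \<inter> homogeneous_component R L g k) I"

definition graded_ideal_zeta ::
    "('a, 'r) ring_scheme \<Rightarrow> ('a, 'b, 'm) module_scheme \<Rightarrow> ('x \<Rightarrow> 'b) \<Rightarrow> nat \<Rightarrow> complex \<Rightarrow> complex"
  where "graded_ideal_zeta R L g c s =
    (\<Sum>I | graded_ideal R L g c I. of_nat (card (a_rcosets\<^bsub>L\<^esub> I)) powr (- s))"


datatype two_gens = X1 | X2

definition zeta_free_nilp_2 :: "nat \<Rightarrow> nat \<Rightarrow> complex \<Rightarrow> complex"
  where "zeta_free_nilp_2 c p s =
    (let F = residue_ring (int p)
     in graded_ideal_zeta F (free_nilp_lie F c) (free_nilp_gen F c :: two_gens \<Rightarrow> _) c s)"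

text \<open>Elements of \<open>\<rat>[X, Y]\<close> are represented as polynomials in \<open>Y\<close> over \<open>\<rat>[X]\<close>.\<close>

definition eval_XY :: "rat poly poly \<Rightarrow> complex \<Rightarrow> complex \<Rightarrow> complex"
  where "eval_XY W x y = poly (map_poly (\<lambda>q. poly (map_poly of_rat q) x) W) y"

end

theory Submission
  imports Defs
begin

text \<open>
  Let \<open>L = L\<^sub>1 \<oplus> \<dots> \<oplus> L\<^sub>c\<close> be the free nilpotent Lie algebra of class \<open>c \<le> 5\<close> on \<open>x, y\<close> over the field
  with \<open>p\<close> elements. Since \<open>L\<close> is generated by \<open>L\<^sub>1\<close>, a graded ideal is the same thing as a sequence
  of subspaces \<open>I\<^sub>k \<le> L\<^sub>k\<close> with \<open>[I\<^sub>k, x] + [I\<^sub>k, y] \<le> I\<^sub>k\<^sub>+\<^sub>1\<close>. The number of admissible \<open>I\<^sub>k\<^sub>+\<^sub>1\<close> of a given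
  dimension is a Gaussian binomial coefficient in \<open>p\<close> that depends only on \<open>dim L\<^sub>k\<^sub>+\<^sub>1\<close> and on
  \<open>dim ([I\<^sub>k, x] + [I\<^sub>k, y])\<close>. In class at most 5 the latter is a function of \<open>dim I\<^sub>k\<close> alone, the same
  for every prime, and so the sum over all sequences unfolds level by level into a polynomial in
  \<open>p\<close> and \<open>p\<^sup>-\<^sup>s\<close>.

  The dimensions of the \<open>L\<^sub>k\<close> are \<open>2, 1, 2, 3, 6\<close>. Write \<open>\<mu>\<^sub>k\<close> for the surjection
  \<open>L\<^sub>k \<times> L\<^sub>k \<rightarrow> L\<^sub>k\<^sub>+\<^sub>1\<close>, \<open>(u, v) \<mapsto> [u, x] + [v, y]\<close>; the subspace of interest is \<open>\<mu>\<^sub>k(I\<^sub>k \<times> I\<^sub>k)\<close>.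
  For \<open>k = 2\<close> and \<open>k = 4\<close> the map is injective, so dimensions double. For \<open>k = 1\<close>, any nonzero vector
  of \<open>L\<^sub>1\<close> already produces the line \<open>L\<^sub>2\<close>. For \<open>k = 3\<close>, with \<open>a = [[x, y], x]\<close> and \<open>b = [[x, y], y]\<close>,
  the kernel is the line spanned by \<open>(b, -a)\<close>, and this pair is not contained in \<open>U \<times> U\<close>
  for any line \<open>U\<close>; hence \<open>0, 1, 2\<close> are sent to \<open>0, 2, 3\<close> (lemma \<open>card_ad_gens_dim\<close>).

  The counting part works over any finite field: \<open>card_between\<close> counts the subspaces between two
  given ones, and \<open>sum_chains\<close> sums weights over sequences of subspaces as above.

  The algebraic part has to determine \<open>L\<close> from its presentation. Upper bounds for the dimensions come
  from spanning: \<open>left_normed_mult\<close> shows by the Jacobi identity that left-normed brackets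
  \<open>[\<dots>[[g\<^sub>1, g\<^sub>2], g\<^sub>3], \<dots>, g\<^sub>k]\<close> span \<open>L\<^sub>k\<close>. For lower bounds, and for the directness of the sum of the \<open>L\<^sub>k\<close>,
  every bracket monomial is expanded into noncommutative words, with \<open>[u, v] = uv - vu\<close>. The
  expansion respects the Lie relations because concatenation of words is associative, and it
  kills everything of degree above \<open>c\<close> on words of length at most \<open>c\<close>, so it is defined on \<open>L\<close>. The
  coefficients of a few well-chosen words then show that the spanning elements are linearly
  independent (\<open>coeffs1\<close> to \<open>coeffs5\<close>).
\<close>

section \<open>Gaussian binomial coefficients\<close>

text \<open>
  The Pascal recursion makes this a polynomial in \<open>q\<close> by construction, so that it can be
  evaluated in any commutative ring; no division is involved.
\<close>

fun gauss_binomial :: "'a::comm_ring_1 \<Rightarrow> nat \<Rightarrow> nat \<Rightarrow> 'a"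
  where
    "gauss_binomial q n 0 = 1"
  | "gauss_binomial q 0 (Suc d) = 0"
  | "gauss_binomial q (Suc n) (Suc d) = gauss_binomial q n d + q ^ Suc d * gauss_binomial q n (Suc d)"

text \<open>
  This identity for \<open>n\<close> follows from the absorption identity for the same \<open>n\<close>, which in turn needs
  it to step from \<open>n\<close> to \<open>n + 1\<close>. Stating it conditionally keeps the induction in one place.
\<close>

lemma gauss_symmetric_absorption:
  assumes "\<And>d. (q ^ Suc d - 1) * gauss_binomial q (Suc n) (Suc d) = (q ^ Suc n - 1) * gauss_binomial q n d"
  shows "(q ^ Suc n - q ^ d) * gauss_binomial q (Suc n) d = q ^ d * (q ^ Suc n - 1) * gauss_binomial q n d"
proof (cases d)
  case (Suc d')
  have "(q ^ Suc n - q ^ d) * gauss_binomial q (Suc n) d =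
      (q ^ Suc n - 1) * gauss_binomial q (Suc n) d - (q ^ Suc d' - 1) * gauss_binomial q (Suc n) (Suc d')"
    by (simp add: Suc algebra_simps)
  also have "\<dots> = (q ^ Suc n - 1) * (gauss_binomial q (Suc n) d - gauss_binomial q n d')"
    unfolding assms by (simp add: algebra_simps)
  also have "\<dots> = q ^ d * (q ^ Suc n - 1) * gauss_binomial q n d"
    by (simp add: Suc algebra_simps)
  finally show ?thesis .
qed simp

text \<open>
  The quotient formula for Gaussian binomials with the denominators cleared. In this form it
  matches the double count of \<open>card_between\<close>.
\<close>

lemma gauss_absorption:
  "(q ^ Suc d - 1) * gauss_binomial q (Suc n) (Suc d) = (q ^ Suc n - 1) * gauss_binomial q n d"
proof (induction n arbitrary: d)
  case 0
  show ?case by (cases d) auto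
next
  case (Suc n)
  have "(q ^ Suc d - 1) * gauss_binomial q (Suc (Suc n)) (Suc d) =
      (q ^ Suc d - 1) * gauss_binomial q (Suc n) d
      + q ^ Suc d * ((q ^ Suc d - 1) * gauss_binomial q (Suc n) (Suc d))"
    by (simp only: gauss_binomial.simps) (simp add: algebra_simps)
  also have "\<dots> = (q ^ Suc d - 1) * gauss_binomial q (Suc n) d
      + q * (q ^ d * (q ^ Suc n - 1) * gauss_binomial q n d)"
    unfolding Suc.IH by (simp add: algebra_simps)
  also have "\<dots> = (q ^ Suc d - 1) * gauss_binomial q (Suc n) d
      + q * ((q ^ Suc n - q ^ d) * gauss_binomial q (Suc n) d)"
    unfolding gauss_symmetric_absorption[OF Suc.IH] ..
  also have "\<dots> = (q ^ Suc (Suc n) - 1) * gauss_binomial q (Suc n) d"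
    by (simp add: algebra_simps)
  finally show ?case .
qed

section \<open>Submodules and sums of submodules\<close>

lemma (in module) submodule_zero: "submodule S R M \<Longrightarrow> \<zero>\<^bsub>M\<^esub> \<in> S"
  using submodule.axioms(1)[THEN subgroup.one_closed] by simp

lemma (in module) submodule_in_carrier: "submodule S R M \<Longrightarrow> u \<in> S \<Longrightarrow> u \<in> carrier M"
  using submoduleE(1) by blast

text \<open>
  The sum of the submodules \<open>J k\<close> for \<open>1 \<le> k \<le> c\<close>, described as the set that
  \<^const>\<open>internal_direct_sum\<close> compares with.
\<close>

definition sum_set :: "('a, 'b, 'm) module_scheme \<Rightarrow> nat \<Rightarrow> (nat \<Rightarrow> 'b set) \<Rightarrow> 'b set"
  where "sum_set A c J = (\<lambda>u. finsum A u {1..c}) ` (\<Pi>\<^sub>E k\<in>{1..c}. J k)"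

context module
begin

lemma submodule_Inter:
  assumes "\<And>S. S \<in> \<S> \<Longrightarrow> submodule S R M" and "\<S> \<noteq> {}"
  shows "submodule (\<Inter>\<S>) R M"
proof (rule submoduleI)
  show "\<Inter>\<S> \<subseteq> carrier M"
    using assms submoduleE(1) by blast
  show "\<zero>\<^bsub>M\<^esub> \<in> \<Inter>\<S>"
    using assms submodule_zero by blast
  show "\<ominus>\<^bsub>M\<^esub> a \<in> \<Inter>\<S>" if "a \<in> \<Inter>\<S>" for a
    using assms that submoduleE(3) by blast
  show "a \<oplus>\<^bsub>M\<^esub> b \<in> \<Inter>\<S>" if "a \<in> \<Inter>\<S>" "b \<in> \<Inter>\<S>" for a b
    using assms that submoduleE(5) by blast
  show "r \<odot>\<^bsub>M\<^esub> a \<in> \<Inter>\<S>" if "r \<in> carrier R" "a \<in> \<Inter>\<S>" for r a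
    using assms that submoduleE(4) by blast
qed

lemma submodule_span_of:
  assumes "S \<subseteq> carrier M"
  shows "submodule (span_of R M S) R M"
  unfolding span_of_def hull_def
  using carrier_is_submodule assms by (intro submodule_Inter) auto

lemma span_of_least: "submodule S R M \<Longrightarrow> T \<subseteq> S \<Longrightarrow> span_of R M T \<subseteq> S"
  unfolding span_of_def by (rule hull_minimal)

lemma span_of_superset: "T \<subseteq> span_of R M T"
  unfolding span_of_def by (rule hull_subset)

lemma submodule_finsum:
  assumes "submodule S R M" "finite K" "\<And>k. k \<in> K \<Longrightarrow> u k \<in> S"
  shows "finsum M u K \<in> S"
  using assms(2,3)
proof (induction K)
  case empty
  then show ?case using submodule_zero[OF assms(1)] by simp
next
  case (insert k K)
  then show ?case
    using submoduleE(5)[OF assms(1)] submodule_in_carrier[OF assms(1)]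
    by (simp add: Pi_def)
qed

lemma sum_setI:
  assumes "\<And>k. k \<in> {1..c} \<Longrightarrow> J k \<subseteq> carrier M" "\<And>k. k \<in> {1..c} \<Longrightarrow> u k \<in> J k"
  shows "finsum M u {1..c} \<in> sum_set M c J"
proof -
  have "u k \<in> carrier M" if "k \<in> {1..c}" for k
    using assms that by blast
  then have "finsum M u {1..c} = finsum M (restrict u {1..c}) {1..c}"
    by (intro M.finsum_cong') auto
  moreover have "restrict u {1..c} \<in> (\<Pi>\<^sub>E k\<in>{1..c}. J k)"
    using assms by auto
  ultimately show ?thesis
    unfolding sum_set_def by blast
qed

lemma sum_setE:
  assumes "a \<in> sum_set M c J"
  obtains u where "\<And>k. k \<in> {1..c} \<Longrightarrow> u k \<in> J k" "a = finsum M u {1..c}"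
  using assms unfolding sum_set_def by blast

lemma submodule_sum_set:
  assumes J: "\<And>k. k \<in> {1..c} \<Longrightarrow> submodule (J k) R M"
  shows "submodule (sum_set M c J) R M"
proof -
  have Jc: "J k \<subseteq> carrier M" if "k \<in> {1..c}" for k
    using J[OF that] submoduleE(1) by blast
  have smult: "r \<odot>\<^bsub>M\<^esub> a \<in> sum_set M c J" if r: "r \<in> carrier R" and a: "a \<in> sum_set M c J" for r a
  proof -
    obtain u where u: "\<And>k. k \<in> {1..c} \<Longrightarrow> u k \<in> J k" "a = finsum M u {1..c}"
      using a by (rule sum_setE) auto
    have "u \<in> {1..c} \<rightarrow> carrier M"
      using u(1) Jc by blast
    then have "r \<odot>\<^bsub>M\<^esub> a = finsum M (\<lambda>k. r \<odot>\<^bsub>M\<^esub> u k) {1..c}"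
      unfolding u(2) using r by (intro finsum_smult_ldistr) auto
    also have "\<dots> \<in> sum_set M c J"
      using r u(1) Jc J submoduleE(4) by (intro sum_setI) blast+
    finally show ?thesis .
  qed
  have carrier: "sum_set M c J \<subseteq> carrier M"
  proof
    fix a assume "a \<in> sum_set M c J"
    then obtain u where u: "\<And>k. k \<in> {1..c} \<Longrightarrow> u k \<in> J k" "a = finsum M u {1..c}"
      by (rule sum_setE) auto
    have "u \<in> {1..c} \<rightarrow> carrier M"
      using u(1) Jc by blast
    then show "a \<in> carrier M"
      unfolding u(2) by (rule M.finsum_closed)
  qed
  show ?thesis
  proof (rule submoduleI)
    show "sum_set M c J \<subseteq> carrier M" by (rule carrier)
    have "finsum M (\<lambda>_. \<zero>\<^bsub>M\<^esub>) {1..c} \<in> sum_set M c J"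
      using Jc J submodule_zero by (intro sum_setI) blast+
    then show "\<zero>\<^bsub>M\<^esub> \<in> sum_set M c J" by simp
    show "\<ominus>\<^bsub>M\<^esub> a \<in> sum_set M c J" if "a \<in> sum_set M c J" for a
      using smult[of "\<ominus>\<^bsub>R\<^esub> \<one>\<^bsub>R\<^esub>" a] that carrier by (auto simp: smult_l_minus)
    show "a \<oplus>\<^bsub>M\<^esub> b \<in> sum_set M c J" if a: "a \<in> sum_set M c J" and b: "b \<in> sum_set M c J" for a b
    proof -
      obtain u where u: "\<And>k. k \<in> {1..c} \<Longrightarrow> u k \<in> J k" "a = finsum M u {1..c}"
        using a by (rule sum_setE) auto
      obtain v where v: "\<And>k. k \<in> {1..c} \<Longrightarrow> v k \<in> J k" "b = finsum M v {1..c}"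
        using b by (rule sum_setE) auto
      have "u \<in> {1..c} \<rightarrow> carrier M" "v \<in> {1..c} \<rightarrow> carrier M"
        using u(1) v(1) Jc by blast+
      then have "a \<oplus>\<^bsub>M\<^esub> b = finsum M (\<lambda>k. u k \<oplus>\<^bsub>M\<^esub> v k) {1..c}"
        unfolding u(2) v(2) by (simp add: M.finsum_addf)
      also have "\<dots> \<in> sum_set M c J"
        using u(1) v(1) Jc J submoduleE(5) by (intro sum_setI) blast+
      finally show ?thesis .
    qed
  qed (rule smult)
qed

lemma sum_set_superset:
  assumes J: "\<And>k. k \<in> {1..c} \<Longrightarrow> submodule (J k) R M" and k: "k \<in> {1..c}"
  shows "J k \<subseteq> sum_set M c J"
proof
  fix a assume a: "a \<in> J k"
  then have "a \<in> carrier M" using J[OF k] submodule_in_carrier by blast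
  then have "a = finsum M (\<lambda>j. if k = j then a else \<zero>\<^bsub>M\<^esub>) {1..c}"
    using k M.finsum_singleton[of k "{1..c}" "\<lambda>_. a"] by simp
  also have "\<dots> \<in> sum_set M c J"
    using J a submodule_zero submoduleE(1) by (intro sum_setI) auto
  finally show "a \<in> sum_set M c J" .
qed

lemma sum_set_least:
  assumes "submodule S R M" "\<And>k. k \<in> {1..c} \<Longrightarrow> J k \<subseteq> S"
  shows "sum_set M c J \<subseteq> S"
proof
  fix a assume "a \<in> sum_set M c J"
  then obtain u where u: "\<And>k. k \<in> {1..c} \<Longrightarrow> u k \<in> J k" "a = finsum M u {1..c}"
    by (rule sum_setE) auto
  show "a \<in> S"
    unfolding u(2) using assms(2) u(1) by (intro submodule_finsum[OF assms(1)]) blast+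
qed

lemma submodule_span_gens:
  assumes x: "x \<in> carrier M" and y: "y \<in> carrier M"
  shows "submodule {r \<odot>\<^bsub>M\<^esub> x \<oplus>\<^bsub>M\<^esub> s \<odot>\<^bsub>M\<^esub> y |r s. r \<in> carrier R \<and> s \<in> carrier R} R M"
    (is "submodule ?D R M")
proof (rule submoduleI)
  show "?D \<subseteq> carrier M" using x y by auto
  show "\<zero>\<^bsub>M\<^esub> \<in> ?D" using x y by (auto intro!: exI[of _ "\<zero>\<^bsub>R\<^esub>"])
  {
    fix a assume "a \<in> ?D"
    then obtain r s where a: "r \<in> carrier R" "s \<in> carrier R" "a = r \<odot>\<^bsub>M\<^esub> x \<oplus>\<^bsub>M\<^esub> s \<odot>\<^bsub>M\<^esub> y"
      by auto
    have "\<ominus>\<^bsub>M\<^esub> a = (\<ominus>\<^bsub>R\<^esub> r) \<odot>\<^bsub>M\<^esub> x \<oplus>\<^bsub>M\<^esub> (\<ominus>\<^bsub>R\<^esub> s) \<odot>\<^bsub>M\<^esub> y"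
      using a x y by (simp add: M.minus_add smult_l_minus)
    then show "\<ominus>\<^bsub>M\<^esub> a \<in> ?D" using a by blast
    {
      fix b assume "b \<in> ?D"
      then obtain r' s' where b: "r' \<in> carrier R" "s' \<in> carrier R" "b = r' \<odot>\<^bsub>M\<^esub> x \<oplus>\<^bsub>M\<^esub> s' \<odot>\<^bsub>M\<^esub> y"
        by auto
      have "a \<oplus>\<^bsub>M\<^esub> b = (r \<oplus>\<^bsub>R\<^esub> r') \<odot>\<^bsub>M\<^esub> x \<oplus>\<^bsub>M\<^esub> (s \<oplus>\<^bsub>R\<^esub> s') \<odot>\<^bsub>M\<^esub> y"
        using a b x y by (simp add: smult_l_distr M.a_ac)
      then show "a \<oplus>\<^bsub>M\<^esub> b \<in> ?D" using a b by blast
    }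
    fix t assume t: "t \<in> carrier R"
    have "t \<odot>\<^bsub>M\<^esub> a = (t \<otimes>\<^bsub>R\<^esub> r) \<odot>\<^bsub>M\<^esub> x \<oplus>\<^bsub>M\<^esub> (t \<otimes>\<^bsub>R\<^esub> s) \<odot>\<^bsub>M\<^esub> y"
      using a t x y by (simp add: smult_r_distr smult_assoc1)
    then show "t \<odot>\<^bsub>M\<^esub> a \<in> ?D" using a t by blast
  }
qed

end

lemma (in abelian_group) eq_if_diff_zero:
  assumes "u \<in> carrier G" "v \<in> carrier G" "u \<oplus> \<ominus> v = \<zero>"
  shows "u = v"
  using assms minus_equality[of u "\<ominus> v"] by simp

section \<open>Counting subspaces over a finite field\<close>

locale finite_field_module = module R M for R :: "('a, 'r) ring_scheme" (structure)
    and M :: "('a, 'b, 'm) module_scheme" (structure) +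
  assumes field: "field R"
    and finite_scalars: "finite (carrier R)"
begin

abbreviation sub :: "'b set \<Rightarrow> bool"
  where "sub U \<equiv> submodule U R M"

definition q :: nat
  where "q = card (carrier R)"

lemma q_gt_1: "q > 1"
proof -
  interpret field R by (rule field)
  have "card {\<zero>\<^bsub>R\<^esub>, \<one>\<^bsub>R\<^esub>} \<le> q"
    unfolding q_def by (intro card_mono finite_scalars) auto
  then show ?thesis by simp
qed

definition adjoin :: "'b set \<Rightarrow> 'b \<Rightarrow> 'b set"
  where "adjoin W v = (\<lambda>(w, r). w \<oplus>\<^bsub>M\<^esub> r \<odot>\<^bsub>M\<^esub> v) ` (W \<times> carrier R)"

lemma adjoin_least: "sub U \<Longrightarrow> W \<subseteq> U \<Longrightarrow> v \<in> U \<Longrightarrow> adjoin W v \<subseteq> U"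
  unfolding adjoin_def by (auto intro!: submoduleE(4,5))

lemma sub_adjoin:
  assumes W: "sub W" and v: "v \<in> carrier M"
  shows "sub (adjoin W v)"
proof (rule submoduleI)
  note c = submodule_in_carrier[OF W] v
  show "adjoin W v \<subseteq> carrier M"
    unfolding adjoin_def using c by auto
  show "\<zero>\<^bsub>M\<^esub> \<in> adjoin W v"
    unfolding adjoin_def using submodule_zero[OF W] v by (auto intro!: image_eqI[of _ _ "(\<zero>\<^bsub>M\<^esub>, \<zero>\<^bsub>R\<^esub>)"])
next
  note c = submodule_in_carrier[OF W] v
  fix a assume "a \<in> adjoin W v"
  then obtain w r where a: "w \<in> W" "r \<in> carrier R" "a = w \<oplus>\<^bsub>M\<^esub> r \<odot>\<^bsub>M\<^esub> v"
    unfolding adjoin_def by auto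
  show "\<ominus>\<^bsub>M\<^esub> a \<in> adjoin W v"
    unfolding adjoin_def using a submoduleE(3)[OF W] c
    by (auto simp: minus_add smult_l_minus intro!: image_eqI[of _ _ "(\<ominus>\<^bsub>M\<^esub> w, \<ominus>\<^bsub>R\<^esub> r)"])
  {
    fix b assume "b \<in> adjoin W v"
    then obtain w' r' where b: "w' \<in> W" "r' \<in> carrier R" "b = w' \<oplus>\<^bsub>M\<^esub> r' \<odot>\<^bsub>M\<^esub> v"
      unfolding adjoin_def by auto
    show "a \<oplus>\<^bsub>M\<^esub> b \<in> adjoin W v"
      unfolding adjoin_def using a b submoduleE(5)[OF W] c
      by (auto simp: smult_l_distr M.a_ac intro!: image_eqI[of _ _ "(w \<oplus>\<^bsub>M\<^esub> w', r \<oplus>\<^bsub>R\<^esub> r')"])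
  }
  fix s assume s: "s \<in> carrier R"
  show "s \<odot>\<^bsub>M\<^esub> a \<in> adjoin W v"
    unfolding adjoin_def using a s submoduleE(4)[OF W] c
    by (auto simp: smult_r_distr smult_assoc1 intro!: image_eqI[of _ _ "(s \<odot>\<^bsub>M\<^esub> w, s \<otimes>\<^bsub>R\<^esub> r)"])
qed

lemma sub_cancel_scalar:
  assumes U: "sub U" and r: "r \<in> carrier R" "r \<noteq> \<zero>\<^bsub>R\<^esub>" and v: "v \<in> carrier M"
    and rv: "r \<odot>\<^bsub>M\<^esub> v \<in> U"
  shows "v \<in> U"
proof -
  interpret field R by (rule field)
  have i: "inv\<^bsub>R\<^esub> r \<in> carrier R" and ir: "inv\<^bsub>R\<^esub> r \<otimes>\<^bsub>R\<^esub> r = \<one>\<^bsub>R\<^esub>"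
    using r field_Units by auto
  have "inv\<^bsub>R\<^esub> r \<odot>\<^bsub>M\<^esub> (r \<odot>\<^bsub>M\<^esub> v) \<in> U"
    using submoduleE(4)[OF U] i rv by blast
  then show ?thesis
    using i r v ir smult_assoc1[of "inv\<^bsub>R\<^esub> r" r v] smult_one[OF v] by simp
qed

lemma adjoin_superset:
  assumes W: "sub W" and v: "v \<in> carrier M"
  shows "W \<subseteq> adjoin W v" and "v \<in> adjoin W v"
proof -
  show "W \<subseteq> adjoin W v"
  proof
    fix w assume "w \<in> W"
    then show "w \<in> adjoin W v"
      unfolding adjoin_def using submodule_in_carrier[OF W] v
      by (auto intro!: image_eqI[of _ _ "(w, \<zero>\<^bsub>R\<^esub>)"])
  qed
  show "v \<in> adjoin W v"
    unfolding adjoin_def using submodule_zero[OF W] v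
    by (auto intro!: image_eqI[of _ _ "(\<zero>\<^bsub>M\<^esub>, \<one>\<^bsub>R\<^esub>)"])
qed

lemma card_adjoin:
  assumes W: "sub W" and v: "v \<in> carrier M" "v \<notin> W"
  shows "card (adjoin W v) = card W * q"
proof -
  have "inj_on (\<lambda>(w, r). w \<oplus>\<^bsub>M\<^esub> r \<odot>\<^bsub>M\<^esub> v) (W \<times> carrier R)"
  proof (rule inj_onI, clarify)
    fix w r w' r'
    assume w: "w \<in> W" "w' \<in> W" and r: "r \<in> carrier R" "r' \<in> carrier R"
      and eq: "w \<oplus>\<^bsub>M\<^esub> r \<odot>\<^bsub>M\<^esub> v = w' \<oplus>\<^bsub>M\<^esub> r' \<odot>\<^bsub>M\<^esub> v"
    note wc = w[THEN submodule_in_carrier[OF W]]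
    let ?r = "r \<ominus>\<^bsub>R\<^esub> r'"
    have "?r \<odot>\<^bsub>M\<^esub> v = r \<odot>\<^bsub>M\<^esub> v \<oplus>\<^bsub>M\<^esub> \<ominus>\<^bsub>M\<^esub> (r' \<odot>\<^bsub>M\<^esub> v)"
      using r v by (simp add: R.minus_eq smult_l_distr smult_l_minus)
    also have "\<dots> = \<ominus>\<^bsub>M\<^esub> w \<oplus>\<^bsub>M\<^esub> (w \<oplus>\<^bsub>M\<^esub> r \<odot>\<^bsub>M\<^esub> v) \<oplus>\<^bsub>M\<^esub> \<ominus>\<^bsub>M\<^esub> (r' \<odot>\<^bsub>M\<^esub> v)"
      using wc r v by (simp add: M.r_neg1)
    also have "\<dots> = \<ominus>\<^bsub>M\<^esub> w \<oplus>\<^bsub>M\<^esub> w'"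
      unfolding eq using wc r v by (simp add: M.a_assoc M.r_neg)
    finally have "?r \<odot>\<^bsub>M\<^esub> v \<in> W"
      using w submoduleE(3,5)[OF W] by simp
    moreover have "?r \<in> carrier R"
      using r by simp
    ultimately have "?r = \<zero>\<^bsub>R\<^esub>"
      using sub_cancel_scalar[OF W _ _ v(1), of ?r] v(2) by blast
    then have "r = r'"
      using r by (simp add: R.r_right_minus_eq)
    then show "w = w' \<and> r = r'"
      using eq wc r v by simp
  qed
  then show ?thesis
    unfolding adjoin_def q_def by (simp add: card_image card_cartesian_product)
qed

text \<open>
  Stands in for dimension theory: relative dimensions are exponents of \<open>q\<close> in cardinalities.
\<close>

lemma card_sub_power:
  assumes "sub W" "sub V" "W \<subseteq> V" "finite V"
  shows "\<exists>d. card V = card W * q ^ d"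
  using assms
proof (induction "card (V - W)" arbitrary: W rule: less_induct)
  case less
  show ?case
  proof (cases "V = W")
    case True
    then show ?thesis by (intro exI[of _ 0]) simp
  next
    case False
    then obtain v where v: "v \<in> V" "v \<notin> W"
      using less.prems by blast
    have vM: "v \<in> carrier M"
      using v submodule_in_carrier[OF \<open>sub V\<close>] by blast
    have "V - adjoin W v \<subset> V - W"
      using adjoin_superset[OF \<open>sub W\<close> vM] v by blast
    then have "card (V - adjoin W v) < card (V - W)"
      using less.prems by (intro psubset_card_mono) auto
    then obtain d where "card V = card (adjoin W v) * q ^ d"
      using less.hyps[OF _ sub_adjoin[OF \<open>sub W\<close> vM]]
        adjoin_least[OF \<open>sub V\<close> \<open>W \<subseteq> V\<close> v(1)] less.prems by blast
    then show ?thesis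
      using card_adjoin[OF \<open>sub W\<close> vM v(2)] by (intro exI[of _ "Suc d"]) simp
  qed
qed

lemma sub_singleton_zero: "sub {\<zero>\<^bsub>M\<^esub>}"
  by (rule submoduleI) auto

lemma mem_adjoin: "u \<in> adjoin W v \<longleftrightarrow> (\<exists>w\<in>W. \<exists>r\<in>carrier R. u = w \<oplus>\<^bsub>M\<^esub> r \<odot>\<^bsub>M\<^esub> v)"
  by (auto simp: adjoin_def)

lemma mem_adjoin_zero: "v \<in> carrier M \<Longrightarrow> u \<in> adjoin {\<zero>\<^bsub>M\<^esub>} v \<longleftrightarrow> (\<exists>r\<in>carrier R. u = r \<odot>\<^bsub>M\<^esub> v)"
  by (auto simp: mem_adjoin)

lemma card_adjoin_indep:
  assumes W: "sub W" and v: "v \<in> carrier M"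
    and indep: "\<And>w r. w \<in> W \<Longrightarrow> r \<in> carrier R \<Longrightarrow> w \<oplus>\<^bsub>M\<^esub> r \<odot>\<^bsub>M\<^esub> v = \<zero>\<^bsub>M\<^esub> \<Longrightarrow> r = \<zero>\<^bsub>R\<^esub>"
  shows "card (adjoin W v) = card W * q"
proof (rule card_adjoin[OF W v])
  interpret field R by (rule field)
  show "v \<notin> W"
  proof
    assume "v \<in> W"
    then have "\<ominus>\<^bsub>M\<^esub> v \<in> W" using submoduleE(3)[OF W] by blast
    moreover have "\<ominus>\<^bsub>M\<^esub> v \<oplus>\<^bsub>M\<^esub> \<one>\<^bsub>R\<^esub> \<odot>\<^bsub>M\<^esub> v = \<zero>\<^bsub>M\<^esub>" using v by (simp add: M.l_neg)
    ultimately show False using indep[of "\<ominus>\<^bsub>M\<^esub> v" "\<one>\<^bsub>R\<^esub>"] by simp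
  qed
qed

lemma sub_card_1: "sub U \<Longrightarrow> card U = q ^ 0 \<Longrightarrow> U = {\<zero>\<^bsub>M\<^esub>}"
  using submodule_zero[of U] by (auto simp: card_1_singleton_iff)

lemma sub_nontrivial:
  assumes "sub U" "card U = q ^ d" "d > 0"
  obtains u where "u \<in> U" "u \<noteq> \<zero>\<^bsub>M\<^esub>"
proof -
  have "U \<noteq> {\<zero>\<^bsub>M\<^esub>}"
    using assms one_less_power[OF q_gt_1 \<open>d > 0\<close>] by auto
  then show ?thesis
    using that submodule_zero[OF \<open>sub U\<close>] by blast
qed

lemma sub_card_q:
  assumes U: "sub U" "card U = q" and v: "v \<in> U" "v \<noteq> \<zero>\<^bsub>M\<^esub>"
  shows "U = adjoin {\<zero>\<^bsub>M\<^esub>} v"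
proof -
  have vM: "v \<in> carrier M" using submodule_in_carrier[OF U(1) v(1)] .
  have "card (adjoin {\<zero>\<^bsub>M\<^esub>} v) = q"
    using card_adjoin[OF sub_singleton_zero vM] v(2) by simp
  moreover have "adjoin {\<zero>\<^bsub>M\<^esub>} v \<subseteq> U"
    using adjoin_least[OF U(1)] submodule_zero[OF U(1)] v(1) by blast
  moreover have "finite U"
    using U(2) q_gt_1 by (metis card.infinite not_less_zero)
  ultimately show ?thesis
    using U(2) card_subset_eq by metis
qed

definition between :: "'b set \<Rightarrow> 'b set \<Rightarrow> 'b set set"
  where "between W V = {U. sub U \<and> W \<subseteq> U \<and> U \<subseteq> V}"

lemma finite_between: "finite V \<Longrightarrow> finite (between W V)"
  by (rule finite_subset[of _ "Pow V"]) (auto simp: between_def)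

text \<open>
  Pairs \<open>(U, v)\<close> with \<open>v \<in> U - W\<close> are counted in two ways. For fixed \<open>U\<close> there are
  \<open>|W| (q\<^sup>d\<^sup>+\<^sup>1 - 1)\<close> of them; for fixed \<open>v\<close> the spaces \<open>U\<close> are those above the span of \<open>W\<close> and \<open>v\<close>,
  so that the induction hypothesis applies. The resulting recursion is \<open>gauss_absorption\<close>.
\<close>

theorem card_between:
  assumes "sub W" "sub V" "W \<subseteq> V" "finite V" "card V = card W * q ^ n"
  shows "of_nat (card {U \<in> between W V. card U = card W * q ^ d}) =
    gauss_binomial (of_nat q :: 'k::{idom, ring_char_0}) n d"
  using assms
proof (induction d arbitrary: n W)
  case 0
  have "{U \<in> between W V. card U = card W * q ^ 0} = {W}"
    using 0 finite_subset[OF _ \<open>finite V\<close>]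
    by (auto simp: between_def dest!: card_subset_eq[rotated])
  then show ?case by simp
next
  case (Suc d)
  have finW: "finite W" using Suc.prems finite_subset by blast
  then have W0: "card W > 0"
    using submodule_zero[OF \<open>sub W\<close>] by (auto simp: card_gt_0_iff)
  show ?case
  proof (cases n)
    case 0
    have "card U \<noteq> card W * q ^ Suc d" if "U \<in> between W V" for U
    proof -
      have "card U \<le> card V"
        using that card_mono[OF \<open>finite V\<close>] by (auto simp: between_def)
      also have "\<dots> = card W * 1"
        using 0 Suc.prems by simp
      also have "\<dots> < card W * q ^ Suc d"
        using W0 one_less_power[OF q_gt_1, of "Suc d"] by (intro mult_strict_left_mono) blast+
      finally show ?thesis by simp
    qed
    then have "{U \<in> between W V. card U = card W * q ^ Suc d} = {}" by blast
    then show ?thesis using 0 by (simp only: card.empty gauss_binomial.simps of_nat_0)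
  next
    case n: (Suc n')
    define S where "S = {U \<in> between W V. card U = card W * q ^ Suc d}"
    have finS: "finite S" unfolding S_def using finite_between Suc.prems by simp
    have pairs: "(\<Sum>U\<in>S. card {v \<in> V - W. v \<in> U}) = (\<Sum>v\<in>V - W. card {U \<in> S. v \<in> U})"
      using finS \<open>finite V\<close> by (intro sum_multicount_gen) auto
    have per_v: "of_nat (card {U \<in> S. v \<in> U}) = gauss_binomial (of_nat q :: 'k) n' d"
      if v: "v \<in> V - W" for v
    proof -
      have vM: "v \<in> carrier M" using v submodule_in_carrier[OF \<open>sub V\<close>] by blast
      have c: "card (adjoin W v) = card W * q"
        using card_adjoin[OF \<open>sub W\<close> vM] v by blast
      have "{U \<in> S. v \<in> U} = {U \<in> between (adjoin W v) V. card U = card (adjoin W v) * q ^ d}"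
        unfolding S_def between_def c
        using adjoin_superset[OF \<open>sub W\<close> vM] adjoin_least[of _ W v] by auto
      then show ?thesis
        using Suc.IH[OF sub_adjoin[OF \<open>sub W\<close> vM] \<open>sub V\<close>
            adjoin_least[OF \<open>sub V\<close> \<open>W \<subseteq> V\<close>] \<open>finite V\<close>, of n'] v Suc.prems(5) n c
        by simp
    qed
    have per_U: "of_nat (card {v \<in> V - W. v \<in> U}) = of_nat (card W) * (of_nat q ^ Suc d - 1 :: 'k)"
      if U: "U \<in> S" for U
    proof -
      have "{v \<in> V - W. v \<in> U} = U - W" "W \<subseteq> U" and cU: "card U = card W * q ^ Suc d"
        using U by (auto simp: S_def between_def)
      then have "card U = card {v \<in> V - W. v \<in> U} + card W"
        using finW card_mono[OF _ \<open>W \<subseteq> U\<close>] finite_subset[OF _ \<open>finite V\<close>, of U] U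
        by (simp add: card_Diff_subset S_def between_def)
      then have "of_nat (card {v \<in> V - W. v \<in> U}) + of_nat (card W) = (of_nat (card U) :: 'k)"
        by simp
      then show ?thesis
        unfolding cU by (simp add: algebra_simps eq_diff_eq)
    qed
    have "(\<Sum>U\<in>S. of_nat (card W) * (of_nat q ^ Suc d - 1)) =
        (of_nat (\<Sum>U\<in>S. card {v \<in> V - W. v \<in> U}) :: 'k)"
      unfolding of_nat_sum by (rule sum.cong[OF refl], rule per_U[symmetric])
    also have "\<dots> = (\<Sum>v\<in>V - W. gauss_binomial (of_nat q) n' d)"
      unfolding pairs of_nat_sum by (rule sum.cong[OF refl], rule per_v)
    finally have "of_nat (card S) * (of_nat (card W) * (of_nat q ^ Suc d - 1)) =
        (of_nat (card (V - W)) * gauss_binomial (of_nat q) n' d :: 'k)"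
      by (simp only: sum_constant)
    moreover have "of_nat (card (V - W)) = of_nat (card W) * (of_nat q ^ Suc n' - 1 :: 'k)"
    proof -
      have "card V = card (V - W) + card W"
        using finW card_mono[OF \<open>finite V\<close> \<open>W \<subseteq> V\<close>] Suc.prems by (simp add: card_Diff_subset)
      then have "of_nat (card (V - W)) + of_nat (card W) = (of_nat (card V) :: 'k)"
        by simp
      then show ?thesis
        unfolding Suc.prems(5) n by (simp add: algebra_simps eq_diff_eq)
    qed
    ultimately have cancel: "of_nat (card W) * ((of_nat q ^ Suc d - 1) * of_nat (card S)) =
        of_nat (card W) * ((of_nat q ^ Suc d - 1) * gauss_binomial (of_nat q :: 'k) n (Suc d))"
      unfolding n gauss_absorption by (simp only: mult_ac)
    have "of_nat q ^ Suc d - 1 \<noteq> (0 :: 'k)"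
    proof -
      have "of_nat (q ^ Suc d) \<noteq> (of_nat 1 :: 'k)"
        unfolding of_nat_eq_iff using one_less_power[OF q_gt_1, of "Suc d"] by linarith
      then show ?thesis by simp
    qed
    moreover have "of_nat (card W) \<noteq> (0 :: 'k)"
      using W0 by simp
    ultimately have "of_nat (card S) = gauss_binomial (of_nat q :: 'k) n (Suc d)"
      using cancel unfolding mult_cancel_left by blast
    then show ?thesis
      unfolding S_def .
  qed
qed

lemma sum_between:
  fixes F :: "nat \<Rightarrow> 'k::{idom, ring_char_0}"
  assumes W: "sub W" "card W = q ^ e" and V: "sub V" "finite V" "card V = q ^ n" and "W \<subseteq> V"
  shows "(\<Sum>U\<in>between W V. F (card U)) =
    (\<Sum>d = e..n. gauss_binomial (of_nat q) (n - e) (d - e) * F (q ^ d))"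
proof -
  have inj: "q ^ i = q ^ j \<longleftrightarrow> i = j" for i j
    using q_gt_1 by simp
  have "q ^ e \<le> q ^ n"
    using card_mono[OF \<open>finite V\<close> \<open>W \<subseteq> V\<close>] W V by simp
  then have "e \<le> n"
    using q_gt_1 by (simp add: power_increasing_iff)
  have finb: "finite (between W V)"
    using finite_between V by blast
  have "\<exists>d\<in>{e..n}. card U = q ^ d" if "U \<in> between W V" for U
  proof -
    have U: "sub U" "W \<subseteq> U" "U \<subseteq> V" "finite U"
      using that V finite_subset by (auto simp: between_def)
    obtain d where d: "card U = card W * q ^ d"
      using card_sub_power[OF W(1) U(1,2,4)] by blast
    have "q ^ (e + d) \<le> q ^ n"
      using card_mono[OF \<open>finite V\<close> \<open>U \<subseteq> V\<close>] d W V by (simp add: power_add)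
    then have "e + d \<le> n"
      using q_gt_1 by (simp add: power_increasing_iff)
    then show ?thesis
      using d W by (intro bexI[of _ "e + d"]) (auto simp: power_add)
  qed
  then have "between W V = (\<Union>d\<in>{e..n}. {U \<in> between W V. card U = q ^ d})" by blast
  then have "(\<Sum>U\<in>between W V. F (card U)) =
      (\<Sum>U\<in>(\<Union>d\<in>{e..n}. {U \<in> between W V. card U = q ^ d}). F (card U))" by simp
  also have "\<dots> = (\<Sum>d = e..n. \<Sum>U | U \<in> between W V \<and> card U = q ^ d. F (card U))"
    using finb inj by (intro sum.UNION_disjoint) auto
  also have "\<dots> = (\<Sum>d = e..n. gauss_binomial (of_nat q) (n - e) (d - e) * F (q ^ d))"
  proof (rule sum.cong[OF refl])
    fix d assume d: "d \<in> {e..n}"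
    have "of_nat (card {U \<in> between W V. card U = card W * q ^ (d - e)}) =
        gauss_binomial (of_nat q :: 'k) (n - e) (d - e)"
      using W V \<open>e \<le> n\<close> \<open>W \<subseteq> V\<close> by (intro card_between) (auto simp flip: power_add)
    moreover have "card W * q ^ (d - e) = q ^ d"
      using W d by (simp flip: power_add)
    ultimately show "(\<Sum>U | U \<in> between W V \<and> card U = q ^ d. F (card U)) =
        gauss_binomial (of_nat q) (n - e) (d - e) * F (q ^ d)"
      by simp
  qed
  finally show ?thesis .
qed

end

context finite_field_module
begin

section \<open>Chains of subspaces\<close>

text \<open>
  Sequences of subspaces \<open>J k, \<dots>, J (k + m - 1)\<close>, one in each level \<open>V j\<close>, such that each contains the
  image under \<open>T\<close> of the one before; \<open>W\<close> is what the first one must contain. The value \<open>{}\<close> elsewhere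
  makes a chain determined by its members.
\<close>

definition chains :: "(nat \<Rightarrow> 'b set) \<Rightarrow> ('b set \<Rightarrow> 'b set) \<Rightarrow> nat \<Rightarrow> nat \<Rightarrow> 'b set \<Rightarrow> (nat \<Rightarrow> 'b set) set"
  where "chains V T m k W =
    {J. (\<forall>j. j \<notin> {k..<k + m} \<longrightarrow> J j = {}) \<and> (\<forall>j\<in>{k..<k + m}. sub (J j) \<and> J j \<subseteq> V j) \<and>
      (0 < m \<longrightarrow> W \<subseteq> J k) \<and> (\<forall>j. k \<le> j \<and> Suc j < k + m \<longrightarrow> T (J j) \<subseteq> J (Suc j))}"

end

text \<open>
  The generating function of chains over levels of dimension \<open>n k\<close>, \<open>n (k + 1)\<close>, \<dots>, when \<open>T\<close> turns
  dimension \<open>d\<close> in level \<open>k\<close> into dimension \<open>\<tau> k d\<close>, the first space must contain a given space of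
  dimension \<open>e\<close>, and \<open>y\<close> marks codimension. It is polymorphic so that one definition serves both
  as a polynomial in two variables and as its values.
\<close>

primrec chain_sum :: "'a::comm_ring_1 \<Rightarrow> 'a \<Rightarrow> (nat \<Rightarrow> nat) \<Rightarrow> (nat \<Rightarrow> nat \<Rightarrow> nat) \<Rightarrow> nat \<Rightarrow> nat \<Rightarrow> nat \<Rightarrow> 'a"
  where
    "chain_sum q y n \<tau> 0 k e = 1"
  | "chain_sum q y n \<tau> (Suc m) k e =
      (\<Sum>d = e..n k. gauss_binomial q (n k - e) (d - e) * (y ^ (n k - d) * chain_sum q y n \<tau> m (Suc k) (\<tau> k d)))"

context finite_field_module
begin

lemma chains_0: "chains V T 0 k W = {\<lambda>_. {}}"
  by (auto simp: chains_def)

lemma bij_betw_chains_Suc: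
  "bij_betw (\<lambda>J. (J k, J(k := {}))) (chains V T (Suc m) k W)
    (SIGMA U : between W (V k). chains V T m (Suc k) (T U))"
proof (rule bij_betw_byWitness[where f' = "\<lambda>(U, J). J(k := U)"])
  show "\<forall>J\<in>chains V T (Suc m) k W. (case (J k, J(k := {})) of (U, J) \<Rightarrow> J(k := U)) = J"
    by auto
  show "\<forall>UJ\<in>SIGMA U : between W (V k). chains V T m (Suc k) (T U).
      ((case UJ of (U, J) \<Rightarrow> J(k := U)) k, (case UJ of (U, J) \<Rightarrow> J(k := U))(k := {})) = UJ"
    by (auto simp: chains_def fun_eq_iff)
  show "(\<lambda>J. (J k, J(k := {}))) ` chains V T (Suc m) k W \<subseteq>
      (SIGMA U : between W (V k). chains V T m (Suc k) (T U))"
  proof (rule image_subsetI)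
    fix J assume "J \<in> chains V T (Suc m) k W"
    note J = this[unfolded chains_def mem_Collect_eq]
    have out: "J j = {}" if "j \<notin> {k..<k + Suc m}" for j
      using J that by blast
    have sub: "sub (J j)" "J j \<subseteq> V j" if "j \<in> {k..<k + Suc m}" for j
      using J that by blast+
    have W: "W \<subseteq> J k"
      using J by blast
    have T: "T (J j) \<subseteq> J (Suc j)" if "k \<le> j" "Suc j < k + Suc m" for j
      using J that by blast
    have "J(k := {}) \<in> chains V T m (Suc k) (T (J k))"
      unfolding chains_def mem_Collect_eq
    proof (intro conjI allI ballI impI)
      fix j
      show "(J(k := {})) j = {}" if "j \<notin> {Suc k..<Suc k + m}"
        using that out[of j] by (cases "j = k") auto
      show "sub ((J(k := {})) j)" "(J(k := {})) j \<subseteq> V j" if "j \<in> {Suc k..<Suc k + m}"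
        using that sub[of j] by simp_all
      show "T ((J(k := {})) j) \<subseteq> (J(k := {})) (Suc j)" if "Suc k \<le> j \<and> Suc j < Suc k + m"
        using that T[of j] by simp
      show "T (J k) \<subseteq> (J(k := {})) (Suc k)" if "0 < m"
        using that T[of k] by simp
    qed
    then show "(J k, J(k := {})) \<in> (SIGMA U : between W (V k). chains V T m (Suc k) (T U))"
      using sub[of k] W by (auto simp: between_def)
  qed
  show "(\<lambda>(U, J). J(k := U)) ` (SIGMA U : between W (V k). chains V T m (Suc k) (T U)) \<subseteq>
      chains V T (Suc m) k W"
  proof (rule image_subsetI, clarify)
    fix U J assume "U \<in> between W (V k)" and "J \<in> chains V T m (Suc k) (T U)"
    note U = this(1)[unfolded between_def mem_Collect_eq]
      and J = this(2)[unfolded chains_def mem_Collect_eq]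
    show "J(k := U) \<in> chains V T (Suc m) k W"
      unfolding chains_def mem_Collect_eq
    proof (intro conjI allI ballI impI)
      fix j
      show "(J(k := U)) j = {}" if "j \<notin> {k..<k + Suc m}"
        using that J by auto
      show "sub ((J(k := U)) j)" "(J(k := U)) j \<subseteq> V j" if "j \<in> {k..<k + Suc m}"
        using that U J by (cases "j = k"; simp)+
      show "T ((J(k := U)) j) \<subseteq> (J(k := U)) (Suc j)" if "k \<le> j \<and> Suc j < k + Suc m"
        using that J by (cases "j = k") auto
    qed (use U in simp)
  qed
qed

lemma finite_chains:
  assumes "\<And>j. j \<in> {k..<k + m} \<Longrightarrow> finite (V j)"
  shows "finite (chains V T m k W)"
  using assms
proof (induction m arbitrary: k W)
  case (Suc m)
  have "finite (SIGMA U : between W (V k). chains V T m (Suc k) (T U))"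
    using Suc by (intro finite_SigmaI finite_between) auto
  then show ?case
    using bij_betw_finite[OF bij_betw_chains_Suc[of k V T m W]] by blast
qed (simp add: chains_0)

text \<open>
  Removing the first space \<open>U\<close> of a chain leaves a chain that starts above \<open>T U\<close>. By assumption the
  contribution of the latter depends on \<open>U\<close> only through its dimension, so \<open>sum_between\<close> evaluates
  the sum over \<open>U\<close>. The weight \<open>h\<close> is a function of cardinalities, which avoids a dimension function.
\<close>

theorem sum_chains:
  fixes y :: "'k::{idom, ring_char_0}"
  assumes V: "\<And>j. j \<in> {k..<k + m} \<Longrightarrow> sub (V j) \<and> finite (V j) \<and> card (V j) = q ^ n j"
    and T: "\<And>j U d. k \<le> j \<Longrightarrow> Suc j < k + m \<Longrightarrow> sub U \<Longrightarrow> U \<subseteq> V j \<Longrightarrow> card U = q ^ d \<Longrightarrow>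
      sub (T U) \<and> T U \<subseteq> V (Suc j) \<and> card (T U) = q ^ \<tau> j d"
    and h: "\<And>j d. j \<in> {k..<k + m} \<Longrightarrow> d \<le> n j \<Longrightarrow> h j (q ^ d) = y ^ (n j - d)"
    and W: "0 < m \<Longrightarrow> sub W \<and> W \<subseteq> V k \<and> card W = q ^ e"
  shows "(\<Sum>J\<in>chains V T m k W. \<Prod>j\<in>{k..<k + m}. h j (card (J j))) = chain_sum (of_nat q) y n \<tau> m k e"
  using V T h W
proof (induction m arbitrary: k W e)
  case 0
  then show ?case by (simp add: chains_0)
next
  case (Suc m)
  note V = Suc.prems(1) and T = Suc.prems(2) and h = Suc.prems(3) and W = Suc.prems(4)
  let ?S = "SIGMA U : between W (V k). chains V T m (Suc k) (T U)"
  let ?w = "\<lambda>k m J. \<Prod>j\<in>{k..<k + m}. h j (card (J j :: 'b set))"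
  have split: "?w k (Suc m) J = (case (J k, J(k := {})) of (U, J) \<Rightarrow> h k (card U) * ?w (Suc k) m J)"
    for J
  proof -
    have "{k..<k + Suc m} = insert k {Suc k..<Suc k + m}" by auto
    then show ?thesis by simp
  qed
  have "(\<Sum>J\<in>chains V T (Suc m) k W. ?w k (Suc m) J) = (\<Sum>(U, J)\<in>?S. h k (card U) * ?w (Suc k) m J)"
    unfolding split by (rule sum.reindex_bij_betw[OF bij_betw_chains_Suc])
  also have "\<dots> = (\<Sum>U\<in>between W (V k). h k (card U) * (\<Sum>J\<in>chains V T m (Suc k) (T U). ?w (Suc k) m J))"
    using V by (subst sum.Sigma[symmetric]) (auto intro!: finite_between finite_chains simp: sum_distrib_left)
  also have "\<dots> = (\<Sum>U\<in>between W (V k). h k (card U) *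
      (chain_sum (of_nat q) y n \<tau> m (Suc k) (\<tau> k (THE d. card U = q ^ d))))"
  proof (rule sum.cong[OF refl], rule arg_cong[where f = "(*) _"])
    fix U assume "U \<in> between W (V k)"
    then have U: "sub U" "W \<subseteq> U" "U \<subseteq> V k" by (auto simp: between_def)
    then have "finite U" using V[of k] finite_subset by auto
    obtain d' where "card U = card W * q ^ d'"
      using card_sub_power[of W U] U W \<open>finite U\<close> by auto
    then have "card U = q ^ (e + d')"
      using W by (simp add: power_add)
    then obtain d where d: "card U = q ^ d"
      by blast
    then have the: "(THE d. card U = q ^ d) = d"
      using q_gt_1 by (intro the_equality) auto
    show "(\<Sum>J\<in>chains V T m (Suc k) (T U). ?w (Suc k) m J) =
        chain_sum (of_nat q) y n \<tau> m (Suc k) (\<tau> k (THE d. card U = q ^ d))"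
    proof (rule Suc.IH)
      show "sub (T U) \<and> T U \<subseteq> V (Suc k) \<and> card (T U) = q ^ \<tau> k (THE d. card U = q ^ d)" if "0 < m"
        unfolding the using T[of k U d] that U d by simp
      show "sub (V j) \<and> finite (V j) \<and> card (V j) = q ^ n j" if "j \<in> {Suc k..<Suc k + m}" for j
        using that V[of j] by auto
      show "sub (T U) \<and> T U \<subseteq> V (Suc j) \<and> card (T U) = q ^ \<tau> j d"
        if "Suc k \<le> j" "Suc j < Suc k + m" "sub U" "U \<subseteq> V j" "card U = q ^ d" for j U d
        by (rule T) (use that in auto)
      show "h j (q ^ d) = y ^ (n j - d)" if "j \<in> {Suc k..<Suc k + m}" "d \<le> n j" for j d
        by (rule h) (use that in auto)
    qed
  qed
  also have "\<dots> = (\<Sum>d = e..n k. gauss_binomial (of_nat q) (n k - e) (d - e) *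
      (h k (q ^ d) * chain_sum (of_nat q) y n \<tau> m (Suc k) (\<tau> k (THE d'. q ^ d = q ^ d'))))"
    using V[of k] W by (intro sum_between) auto
  also have "\<dots> = chain_sum (of_nat q) y n \<tau> (Suc m) k e"
    using h[of k] q_gt_1 by simp
  finally show ?case .
qed

end

section \<open>Specialising the polynomial\<close>

lemma gauss_hom:
  fixes f :: "'a::comm_ring_1 \<Rightarrow> 'b::comm_ring_1"
  assumes "f 0 = 0" "f 1 = 1" "\<And>x y. f (x + y) = f x + f y" "\<And>x y. f (x * y) = f x * f y"
  shows "f (gauss_binomial q n d) = gauss_binomial (f q) n d"
proof -
  have pow: "f (x ^ k) = f x ^ k" for x k
    using assms by (induction k) auto
  show ?thesis
    by (induction q n d rule: gauss_binomial.induct) (simp_all only: gauss_binomial.simps assms pow)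
qed

lemma chain_sum_hom:
  fixes f :: "'a::comm_ring_1 \<Rightarrow> 'b::comm_ring_1"
  assumes f: "f 0 = 0" "f 1 = 1" "\<And>x y. f (x + y) = f x + f y" "\<And>x y. f (x * y) = f x * f y"
  shows "f (chain_sum q y n \<tau> m k e) = chain_sum (f q) (f y) n \<tau> m k e"
proof -
  have pow: "f (x ^ k) = f x ^ k" for x k
    using f by (induction k) auto
  have sum: "f (sum g A) = (\<Sum>a\<in>A. f (g a))" for g and A :: "nat set"
    using f by (induction A rule: infinite_finite_induct) auto
  show ?thesis
    by (induction m arbitrary: k e) (simp_all add: f sum pow gauss_hom[of f, OF f])
qed

text \<open>
  Evaluation commutes with \<^const>\<open>chain_sum\<close> for the sole reason that it is a ring homomorphism.
\<close>

lemma eval_XY_ring_hom: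
  "eval_XY 0 x y = 0" "eval_XY 1 x y = 1"
  "eval_XY (V + W) x y = eval_XY V x y + eval_XY W x y"
  "eval_XY (V * W) x y = eval_XY V x y * eval_XY W x y"
  "eval_XY [:[:0, 1:]:] x y = x" "eval_XY [:0, 1:] x y = y"
proof -
  let ?f = "\<lambda>q :: rat poly. poly (map_poly of_rat q) x"
  have f_pCons: "?f (pCons a r) = of_rat a + x * ?f r" for a r
    by (simp add: map_poly_pCons)
  have f_add: "?f (r + s) = ?f r + ?f s" for r s
  proof (induction r arbitrary: s)
    case (pCons a r)
    show ?case
      by (cases s) (use pCons in \<open>simp add: f_pCons of_rat_add algebra_simps\<close>)
  qed simp
  have f_smult: "?f (smult a s) = of_rat a * ?f s" for a s
    by (induction s) (simp_all add: f_pCons of_rat_mult algebra_simps)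
  have f_mult: "?f (r * s) = ?f r * ?f s" for r s
    by (induction r) (simp_all add: f_add f_smult map_poly_pCons algebra_simps)
  have e_0: "eval_XY 0 x y = 0"
    by (simp add: eval_XY_def)
  have e_pCons: "eval_XY (pCons a V) x y = ?f a + y * eval_XY V x y" for a V
    by (simp add: eval_XY_def map_poly_pCons)
  have e_add: "eval_XY (V + W) x y = eval_XY V x y + eval_XY W x y" for V W
  proof (induction V arbitrary: W)
    case (pCons a V)
    show ?case
      by (cases W) (use pCons in \<open>simp add: e_pCons f_add algebra_simps\<close>)
  qed (simp add: e_0)
  have e_smult: "eval_XY (smult a W) x y = ?f a * eval_XY W x y" for a W
    by (induction W) (simp_all add: e_0 e_pCons f_mult algebra_simps)
  show "eval_XY (V * W) x y = eval_XY V x y * eval_XY W x y"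
    by (induction V) (simp_all add: e_0 e_add e_smult e_pCons algebra_simps)
  show "eval_XY 0 x y = 0" by (rule e_0)
  show "eval_XY (V + W) x y = eval_XY V x y + eval_XY W x y" by (rule e_add)
  show "eval_XY 1 x y = 1" "eval_XY [:[:0, 1:]:] x y = x" "eval_XY [:0, 1:] x y = y"
    by (simp_all add: one_pCons e_pCons e_0 map_poly_pCons)
qed

lemma of_nat_prod_powr:
  "finite K \<Longrightarrow> of_nat (\<Prod>k\<in>K. f k) powr s = (\<Prod>k\<in>K. of_nat (f k) powr (s :: complex))"
proof (induction K rule: finite_induct)
  case (insert k K)
  have "of_nat (f k * (\<Prod>k\<in>K. f k)) powr s = of_nat (f k) powr s * of_nat (\<Prod>k\<in>K. f k) powr s"
    unfolding of_nat_mult by (intro powr_times_real) (simp_all del: of_nat_prod)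
  then show ?case using insert by simp
qed simp

lemma of_nat_power_powr: "of_nat (n ^ k) powr s = (of_nat n powr (s :: complex)) ^ k"
  using of_nat_prod_powr[of "{..<k}" "\<lambda>_. n" s] by simp

section \<open>Algebras with a bilinear product and their quotients\<close>

locale bilinear_algebra = module R A for R :: "('a, 'r) ring_scheme" (structure)
    and A :: "('a, 'b, 'm) module_scheme" (structure) +
  assumes mult_closed [simp, intro]:
      "\<lbrakk>x \<in> carrier A; y \<in> carrier A\<rbrakk> \<Longrightarrow> x \<otimes>\<^bsub>A\<^esub> y \<in> carrier A"
    and mult_add_left:
      "\<lbrakk>x \<in> carrier A; y \<in> carrier A; z \<in> carrier A\<rbrakk> \<Longrightarrow>
        (x \<oplus>\<^bsub>A\<^esub> y) \<otimes>\<^bsub>A\<^esub> z = x \<otimes>\<^bsub>A\<^esub> z \<oplus>\<^bsub>A\<^esub> y \<otimes>\<^bsub>A\<^esub> z"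
    and mult_add_right:
      "\<lbrakk>x \<in> carrier A; y \<in> carrier A; z \<in> carrier A\<rbrakk> \<Longrightarrow>
        z \<otimes>\<^bsub>A\<^esub> (x \<oplus>\<^bsub>A\<^esub> y) = z \<otimes>\<^bsub>A\<^esub> x \<oplus>\<^bsub>A\<^esub> z \<otimes>\<^bsub>A\<^esub> y"
    and mult_smult_left:
      "\<lbrakk>r \<in> carrier R; x \<in> carrier A; y \<in> carrier A\<rbrakk> \<Longrightarrow>
        (r \<odot>\<^bsub>A\<^esub> x) \<otimes>\<^bsub>A\<^esub> y = r \<odot>\<^bsub>A\<^esub> (x \<otimes>\<^bsub>A\<^esub> y)"
    and mult_smult_right:
      "\<lbrakk>r \<in> carrier R; x \<in> carrier A; y \<in> carrier A\<rbrakk> \<Longrightarrow>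
        x \<otimes>\<^bsub>A\<^esub> (r \<odot>\<^bsub>A\<^esub> y) = r \<odot>\<^bsub>A\<^esub> (x \<otimes>\<^bsub>A\<^esub> y)"
begin

lemma mult_zero_left [simp]: "x \<in> carrier A \<Longrightarrow> \<zero>\<^bsub>A\<^esub> \<otimes>\<^bsub>A\<^esub> x = \<zero>\<^bsub>A\<^esub>"
  using mult_smult_left[of "\<zero>\<^bsub>R\<^esub>" "\<zero>\<^bsub>A\<^esub>" x] by simp

lemma mult_zero_right [simp]: "x \<in> carrier A \<Longrightarrow> x \<otimes>\<^bsub>A\<^esub> \<zero>\<^bsub>A\<^esub> = \<zero>\<^bsub>A\<^esub>"
  using mult_smult_right[of "\<zero>\<^bsub>R\<^esub>" x "\<zero>\<^bsub>A\<^esub>"] by simp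

lemma mult_minus_left:
  assumes "x \<in> carrier A" "y \<in> carrier A"
  shows "(\<ominus>\<^bsub>A\<^esub> x) \<otimes>\<^bsub>A\<^esub> y = \<ominus>\<^bsub>A\<^esub> (x \<otimes>\<^bsub>A\<^esub> y)"
proof -
  have "(\<ominus>\<^bsub>A\<^esub> x) \<otimes>\<^bsub>A\<^esub> y \<oplus>\<^bsub>A\<^esub> x \<otimes>\<^bsub>A\<^esub> y = \<zero>\<^bsub>A\<^esub>"
    using assms mult_add_left[of "\<ominus>\<^bsub>A\<^esub> x" x y] by (simp add: M.l_neg)
  then show ?thesis
    using assms by (simp add: M.minus_equality)
qed

lemma mult_minus_right:
  assumes "x \<in> carrier A" "y \<in> carrier A"
  shows "x \<otimes>\<^bsub>A\<^esub> (\<ominus>\<^bsub>A\<^esub> y) = \<ominus>\<^bsub>A\<^esub> (x \<otimes>\<^bsub>A\<^esub> y)"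
proof -
  have "x \<otimes>\<^bsub>A\<^esub> (\<ominus>\<^bsub>A\<^esub> y) \<oplus>\<^bsub>A\<^esub> x \<otimes>\<^bsub>A\<^esub> y = \<zero>\<^bsub>A\<^esub>"
    using assms mult_add_right[of "\<ominus>\<^bsub>A\<^esub> y" y x] by (simp add: M.l_neg)
  then show ?thesis
    using assms by (simp add: M.minus_equality)
qed

lemma alg_ideal_hull:
  assumes "S \<subseteq> carrier A"
  shows "alg_ideal R A (alg_ideal R A hull S)"
proof -
  have carrier: "alg_ideal R A (carrier A)"
    using carrier_is_submodule by (auto simp: alg_ideal_def)
  have "submodule (alg_ideal R A hull S) R A"
    unfolding hull_def using carrier assms by (intro submodule_Inter) (auto simp: alg_ideal_def)
  then show ?thesis
    by (auto simp: alg_ideal_def hull_def)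
qed

end

locale algebra_quotient = bilinear_algebra R A for R :: "('a, 'r) ring_scheme" (structure)
    and A :: "('a, 'b, 'm) module_scheme" (structure) +
  fixes I :: "'b set"
  assumes ideal: "alg_ideal R A I"
begin

abbreviation Q :: "('a, 'b set) module"
  where "Q \<equiv> quot_alg A I"

abbreviation proj :: "'b \<Rightarrow> 'b set"
  where "proj a \<equiv> I +>\<^bsub>A\<^esub> a"

lemma sub: "submodule I R A"
  using ideal by (simp add: alg_ideal_def)

lemma ideal_left: "x \<in> carrier A \<Longrightarrow> a \<in> I \<Longrightarrow> x \<otimes>\<^bsub>A\<^esub> a \<in> I"
  and ideal_right: "x \<in> carrier A \<Longrightarrow> a \<in> I \<Longrightarrow> a \<otimes>\<^bsub>A\<^esub> x \<in> I"
  using ideal by (simp_all add: alg_ideal_def)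

sublocale abelian_subgroup I A
  using submodule.axioms(1)[OF sub] M.abelian_group_axioms
  by (intro abelian_subgroupI3 additive_subgroupI)

lemma proj_eq_iff:
  assumes "a \<in> carrier A" "b \<in> carrier A"
  shows "proj a = proj b \<longleftrightarrow> a \<ominus>\<^bsub>A\<^esub> b \<in> I"
proof -
  have "proj a = proj b \<longleftrightarrow> a \<in> proj b"
    using assms a_rcos_self[of a] M.a_repr_independence[OF _ _ a_subgroup] by blast
  then show ?thesis
    using a_rcos_module[OF assms(2,1)] by (simp add: M.minus_eq)
qed

lemma proj_eq_zero: "a \<in> carrier A \<Longrightarrow> proj a = I \<longleftrightarrow> a \<in> I"
  using M.a_coset_join1 M.a_coset_join2 a_subgroup by blast

lemma mem_proj: "a \<in> carrier A \<Longrightarrow> b \<in> proj a \<longleftrightarrow> b \<in> carrier A \<and> proj b = proj a"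
  using a_rcos_self[of b] M.a_repr_independence[OF _ _ a_subgroup, of b a]
    M.a_r_coset_subset_G[OF a_subset, of a] by blast

lemma UN_proj:
  assumes a: "a \<in> carrier A" and "\<And>b. b \<in> carrier A \<Longrightarrow> proj b = proj a \<Longrightarrow> f b = c"
  shows "(\<Union>b\<in>proj a. f b) = c"
proof -
  have "f b = c" if "b \<in> proj a" for b
    using that mem_proj[OF a] assms(2) by blast
  moreover have "a \<in> proj a"
    using a mem_proj by blast
  ultimately show ?thesis by auto
qed

text \<open>
  The operations of the quotient are unions over all representatives; this and the next lemma
  say that the choice of representative does not matter, which collapses the unions.
\<close>

lemma proj_smult_cong:
  assumes "a \<in> carrier A" "b \<in> carrier A" "proj b = proj a" "r \<in> carrier R"
  shows "proj (r \<odot>\<^bsub>A\<^esub> b) = proj (r \<odot>\<^bsub>A\<^esub> a)"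
proof -
  have "r \<odot>\<^bsub>A\<^esub> (b \<ominus>\<^bsub>A\<^esub> a) \<in> I"
    using assms submoduleE(4)[OF sub] by (simp add: proj_eq_iff)
  then show ?thesis
    using assms by (simp add: proj_eq_iff M.minus_eq smult_r_distr smult_r_minus)
qed

lemma proj_mult_cong:
  assumes "a \<in> carrier A" "a' \<in> carrier A" "proj a' = proj a"
    and "b \<in> carrier A" "b' \<in> carrier A" "proj b' = proj b"
  shows "proj (a' \<otimes>\<^bsub>A\<^esub> b') = proj (a \<otimes>\<^bsub>A\<^esub> b)"
proof -
  have "(a' \<ominus>\<^bsub>A\<^esub> a) \<otimes>\<^bsub>A\<^esub> b' \<in> I" and "a \<otimes>\<^bsub>A\<^esub> (b' \<ominus>\<^bsub>A\<^esub> b) \<in> I"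
    using assms by (simp_all add: proj_eq_iff ideal_left ideal_right)
  then have "proj (a' \<otimes>\<^bsub>A\<^esub> b') = proj (a \<otimes>\<^bsub>A\<^esub> b')" "proj (a \<otimes>\<^bsub>A\<^esub> b') = proj (a \<otimes>\<^bsub>A\<^esub> b)"
    using assms
    by (simp_all add: proj_eq_iff M.minus_eq mult_add_left mult_add_right mult_minus_left mult_minus_right)
  then show ?thesis by simp
qed

lemma carrier_Q: "carrier Q = proj ` carrier A"
  by (auto simp: quot_alg_def A_RCOSETS_def')

lemma zero_Q: "\<zero>\<^bsub>Q\<^esub> = proj \<zero>\<^bsub>A\<^esub>"
  using a_subset by (simp add: quot_alg_def)

lemma zero_Q': "\<zero>\<^bsub>Q\<^esub> = I"
  by (simp add: quot_alg_def)

lemma add_Q: "a \<in> carrier A \<Longrightarrow> b \<in> carrier A \<Longrightarrow> proj a \<oplus>\<^bsub>Q\<^esub> proj b = proj (a \<oplus>\<^bsub>A\<^esub> b)"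
  by (simp add: quot_alg_def a_rcos_sum)

lemma smult_Q:
  assumes "r \<in> carrier R" "a \<in> carrier A"
  shows "r \<odot>\<^bsub>Q\<^esub> proj a = proj (r \<odot>\<^bsub>A\<^esub> a)"
proof -
  have "(\<Union>b\<in>proj a. proj (r \<odot>\<^bsub>A\<^esub> b)) = proj (r \<odot>\<^bsub>A\<^esub> a)"
    using assms by (intro UN_proj proj_smult_cong)
  then show ?thesis
    by (simp add: quot_alg_def)
qed

lemma mult_Q:
  assumes "a \<in> carrier A" "b \<in> carrier A"
  shows "proj a \<otimes>\<^bsub>Q\<^esub> proj b = proj (a \<otimes>\<^bsub>A\<^esub> b)"
proof -
  have "(\<Union>a'\<in>proj a. \<Union>b'\<in>proj b. proj (a' \<otimes>\<^bsub>A\<^esub> b')) = proj (a \<otimes>\<^bsub>A\<^esub> b)"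
    using assms by (intro UN_proj proj_mult_cong)
  then show ?thesis
    by (simp add: quot_alg_def rcoset_mult_def)
qed

lemmas Q_simps = add_Q smult_Q mult_Q

lemma bilinear_algebra_Q: "bilinear_algebra R Q"
proof (intro bilinear_algebra.intro bilinear_algebra_axioms.intro moduleI)
  show "cring R" by (rule R.cring_axioms)
  show "abelian_group Q"
  proof (rule abelian_groupI)
    show "\<exists>y\<in>carrier Q. y \<oplus>\<^bsub>Q\<^esub> x = \<zero>\<^bsub>Q\<^esub>" if x: "x \<in> carrier Q" for x
    proof -
      obtain a where "a \<in> carrier A" "x = proj a"
        using x by (auto simp: carrier_Q)
      then show ?thesis
        by (intro bexI[of _ "proj (\<ominus>\<^bsub>A\<^esub> a)"]) (auto simp: carrier_Q add_Q zero_Q M.l_neg)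
    qed
  qed (auto simp: carrier_Q zero_Q Q_simps M.a_ac)
qed (auto simp: carrier_Q Q_simps smult_l_distr smult_r_distr smult_assoc1
    mult_add_left mult_add_right mult_smult_left mult_smult_right)

lemma submodule_vimage_proj:
  assumes "submodule S R Q"
  shows "submodule {a \<in> carrier A. proj a \<in> S} R A"
proof -
  interpret Q: bilinear_algebra R Q by (rule bilinear_algebra_Q)
  note S = Q.submoduleE[OF assms] Q.submodule_zero[OF assms]
  have minus: "proj (\<ominus>\<^bsub>A\<^esub> a) = \<ominus>\<^bsub>Q\<^esub> proj a" if "a \<in> carrier A" for a
    using that by (intro Q.M.minus_equality[symmetric]) (auto simp: add_Q zero_Q carrier_Q M.l_neg)
  show ?thesis
    using S by (intro submoduleI) (auto simp: minus zero_Q simp flip: Q_simps)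
qed

end

section \<open>Expansion into noncommutative words\<close>

text \<open>
  The product of noncommutative power series \<open>f\<close> and \<open>g\<close>, given by their coefficients: the
  coefficient of \<open>w\<close> is the sum of \<open>f u * g v\<close> over all factorisations \<open>w = u @ v\<close>. The recursion on \<open>w\<close>
  makes bilinearity and associativity plain inductions.
\<close>

primrec conv :: "('x list \<Rightarrow> int) \<Rightarrow> ('x list \<Rightarrow> int) \<Rightarrow> 'x list \<Rightarrow> int"
  where
    "conv f g [] = f [] * g []"
  | "conv f g (x # w) = f [] * g (x # w) + conv (\<lambda>u. f (x # u)) g w"

lemma conv_add_left: "conv (\<lambda>u. f u + f' u) g w = conv f g w + conv f' g w"
  by (induction w arbitrary: f f') (simp_all add: algebra_simps)

lemma conv_scale_left: "conv (\<lambda>u. r * f u) g w = r * conv f g w"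
  by (induction w arbitrary: f) (simp_all add: algebra_simps)

lemma conv_add_right: "conv f (\<lambda>u. g u + g' u) w = conv f g w + conv f g' w"
  by (induction w arbitrary: f) (simp_all add: algebra_simps)

lemma conv_scale_right: "conv f (\<lambda>u. r * g u) w = r * conv f g w"
  by (induction w arbitrary: f) (simp_all add: algebra_simps)

lemma conv_diff_left: "conv (\<lambda>u. f u - f' u) g w = conv f g w - conv f' g w"
  by (induction w arbitrary: f f') (simp_all add: algebra_simps)

lemma conv_diff_right: "conv f (\<lambda>u. g u - g' u) w = conv f g w - conv f g' w"
  by (induction w arbitrary: f) (simp_all add: algebra_simps)

lemma conv_sum_left: "conv (\<lambda>u. \<Sum>a\<in>S. r a * f a u) g w = (\<Sum>a\<in>S. r a * conv (f a) g w)"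
proof (induction S rule: infinite_finite_induct)
  case empty
  show ?case using conv_scale_left[of 0 "\<lambda>_. 0" g w] by simp
next
  case (infinite S)
  then show ?case using conv_scale_left[of 0 "\<lambda>_. 0" g w] by simp
qed (simp add: conv_add_left conv_scale_left)

lemma conv_sum_right: "conv f (\<lambda>u. \<Sum>a\<in>S. r a * g a u) w = (\<Sum>a\<in>S. r a * conv f (g a) w)"
proof (induction S rule: infinite_finite_induct)
  case empty
  show ?case using conv_scale_right[of f 0 "\<lambda>_. 0" w] by simp
next
  case (infinite S)
  then show ?case using conv_scale_right[of f 0 "\<lambda>_. 0" w] by simp
qed (simp add: conv_add_right conv_scale_right)

lemma conv_assoc: "conv (conv f g) h w = conv f (conv g h) w"
  by (induction w arbitrary: f g) (simp_all add: conv_add_left conv_scale_left algebra_simps)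

lemma conv_cong:
  assumes "\<And>u. length u \<le> length w \<Longrightarrow> [f u = f' u] (mod m)"
    and "\<And>u. length u \<le> length w \<Longrightarrow> [g u = g' u] (mod m)"
  shows "[conv f g w = conv f' g' w] (mod m)"
  using assms
proof (induction w arbitrary: f f')
  case (Cons x w)
  have "[conv (\<lambda>u. f (x # u)) g w = conv (\<lambda>u. f' (x # u)) g' w] (mod m)"
    using Cons.prems by (intro Cons.IH) auto
  then show ?case
    using Cons.prems by (auto intro!: cong_add cong_mult)
qed (simp add: cong_mult)

definition comm :: "('x list \<Rightarrow> int) \<Rightarrow> ('x list \<Rightarrow> int) \<Rightarrow> 'x list \<Rightarrow> int"
  where "comm f g w = conv f g w - conv g f w"

lemma comm_cong:
  assumes "\<And>u. length u \<le> length w \<Longrightarrow> [f u = f' u] (mod m)"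
    and "\<And>u. length u \<le> length w \<Longrightarrow> [g u = g' u] (mod m)"
  shows "[comm f g w = comm f' g' w] (mod m)"
  unfolding comm_def using assms by (intro cong_diff conv_cong)

text \<open>
  Expanding leaves twelve terms, which cancel in pairs by \<open>conv_assoc\<close>.
\<close>

lemma comm_jacobi: "comm f (comm g h) w + comm g (comm h f) w + comm h (comm f g) w = 0"
  unfolding comm_def[abs_def] by (simp add: conv_diff_left conv_diff_right conv_assoc)

text \<open>
  A Lie homomorphism from \<open>A\<close> to noncommutative power series without constant term over the
  integers modulo \<open>m\<close>, truncated after degree \<open>c\<close>, that sends each generator to the corresponding letter. The coefficients are integers
  that matter only modulo \<open>m\<close>; this avoids arithmetic in the residue ring and makes it possible to
  choose representatives arbitrarily when passing to a quotient.
\<close>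

definition word_rep ::
    "int \<Rightarrow> nat \<Rightarrow> (int, 'b, 'm) module_scheme \<Rightarrow> ('x \<Rightarrow> 'b) \<Rightarrow> ('b \<Rightarrow> 'x list \<Rightarrow> int) \<Rightarrow> bool"
  where "word_rep m c A g \<Phi> \<longleftrightarrow>
    (\<forall>a\<in>carrier A. \<forall>b\<in>carrier A. \<forall>w. length w \<le> c \<longrightarrow>
      [\<Phi> (a \<oplus>\<^bsub>A\<^esub> b) w = \<Phi> a w + \<Phi> b w] (mod m) \<and>
      [\<Phi> (a \<otimes>\<^bsub>A\<^esub> b) w = comm (\<Phi> a) (\<Phi> b) w] (mod m)) \<and>
    (\<forall>r\<in>{0..m - 1}. \<forall>a\<in>carrier A. \<forall>w. length w \<le> c \<longrightarrow> [\<Phi> (r \<odot>\<^bsub>A\<^esub> a) w = r * \<Phi> a w] (mod m)) \<and>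
    (\<forall>a\<in>carrier A. [\<Phi> a [] = 0] (mod m)) \<and>
    (\<forall>x w. length w \<le> c \<longrightarrow> [\<Phi> (g x) w = (if w = [x] then 1 else 0)] (mod m))"

lemma word_repD:
  assumes "word_rep m c A g \<Phi>" and "length w \<le> c"
  shows "a \<in> carrier A \<Longrightarrow> b \<in> carrier A \<Longrightarrow> [\<Phi> (a \<oplus>\<^bsub>A\<^esub> b) w = \<Phi> a w + \<Phi> b w] (mod m)"
    and "a \<in> carrier A \<Longrightarrow> b \<in> carrier A \<Longrightarrow> [\<Phi> (a \<otimes>\<^bsub>A\<^esub> b) w = comm (\<Phi> a) (\<Phi> b) w] (mod m)"
    and "r \<in> {0..m - 1} \<Longrightarrow> a \<in> carrier A \<Longrightarrow> [\<Phi> (r \<odot>\<^bsub>A\<^esub> a) w = r * \<Phi> a w] (mod m)"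
    and "a \<in> carrier A \<Longrightarrow> [\<Phi> a [] = 0] (mod m)"
    and "[\<Phi> (g x) w = (if w = [x] then 1 else 0)] (mod m)"
  using assms unfolding word_rep_def by simp_all

text \<open>
  Evaluating at an arbitrarily chosen element of a coset works because the expansion is constant
  modulo \<open>m\<close> on cosets of an ideal that it kills.
\<close>

lemma word_rep_quot:
  assumes quot: "algebra_quotient (residue_ring m) A I"
    and rep: "word_rep m c A g \<Phi>" and g: "\<And>x. g x \<in> carrier A"
    and vanish: "\<And>a w. a \<in> I \<Longrightarrow> length w \<le> c \<Longrightarrow> [\<Phi> a w = 0] (mod m)"
  shows "\<exists>\<Psi>. word_rep m c (quot_alg A I) (\<lambda>x. I +>\<^bsub>A\<^esub> g x) \<Psi> \<and>
    (\<forall>a\<in>carrier A. \<forall>w. length w \<le> c \<longrightarrow> [\<Psi> (I +>\<^bsub>A\<^esub> a) w = \<Phi> a w] (mod m))"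
proof (intro exI[of _ "\<lambda>X. \<Phi> (SOME a. a \<in> X)"] conjI)
  interpret algebra_quotient "residue_ring m" A I by (rule quot)
  let ?\<Psi> = "\<lambda>X. \<Phi> (SOME a. a \<in> X)"
  note D = word_repD[OF rep]
  have carrier_R: "carrier (residue_ring m) = {0..m - 1}"
    by (simp add: residue_ring_def)
  have \<Psi>: "[?\<Psi> (proj a) w = \<Phi> a w] (mod m)" if a: "a \<in> carrier A" and w: "length w \<le> c" for a w
  proof -
    have "(SOME b. b \<in> proj a) \<in> proj a"
      using a mem_proj by (intro someI[of "\<lambda>b. b \<in> proj a"]) blast
    then obtain h where h: "h \<in> I" and eq: "(SOME b. b \<in> proj a) = h \<oplus>\<^bsub>A\<^esub> a"
      by (auto simp: a_r_coset_def')
    have "[\<Phi> (h \<oplus>\<^bsub>A\<^esub> a) w = \<Phi> h w + \<Phi> a w] (mod m)"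
      using D(1)[OF w] h a a_subset by blast
    also have "[\<Phi> h w + \<Phi> a w = 0 + \<Phi> a w] (mod m)"
      using vanish[OF h w] by (intro cong_add) auto
    finally show ?thesis
      unfolding eq by simp
  qed
  then show "\<forall>a\<in>carrier A. \<forall>w. length w \<le> c \<longrightarrow> [?\<Psi> (proj a) w = \<Phi> a w] (mod m)"
    by blast
  have h1: "[?\<Psi> (proj a \<oplus>\<^bsub>Q\<^esub> proj b) w = ?\<Psi> (proj a) w + ?\<Psi> (proj b) w] (mod m)"
    if "a \<in> carrier A" "b \<in> carrier A" "length w \<le> c" for a b w
  proof -
    have "[?\<Psi> (proj (a \<oplus>\<^bsub>A\<^esub> b)) w = \<Phi> a w + \<Phi> b w] (mod m)"
      by (rule cong_trans[OF \<Psi> D(1)]) (use that in auto)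
    also have "[\<Phi> a w + \<Phi> b w = ?\<Psi> (proj a) w + ?\<Psi> (proj b) w] (mod m)"
      using that by (intro cong_add cong_sym[OF \<Psi>])
    finally show ?thesis
      using that by (simp add: add_Q)
  qed
  have h2: "[?\<Psi> (proj a \<otimes>\<^bsub>Q\<^esub> proj b) w = comm (?\<Psi> (proj a)) (?\<Psi> (proj b)) w] (mod m)"
    if "a \<in> carrier A" "b \<in> carrier A" "length w \<le> c" for a b w
  proof -
    have "[?\<Psi> (proj (a \<otimes>\<^bsub>A\<^esub> b)) w = comm (\<Phi> a) (\<Phi> b) w] (mod m)"
      by (rule cong_trans[OF \<Psi> D(2)]) (use that in auto)
    also have "[comm (\<Phi> a) (\<Phi> b) w = comm (?\<Psi> (proj a)) (?\<Psi> (proj b)) w] (mod m)"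
      using that by (intro comm_cong cong_sym[OF \<Psi>]) auto
    finally show ?thesis
      using that by (simp add: mult_Q)
  qed
  have h3: "[?\<Psi> (r \<odot>\<^bsub>Q\<^esub> proj a) w = r * ?\<Psi> (proj a) w] (mod m)"
    if "r \<in> {0..m - 1}" "a \<in> carrier A" "length w \<le> c" for r a w
  proof -
    have "[?\<Psi> (proj (r \<odot>\<^bsub>A\<^esub> a)) w = r * \<Phi> a w] (mod m)"
      by (rule cong_trans[OF \<Psi> D(3)]) (use that carrier_R in auto)
    also have "[r * \<Phi> a w = r * ?\<Psi> (proj a) w] (mod m)"
      using that by (intro cong_mult cong_sym[OF \<Psi>] cong_refl)
    finally show ?thesis
      using that carrier_R by (simp add: smult_Q)
  qed
  have h4: "[?\<Psi> (proj a) [] = 0] (mod m)" if "a \<in> carrier A" for a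
    using cong_trans[OF \<Psi>[of a "[]"] D(4)[of "[]" a]] that by simp
  have h5: "[?\<Psi> (proj (g x)) w = (if w = [x] then 1 else 0)] (mod m)" if "length w \<le> c" for x w
    by (rule cong_trans[OF \<Psi> D(5)]) (use that g in auto)
  show "word_rep m c Q (\<lambda>x. proj (g x)) ?\<Psi>"
    unfolding word_rep_def carrier_Q ball_simps by (intro conjI ballI allI impI h1 h2 h3 h4 h5)
qed

section \<open>The free nonassociative algebra\<close>

text \<open>
  Generation is phrased as an induction principle, which is the form that passes to quotients.
\<close>

definition generates :: "('a, 'r) ring_scheme \<Rightarrow> ('a, 'b, 'm) module_scheme \<Rightarrow> ('x \<Rightarrow> 'b) \<Rightarrow> bool"
  where "generates R A g \<longleftrightarrow> range g \<subseteq> carrier A \<and>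
    (\<forall>S. submodule S R A \<and> range g \<subseteq> S \<and> (\<forall>a\<in>S. \<forall>b\<in>S. a \<otimes>\<^bsub>A\<^esub> b \<in> S) \<longrightarrow> carrier A \<subseteq> S)"

lemma (in algebra_quotient) generates_Q:
  assumes "generates R A g"
  shows "generates R Q (\<lambda>x. proj (g x))"
  unfolding generates_def
proof (intro conjI allI impI)
  show "range (\<lambda>x. proj (g x)) \<subseteq> carrier Q"
    using assms by (auto simp: generates_def carrier_Q)
  fix S assume S: "submodule S R Q \<and> range (\<lambda>x. proj (g x)) \<subseteq> S \<and> (\<forall>a\<in>S. \<forall>b\<in>S. a \<otimes>\<^bsub>Q\<^esub> b \<in> S)"
  let ?S = "{a \<in> carrier A. proj a \<in> S}"
  have "carrier A \<subseteq> ?S"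
  proof (rule assms[unfolded generates_def, THEN conjunct2, rule_format], intro conjI ballI)
    show "submodule ?S R A"
      using S submodule_vimage_proj by blast
    show "range g \<subseteq> ?S"
      using S assms by (auto simp: generates_def)
    show "a \<otimes>\<^bsub>A\<^esub> b \<in> ?S" if "a \<in> ?S" "b \<in> ?S" for a b
      using S that by (auto simp flip: mult_Q)
  qed
  then show "carrier Q \<subseteq> S"
    by (auto simp: carrier_Q)
qed

lemma free_na_simps:
  fixes R (structure)
  shows "f \<in> carrier (free_na_alg R) \<longleftrightarrow> (\<forall>t. f t \<in> carrier R) \<and> finite {t. f t \<noteq> \<zero>}"
    "f \<otimes>\<^bsub>free_na_alg R\<^esub> g = (\<lambda>t. case t of Gen x \<Rightarrow> \<zero> | Br u v \<Rightarrow> f u \<otimes> g v)"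
    "f \<oplus>\<^bsub>free_na_alg R\<^esub> g = (\<lambda>t. f t \<oplus> g t)"
    "r \<odot>\<^bsub>free_na_alg R\<^esub> f = (\<lambda>t. r \<otimes> f t)"
    "\<zero>\<^bsub>free_na_alg R\<^esub> = (\<lambda>t. \<zero>)"
  by (auto simp: free_na_alg_def)

context cring
begin

lemma free_na_mult_support:
  assumes "f \<in> carrier (free_na_alg R)" "g \<in> carrier (free_na_alg R)"
  shows "{t. (f \<otimes>\<^bsub>free_na_alg R\<^esub> g) t \<noteq> \<zero>} \<subseteq> (\<lambda>(u, v). Br u v) ` ({t. f t \<noteq> \<zero>} \<times> {t. g t \<noteq> \<zero>})"
proof
  fix t assume "t \<in> {t. (f \<otimes>\<^bsub>free_na_alg R\<^esub> g) t \<noteq> \<zero>}"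
  then show "t \<in> (\<lambda>(u, v). Br u v) ` ({t. f t \<noteq> \<zero>} \<times> {t. g t \<noteq> \<zero>})"
    using assms by (cases t) (auto simp: free_na_simps)
qed

lemma bilinear_algebra_free_na: "bilinear_algebra R (free_na_alg R :: ('a, 'x fmagma \<Rightarrow> 'a) module)"
proof (intro bilinear_algebra.intro bilinear_algebra_axioms.intro moduleI)
  let ?A = "free_na_alg R :: ('a, 'x fmagma \<Rightarrow> 'a) module"
  show "cring R" by (rule is_cring)
  have add: "f \<oplus>\<^bsub>?A\<^esub> g \<in> carrier ?A" if "f \<in> carrier ?A" "g \<in> carrier ?A" for f g
  proof -
    have "{t. f t \<oplus> g t \<noteq> \<zero>} \<subseteq> {t. f t \<noteq> \<zero>} \<union> {t. g t \<noteq> \<zero>}"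
      by auto
    then have "finite {t. f t \<oplus> g t \<noteq> \<zero>}"
      using that by (auto simp: free_na_simps dest: finite_subset)
    then show ?thesis
      using that by (simp add: free_na_simps)
  qed
  show smult: "r \<odot>\<^bsub>?A\<^esub> f \<in> carrier ?A" if "r \<in> carrier R" "f \<in> carrier ?A" for r f
  proof -
    have "{t. r \<otimes> f t \<noteq> \<zero>} \<subseteq> {t. f t \<noteq> \<zero>}"
      using that by auto
    then have "finite {t. r \<otimes> f t \<noteq> \<zero>}"
      using that by (auto simp: free_na_simps dest: finite_subset)
    then show ?thesis
      using that by (simp add: free_na_simps)
  qed
  show "f \<otimes>\<^bsub>?A\<^esub> g \<in> carrier ?A" if "f \<in> carrier ?A" "g \<in> carrier ?A" for f g
  proof -
    have "finite {t. (f \<otimes>\<^bsub>?A\<^esub> g) t \<noteq> \<zero>}"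
      using that by (intro finite_subset[OF free_na_mult_support[OF that]]) (auto simp: free_na_simps)
    moreover have "(f \<otimes>\<^bsub>?A\<^esub> g) t \<in> carrier R" for t
      using that by (cases t) (auto simp: free_na_simps)
    ultimately show ?thesis
      by (simp add: free_na_simps(1))
  qed
  show "abelian_group ?A"
  proof (rule abelian_groupI)
    show "f \<oplus>\<^bsub>?A\<^esub> g \<in> carrier ?A" if "f \<in> carrier ?A" "g \<in> carrier ?A" for f g
      by (rule add[OF that])
    show "\<exists>g\<in>carrier ?A. g \<oplus>\<^bsub>?A\<^esub> f = \<zero>\<^bsub>?A\<^esub>" if "f \<in> carrier ?A" for f
    proof (rule bexI)
      show "((\<ominus> \<one>) \<odot>\<^bsub>?A\<^esub> f) \<oplus>\<^bsub>?A\<^esub> f = \<zero>\<^bsub>?A\<^esub>"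
        using that by (auto simp: free_na_simps l_minus l_neg)
    qed (use that smult in auto)
  qed (auto simp: free_na_simps a_ac)
qed (auto simp: free_na_simps l_distr r_distr m_ac split: fmagma.splits)

lemma generates_free_na: "generates R (free_na_alg R) (free_na_gen R :: 'x \<Rightarrow> _)"
  unfolding generates_def
proof (intro conjI allI impI)
  let ?A = "free_na_alg R :: ('a, 'x fmagma \<Rightarrow> 'a) module"
  interpret A: bilinear_algebra R ?A by (rule bilinear_algebra_free_na)
  show "range (free_na_gen R) \<subseteq> carrier ?A"
    by (auto simp: free_na_simps free_na_gen_def)
  fix S assume S: "submodule S R ?A \<and> range (free_na_gen R) \<subseteq> S \<and> (\<forall>a\<in>S. \<forall>b\<in>S. a \<otimes>\<^bsub>?A\<^esub> b \<in> S)"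
  define \<delta> :: "'x fmagma \<Rightarrow> 'x fmagma \<Rightarrow> 'a" where "\<delta> t = (\<lambda>u. if u = t then \<one> else \<zero>)" for t
  have \<delta>: "\<delta> t \<in> S" for t
  proof (induction t)
    case (Gen x)
    then show ?case
      using S by (auto simp: \<delta>_def free_na_gen_def)
  next
    case (Br s t)
    have "\<delta> (Br s t) = \<delta> s \<otimes>\<^bsub>?A\<^esub> \<delta> t"
      by (auto simp: \<delta>_def free_na_simps fun_eq_iff split: fmagma.splits)
    then show ?case
      using Br S by simp
  qed
  have "f \<in> S" if "finite T" "f \<in> carrier ?A" "{t. f t \<noteq> \<zero>} \<subseteq> T" for f T
    using that
  proof (induction T arbitrary: f)
    case empty
    then have "f = \<zero>\<^bsub>?A\<^esub>"
      by (auto simp: free_na_simps)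
    then show ?case
      using A.submodule_zero S by simp
  next
    case (insert t T)
    let ?f = "f(t := \<zero>)"
    have f: "f u \<in> carrier R" for u
      using insert.prems by (simp add: free_na_simps)
    have "finite {u. f u \<noteq> \<zero>}"
      using insert.prems by (simp add: free_na_simps)
    then have "finite {u. ?f u \<noteq> \<zero>}"
      by (rule rev_finite_subset) auto
    then have "?f \<in> S"
      using insert.prems f by (intro insert.IH) (auto simp: free_na_simps)
    moreover have "f t \<odot>\<^bsub>?A\<^esub> \<delta> t \<in> S"
      using A.submoduleE(4) S f \<delta> by blast
    moreover have "f = ?f \<oplus>\<^bsub>?A\<^esub> f t \<odot>\<^bsub>?A\<^esub> \<delta> t"
      using f by (auto simp: free_na_simps \<delta>_def fun_eq_iff)
    ultimately show ?case
      using A.submoduleE(5) S by metis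
  qed
  then show "carrier ?A \<subseteq> S"
    by (auto simp: free_na_simps)
qed

end

primrec expand :: "'x fmagma \<Rightarrow> 'x list \<Rightarrow> int"
  where
    "expand (Gen x) = (\<lambda>w. if w = [x] then 1 else 0)"
  | "expand (Br s t) = comm (expand s) (expand t)"

definition free_rep :: "('x fmagma \<Rightarrow> int) \<Rightarrow> 'x list \<Rightarrow> int"
  where "free_rep f w = (\<Sum>t | f t \<noteq> 0. f t * expand t w)"

lemma free_rep_eq:
  assumes "finite S" "{t. f t \<noteq> 0} \<subseteq> S"
  shows "free_rep f w = (\<Sum>t\<in>S. f t * expand t w)"
  unfolding free_rep_def using assms by (intro sum.mono_neutral_left) auto

lemma expand_Nil: "expand t [] = 0"
  by (induction t) (simp_all add: comm_def)

text \<open>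
  On the free nonassociative algebra the expansion is the linear extension of the expansion of
  monomials, and the bracket rule holds because the product of that algebra only grafts trees.
\<close>

lemma (in residues) word_rep_free_na:
  "word_rep m c (free_na_alg R) (free_na_gen R) (free_rep :: ('x fmagma \<Rightarrow> int) \<Rightarrow> _)"
proof -
  let ?A = "free_na_alg R :: (int, 'x fmagma \<Rightarrow> int) module"
  interpret cring R by (rule cring)
  have zero: "\<zero> = 0" by (simp add: R_m_def residue_ring_def)
  have fin: "finite {t. f t \<noteq> 0}" if "f \<in> carrier ?A" for f
    using that by (simp add: free_na_simps zero)
  have 1: "[free_rep (f \<oplus>\<^bsub>?A\<^esub> g) w = free_rep f w + free_rep g w] (mod m)"
    if f: "f \<in> carrier ?A" and g: "g \<in> carrier ?A" for f g w
  proof -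
    let ?S = "{t. f t \<noteq> 0} \<union> {t. g t \<noteq> 0}"
    have S: "finite ?S" using fin f g by blast
    have "{t. (f \<oplus>\<^bsub>?A\<^esub> g) t \<noteq> 0} \<subseteq> ?S"
      by (auto simp: free_na_simps res_add_eq)
    then have "free_rep (f \<oplus>\<^bsub>?A\<^esub> g) w = (\<Sum>t\<in>?S. ((f t + g t) mod m) * expand t w)"
      using free_rep_eq[OF S] by (simp add: free_na_simps res_add_eq)
    also have "[\<dots> = (\<Sum>t\<in>?S. (f t + g t) * expand t w)] (mod m)"
      by (intro cong_sum cong_mult) (auto simp: cong_def)
    also have "(\<Sum>t\<in>?S. (f t + g t) * expand t w) = free_rep f w + free_rep g w"
      using free_rep_eq[OF S, of f] free_rep_eq[OF S, of g] by (simp add: algebra_simps sum.distrib)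
    finally show ?thesis .
  qed
  have 2: "[free_rep (f \<otimes>\<^bsub>?A\<^esub> g) w = comm (free_rep f) (free_rep g) w] (mod m)"
    if f: "f \<in> carrier ?A" and g: "g \<in> carrier ?A" for f g w
  proof -
    let ?S = "{t. f t \<noteq> 0}" and ?T = "{t. g t \<noteq> 0}"
    let ?U = "(\<lambda>(u, v). Br u v) ` (?S \<times> ?T)"
    have "free_rep (f \<otimes>\<^bsub>?A\<^esub> g) w = (\<Sum>t\<in>?U. (f \<otimes>\<^bsub>?A\<^esub> g) t * expand t w)"
      using fin[OF f] fin[OF g] free_na_mult_support[OF f g, unfolded zero] by (intro free_rep_eq) auto
    also have "\<dots> = (\<Sum>(u, v)\<in>?S \<times> ?T. ((f u * g v) mod m) * comm (expand u) (expand v) w)"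
      by (subst sum.reindex) (auto simp: inj_on_def free_na_simps res_mult_eq intro!: sum.cong)
    also have "[\<dots> = (\<Sum>(u, v)\<in>?S \<times> ?T. (f u * g v) * comm (expand u) (expand v) w)] (mod m)"
      unfolding case_prod_beta by (intro cong_sum cong_mult) (auto simp: cong_def)
    also have "(\<Sum>(u, v)\<in>?S \<times> ?T. (f u * g v) * comm (expand u) (expand v) w) =
        (\<Sum>u\<in>?S. \<Sum>v\<in>?T. f u * (g v * conv (expand u) (expand v) w)) -
        (\<Sum>u\<in>?S. \<Sum>v\<in>?T. g v * (f u * conv (expand v) (expand u) w))"
      unfolding sum.cartesian_product[symmetric]
      by (simp add: comm_def algebra_simps sum_subtractf)
    also have "\<dots> = comm (free_rep f) (free_rep g) w"
      unfolding comm_def free_rep_def[abs_def] conv_sum_left conv_sum_right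
      by (subst (2) sum.swap) (simp add: sum_distrib_left)
    finally show ?thesis .
  qed
  have 3: "[free_rep (r \<odot>\<^bsub>?A\<^esub> f) w = r * free_rep f w] (mod m)" if f: "f \<in> carrier ?A" for r f w
  proof -
    let ?S = "{t. f t \<noteq> 0}"
    have "{t. (r \<odot>\<^bsub>?A\<^esub> f) t \<noteq> 0} \<subseteq> ?S"
      by (auto simp: free_na_simps res_mult_eq)
    then have "free_rep (r \<odot>\<^bsub>?A\<^esub> f) w = (\<Sum>t\<in>?S. ((r * f t) mod m) * expand t w)"
      using free_rep_eq[OF fin[OF f]] by (simp add: free_na_simps res_mult_eq)
    also have "[\<dots> = (\<Sum>t\<in>?S. (r * f t) * expand t w)] (mod m)"
      by (intro cong_sum cong_mult) (auto simp: cong_def)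
    also have "(\<Sum>t\<in>?S. (r * f t) * expand t w) = r * free_rep f w"
      by (simp add: free_rep_def sum_distrib_left mult.assoc)
    finally show ?thesis .
  qed
  have "free_rep (free_na_gen R x) w = (if w = [x] then 1 else 0)" for x :: 'x and w
    using free_rep_eq[of "{Gen x}" "free_na_gen R x" w]
    by (auto simp: free_na_gen_def R_m_def residue_ring_def)
  then show ?thesis
    unfolding word_rep_def using 1 2 3 by (auto simp: free_rep_def expand_Nil)
qed

section \<open>Lie algebras on two generators\<close>

locale lie_algebra = bilinear_algebra R A for R :: "('a, 'r) ring_scheme" (structure)
    and A :: "('a, 'b, 'm) module_scheme" (structure) +
  assumes alternating: "x \<in> carrier A \<Longrightarrow> x \<otimes>\<^bsub>A\<^esub> x = \<zero>\<^bsub>A\<^esub>"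
    and jacobi: "\<lbrakk>x \<in> carrier A; y \<in> carrier A; z \<in> carrier A\<rbrakk> \<Longrightarrow>
      x \<otimes>\<^bsub>A\<^esub> (y \<otimes>\<^bsub>A\<^esub> z) \<oplus>\<^bsub>A\<^esub> y \<otimes>\<^bsub>A\<^esub> (z \<otimes>\<^bsub>A\<^esub> x) \<oplus>\<^bsub>A\<^esub> z \<otimes>\<^bsub>A\<^esub> (x \<otimes>\<^bsub>A\<^esub> y) = \<zero>\<^bsub>A\<^esub>"

text \<open>
  Used twice: for the ideal generated by the Lie relations, and for an ideal of a Lie algebra,
  where all Lie relations are already zero.
\<close>

lemma (in algebra_quotient) lie_algebra_Q:
  assumes "lie_relations A \<subseteq> I"
  shows "lie_algebra R Q"
proof (intro lie_algebra.intro lie_algebra_axioms.intro bilinear_algebra_Q)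
  have zero: "proj a = \<zero>\<^bsub>Q\<^esub>" if "a \<in> lie_relations A" for a
    using that assms proj_eq_zero a_subset by (auto simp: zero_Q')
  show "X \<otimes>\<^bsub>Q\<^esub> X = \<zero>\<^bsub>Q\<^esub>" if X: "X \<in> carrier Q" for X
  proof -
    obtain a where "a \<in> carrier A" "X = proj a"
      using X by (auto simp: carrier_Q)
    then show ?thesis
      using zero[of "a \<otimes>\<^bsub>A\<^esub> a"] by (auto simp: mult_Q lie_relations_def)
  qed
  show "X \<otimes>\<^bsub>Q\<^esub> (Y \<otimes>\<^bsub>Q\<^esub> Z) \<oplus>\<^bsub>Q\<^esub> Y \<otimes>\<^bsub>Q\<^esub> (Z \<otimes>\<^bsub>Q\<^esub> X) \<oplus>\<^bsub>Q\<^esub> Z \<otimes>\<^bsub>Q\<^esub> (X \<otimes>\<^bsub>Q\<^esub> Y) = \<zero>\<^bsub>Q\<^esub>"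
    if XYZ: "X \<in> carrier Q" "Y \<in> carrier Q" "Z \<in> carrier Q" for X Y Z
  proof -
    obtain a b c where abc: "a \<in> carrier A" "b \<in> carrier A" "c \<in> carrier A"
      and XYZ: "X = proj a" "Y = proj b" "Z = proj c"
      using XYZ by (auto simp: carrier_Q)
    have "a \<otimes>\<^bsub>A\<^esub> (b \<otimes>\<^bsub>A\<^esub> c) \<oplus>\<^bsub>A\<^esub> b \<otimes>\<^bsub>A\<^esub> (c \<otimes>\<^bsub>A\<^esub> a) \<oplus>\<^bsub>A\<^esub> c \<otimes>\<^bsub>A\<^esub> (a \<otimes>\<^bsub>A\<^esub> b) \<in> lie_relations A"
      using abc by (auto simp: lie_relations_def)
    from zero[OF this] show ?thesis
      using abc by (simp add: XYZ Q_simps)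
  qed
qed

lemma (in bilinear_algebra) submodule_vimage_mult_left:
  assumes "submodule S R A" "z \<in> carrier A"
  shows "submodule {a \<in> carrier A. a \<otimes>\<^bsub>A\<^esub> z \<in> S} R A"
  using submoduleE[OF assms(1)] submodule_zero[OF assms(1)] assms(2)
  by (intro submoduleI) (auto simp: mult_minus_left mult_add_left mult_smult_left)

lemma (in bilinear_algebra) submodule_vimage_mult_right:
  assumes "submodule S R A" "T \<subseteq> carrier A"
  shows "submodule {z \<in> carrier A. \<forall>a\<in>T. a \<otimes>\<^bsub>A\<^esub> z \<in> S} R A"
  using submoduleE[OF assms(1)] submodule_zero[OF assms(1)] assms(2)
  by (intro submoduleI) (auto simp: mult_minus_right mult_add_right mult_smult_right subset_iff)

text \<open>
  The space \<open>[U, x] + [U, y]\<close>. For a subspace \<open>U\<close> this set is already closed under addition.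
\<close>

definition ad_gens :: "('a, 'b, 'm) module_scheme \<Rightarrow> (two_gens \<Rightarrow> 'b) \<Rightarrow> 'b set \<Rightarrow> 'b set"
  where "ad_gens A g U = {u \<otimes>\<^bsub>A\<^esub> g X1 \<oplus>\<^bsub>A\<^esub> v \<otimes>\<^bsub>A\<^esub> g X2 |u v. u \<in> U \<and> v \<in> U}"

lemma ad_gens_mono: "U \<subseteq> V \<Longrightarrow> ad_gens A g U \<subseteq> ad_gens A g V"
  unfolding ad_gens_def by blast

text \<open>
  The span of the left-normed brackets of degree \<open>k\<close>. The value in degree 0 makes
  \<open>left_normed_mult\<close> hold there too.
\<close>

primrec left_normed ::
    "('a, 'r) ring_scheme \<Rightarrow> ('a, 'b, 'm) module_scheme \<Rightarrow> (two_gens \<Rightarrow> 'b) \<Rightarrow> nat \<Rightarrow> 'b set"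
  where
    "left_normed R A g 0 = {\<zero>\<^bsub>A\<^esub>}"
  | "left_normed R A g (Suc k) =
      (if k = 0 then {r \<odot>\<^bsub>A\<^esub> g X1 \<oplus>\<^bsub>A\<^esub> s \<odot>\<^bsub>A\<^esub> g X2 |r s. r \<in> carrier R \<and> s \<in> carrier R}
       else ad_gens A g (left_normed R A g k))"

context bilinear_algebra
begin

lemma submodule_ad_gens:
  assumes g: "\<And>i. g i \<in> carrier A" and U: "submodule U R A"
  shows "submodule (ad_gens A g U) R A"
proof (rule submoduleI)
  note U' = submoduleE[OF U] submodule_in_carrier[OF U] g
  show "ad_gens A g U \<subseteq> carrier A"
    using U' by (auto simp: ad_gens_def)
  show "\<zero>\<^bsub>A\<^esub> \<in> ad_gens A g U"
    unfolding ad_gens_def using submodule_zero[OF U] g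
    by (auto intro!: exI[of _ "\<zero>\<^bsub>A\<^esub>"])
  {
    fix a assume "a \<in> ad_gens A g U"
    then obtain u v where a: "u \<in> U" "v \<in> U" "a = u \<otimes>\<^bsub>A\<^esub> g X1 \<oplus>\<^bsub>A\<^esub> v \<otimes>\<^bsub>A\<^esub> g X2"
      by (auto simp: ad_gens_def)
    have "\<ominus>\<^bsub>A\<^esub> a = (\<ominus>\<^bsub>A\<^esub> u) \<otimes>\<^bsub>A\<^esub> g X1 \<oplus>\<^bsub>A\<^esub> (\<ominus>\<^bsub>A\<^esub> v) \<otimes>\<^bsub>A\<^esub> g X2"
      using a U' by (simp add: M.minus_add mult_minus_left)
    then show "\<ominus>\<^bsub>A\<^esub> a \<in> ad_gens A g U"
      unfolding ad_gens_def using a U' by blast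
    {
      fix b assume "b \<in> ad_gens A g U"
      then obtain u' v' where b: "u' \<in> U" "v' \<in> U" "b = u' \<otimes>\<^bsub>A\<^esub> g X1 \<oplus>\<^bsub>A\<^esub> v' \<otimes>\<^bsub>A\<^esub> g X2"
        by (auto simp: ad_gens_def)
      have "a \<oplus>\<^bsub>A\<^esub> b = (u \<oplus>\<^bsub>A\<^esub> u') \<otimes>\<^bsub>A\<^esub> g X1 \<oplus>\<^bsub>A\<^esub> (v \<oplus>\<^bsub>A\<^esub> v') \<otimes>\<^bsub>A\<^esub> g X2"
        using a b U' by (simp add: mult_add_left M.a_ac)
      then show "a \<oplus>\<^bsub>A\<^esub> b \<in> ad_gens A g U"
        unfolding ad_gens_def using a b U' by blast
    }
    fix r assume r: "r \<in> carrier R"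
    have "r \<odot>\<^bsub>A\<^esub> a = (r \<odot>\<^bsub>A\<^esub> u) \<otimes>\<^bsub>A\<^esub> g X1 \<oplus>\<^bsub>A\<^esub> (r \<odot>\<^bsub>A\<^esub> v) \<otimes>\<^bsub>A\<^esub> g X2"
      using a r U' by (simp add: smult_r_distr mult_smult_left)
    then show "r \<odot>\<^bsub>A\<^esub> a \<in> ad_gens A g U"
      unfolding ad_gens_def using a r U' by blast
  }
qed

lemma submodule_left_normed:
  assumes g: "\<And>i. g i \<in> carrier A"
  shows "submodule (left_normed R A g k) R A"
proof (induction k)
  case 0
  show ?case by (simp, rule submoduleI) auto
next
  case (Suc k)
  then show ?case
    using submodule_ad_gens[OF g] submodule_span_gens[OF g g] by simp
qed

lemma left_normed_step:
  assumes g: "\<And>i. g i \<in> carrier A" and u: "u \<in> left_normed R A g k" and "k > 0"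
  shows "u \<otimes>\<^bsub>A\<^esub> g i \<in> left_normed R A g (Suc k)"
proof -
  have uA: "u \<in> carrier A"
    using u submodule_in_carrier[OF submodule_left_normed[of g, OF g]] by blast
  note z = submodule_zero[OF submodule_left_normed[of g k, OF g]]
  have "u \<otimes>\<^bsub>A\<^esub> g X1 = u \<otimes>\<^bsub>A\<^esub> g X1 \<oplus>\<^bsub>A\<^esub> \<zero>\<^bsub>A\<^esub> \<otimes>\<^bsub>A\<^esub> g X2"
    "u \<otimes>\<^bsub>A\<^esub> g X2 = \<zero>\<^bsub>A\<^esub> \<otimes>\<^bsub>A\<^esub> g X1 \<oplus>\<^bsub>A\<^esub> u \<otimes>\<^bsub>A\<^esub> g X2"
    using uA g by simp_all
  then have "u \<otimes>\<^bsub>A\<^esub> g X1 \<in> ad_gens A g (left_normed R A g k)"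
    "u \<otimes>\<^bsub>A\<^esub> g X2 \<in> ad_gens A g (left_normed R A g k)"
    unfolding ad_gens_def using u z by blast+
  then show ?thesis
    using \<open>k > 0\<close> by (cases i) simp_all
qed

end

context lie_algebra
begin

lemma anticommute:
  assumes "x \<in> carrier A" "y \<in> carrier A"
  shows "x \<otimes>\<^bsub>A\<^esub> y = \<ominus>\<^bsub>A\<^esub> (y \<otimes>\<^bsub>A\<^esub> x)"
proof -
  have "\<zero>\<^bsub>A\<^esub> = (x \<oplus>\<^bsub>A\<^esub> y) \<otimes>\<^bsub>A\<^esub> (x \<oplus>\<^bsub>A\<^esub> y)"
    using assms alternating by simp
  also have "\<dots> = x \<otimes>\<^bsub>A\<^esub> y \<oplus>\<^bsub>A\<^esub> y \<otimes>\<^bsub>A\<^esub> x"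
    using assms alternating[of x] alternating[of y]
    by (simp add: mult_add_left mult_add_right M.a_comm)
  finally show ?thesis
    using assms by (simp add: M.minus_equality)
qed

text \<open>
  The Jacobi identity in the form that moves brackets to the left.
\<close>

lemma leibniz:
  assumes c: "x \<in> carrier A" "y \<in> carrier A" "z \<in> carrier A"
  shows "x \<otimes>\<^bsub>A\<^esub> (y \<otimes>\<^bsub>A\<^esub> z) = (x \<otimes>\<^bsub>A\<^esub> y) \<otimes>\<^bsub>A\<^esub> z \<oplus>\<^bsub>A\<^esub> \<ominus>\<^bsub>A\<^esub> ((x \<otimes>\<^bsub>A\<^esub> z) \<otimes>\<^bsub>A\<^esub> y)"
proof -
  have 1: "y \<otimes>\<^bsub>A\<^esub> (z \<otimes>\<^bsub>A\<^esub> x) = (x \<otimes>\<^bsub>A\<^esub> z) \<otimes>\<^bsub>A\<^esub> y"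
    using c anticommute[of y "z \<otimes>\<^bsub>A\<^esub> x"] anticommute[of z x] by (simp add: mult_minus_left)
  have 2: "z \<otimes>\<^bsub>A\<^esub> (x \<otimes>\<^bsub>A\<^esub> y) = \<ominus>\<^bsub>A\<^esub> ((x \<otimes>\<^bsub>A\<^esub> y) \<otimes>\<^bsub>A\<^esub> z)"
    using c anticommute[of z "x \<otimes>\<^bsub>A\<^esub> y"] by simp
  have "x \<otimes>\<^bsub>A\<^esub> (y \<otimes>\<^bsub>A\<^esub> z) \<oplus>\<^bsub>A\<^esub> ((x \<otimes>\<^bsub>A\<^esub> z) \<otimes>\<^bsub>A\<^esub> y \<oplus>\<^bsub>A\<^esub> \<ominus>\<^bsub>A\<^esub> ((x \<otimes>\<^bsub>A\<^esub> y) \<otimes>\<^bsub>A\<^esub> z)) = \<zero>\<^bsub>A\<^esub>"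
    using jacobi[OF c] c unfolding 1 2 by (simp add: M.a_assoc)
  then have "x \<otimes>\<^bsub>A\<^esub> (y \<otimes>\<^bsub>A\<^esub> z) = \<ominus>\<^bsub>A\<^esub> ((x \<otimes>\<^bsub>A\<^esub> z) \<otimes>\<^bsub>A\<^esub> y \<oplus>\<^bsub>A\<^esub> \<ominus>\<^bsub>A\<^esub> ((x \<otimes>\<^bsub>A\<^esub> y) \<otimes>\<^bsub>A\<^esub> z))"
    using c by (intro M.minus_equality[symmetric]) auto
  then show ?thesis
    using c by (simp add: M.minus_add M.a_comm)
qed

lemma alg_idealI:
  assumes "submodule I R A" "\<And>a x. a \<in> I \<Longrightarrow> x \<in> carrier A \<Longrightarrow> a \<otimes>\<^bsub>A\<^esub> x \<in> I"
  shows "alg_ideal R A I"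
  unfolding alg_ideal_def
proof (intro conjI ballI)
  fix x a assume x: "x \<in> carrier A" and a: "a \<in> I"
  show "x \<otimes>\<^bsub>A\<^esub> a \<in> I"
    using anticommute[OF x submodule_in_carrier[OF assms(1) a]] assms(2)[OF a x]
      submoduleE(3)[OF assms(1)] by simp
qed (use assms in auto)

lemma alg_ideal_lower_central: "alg_ideal R A (lower_central R A k)"
proof (induction k)
  case 0
  show ?case using carrier_is_submodule by (auto simp: alg_ideal_def)
next
  case (Suc k)
  let ?P = "{x \<otimes>\<^bsub>A\<^esub> y |x y. x \<in> lower_central R A k \<and> y \<in> carrier A}"
  have sub: "submodule (lower_central R A k) R A"
    using Suc by (simp add: alg_ideal_def)
  have P: "?P \<subseteq> lower_central R A k"
    using Suc by (auto simp: alg_ideal_def)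
  show ?case
  proof (cases "k = 0")
    case True
    then show ?thesis using carrier_is_submodule by (auto simp: alg_ideal_def)
  next
    case False
    have "alg_ideal R A (span_of R A ?P)"
    proof (rule alg_idealI)
      show "submodule (span_of R A ?P) R A"
        using P submoduleE(1)[OF sub] by (intro submodule_span_of) auto
      fix a x assume a: "a \<in> span_of R A ?P" and x: "x \<in> carrier A"
      have "a \<in> lower_central R A k"
        using a span_of_least[OF sub P] by blast
      then have "a \<otimes>\<^bsub>A\<^esub> x \<in> ?P" using x by blast
      then show "a \<otimes>\<^bsub>A\<^esub> x \<in> span_of R A ?P"
        by (rule subsetD[OF span_of_superset])
    qed
    then show ?thesis using False by simp
  qed
qed

lemma left_normed_lower_central:
  assumes g: "\<And>i. g i \<in> carrier A"
  shows "left_normed R A g k \<subseteq> lower_central R A k"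
proof (induction k)
  case (Suc k)
  have sub: "submodule (lower_central R A (Suc k)) R A"
    using alg_ideal_lower_central by (simp only: alg_ideal_def)
  show ?case
  proof (cases "k = 0")
    case True
    then show ?thesis using g by auto
  next
    case False
    have "u \<otimes>\<^bsub>A\<^esub> g i \<in> lower_central R A (Suc k)" if "u \<in> left_normed R A g k" for u i
    proof -
      have "u \<otimes>\<^bsub>A\<^esub> g i \<in> {x \<otimes>\<^bsub>A\<^esub> y |x y. x \<in> lower_central R A k \<and> y \<in> carrier A}"
        using that Suc g by blast
      then show ?thesis
        using False subsetD[OF span_of_superset] by simp
    qed
    then show ?thesis
      using False submoduleE(5)[OF sub] by (auto simp: ad_gens_def simp del: lower_central.simps)
  qed
qed simp

text \<open>
  By induction on \<open>j\<close>: an element of degree \<open>j + 1\<close> is a combination of brackets \<open>[w, g\<^sub>l]\<close>, and \<open>leibniz\<close>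
  rewrites \<open>[u, [w, g\<^sub>l]]\<close> as \<open>[[u, w], g\<^sub>l] - [[u, g\<^sub>l], w]\<close>, where the right factors have smaller degree.
\<close>

lemma left_normed_mult:
  assumes g: "\<And>i. g i \<in> carrier A"
    and "u \<in> left_normed R A g i" "v \<in> left_normed R A g j"
  shows "u \<otimes>\<^bsub>A\<^esub> v \<in> left_normed R A g (i + j)"
  using assms(2,3)
proof (induction j arbitrary: i u v)
  case 0
  then show ?case
    using submodule_in_carrier[OF submodule_left_normed[of g, OF g]]
      submodule_zero[OF submodule_left_normed[of g, OF g]] by auto
next
  case (Suc j)
  note sub = submodule_left_normed[of g, OF g]
  note carrier = submodule_in_carrier[OF sub]
  show ?case
  proof (cases "i = 0")
    case True
    then show ?thesis
      using Suc.prems carrier submodule_zero[OF sub, of "Suc j"]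
      by (auto simp del: left_normed.simps(2))
  next
    case i: False
    note step = left_normed_step[of g, OF g]
    show ?thesis
    proof (cases "j = 0")
      case True
      then obtain r s where v: "r \<in> carrier R" "s \<in> carrier R" "v = r \<odot>\<^bsub>A\<^esub> g X1 \<oplus>\<^bsub>A\<^esub> s \<odot>\<^bsub>A\<^esub> g X2"
        using Suc.prems by auto
      have "u \<otimes>\<^bsub>A\<^esub> v = r \<odot>\<^bsub>A\<^esub> (u \<otimes>\<^bsub>A\<^esub> g X1) \<oplus>\<^bsub>A\<^esub> s \<odot>\<^bsub>A\<^esub> (u \<otimes>\<^bsub>A\<^esub> g X2)"
        unfolding v(3) using v carrier[OF Suc.prems(1)] g
        by (simp add: mult_add_right mult_smult_right)
      also have "\<dots> \<in> left_normed R A g (Suc i)"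
        using step[OF Suc.prems(1)] i v submoduleE(4,5)[OF sub] by blast
      finally show ?thesis using True by simp
    next
      case False
      then obtain v1 v2 where v: "v1 \<in> left_normed R A g j" "v2 \<in> left_normed R A g j"
        and v_eq: "v = v1 \<otimes>\<^bsub>A\<^esub> g X1 \<oplus>\<^bsub>A\<^esub> v2 \<otimes>\<^bsub>A\<^esub> g X2"
        using Suc.prems by (auto simp: ad_gens_def)
      have *: "u \<otimes>\<^bsub>A\<^esub> (w \<otimes>\<^bsub>A\<^esub> g l) \<in> left_normed R A g (i + Suc j)"
        if w: "w \<in> left_normed R A g j" for w l
      proof -
        have "(u \<otimes>\<^bsub>A\<^esub> w) \<otimes>\<^bsub>A\<^esub> g l \<in> left_normed R A g (i + Suc j)"
          using step[OF Suc.IH[OF Suc.prems(1) w]] i by (simp del: left_normed.simps)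
        moreover have "(u \<otimes>\<^bsub>A\<^esub> g l) \<otimes>\<^bsub>A\<^esub> w \<in> left_normed R A g (i + Suc j)"
          using Suc.IH[OF step[OF Suc.prems(1)] w] i by (simp del: left_normed.simps)
        ultimately show ?thesis
          unfolding leibniz[OF carrier[OF Suc.prems(1)] carrier[OF w] g]
          by (intro submoduleE(5)[OF sub] submoduleE(3)[OF sub])
      qed
      have "u \<otimes>\<^bsub>A\<^esub> v = u \<otimes>\<^bsub>A\<^esub> (v1 \<otimes>\<^bsub>A\<^esub> g X1) \<oplus>\<^bsub>A\<^esub> u \<otimes>\<^bsub>A\<^esub> (v2 \<otimes>\<^bsub>A\<^esub> g X2)"
        unfolding v_eq using carrier[OF Suc.prems(1)] carrier[OF v(1)] carrier[OF v(2)] g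
        by (simp add: mult_add_right)
      then show ?thesis
        using submoduleE(5)[OF sub *[OF v(1)] *[OF v(2)]] by metis
    qed
  qed
qed

lemma gen_left_normed:
  assumes g: "\<And>i. g i \<in> carrier A"
  shows "g i \<in> left_normed R A g 1"
proof -
  have "g X1 = \<one>\<^bsub>R\<^esub> \<odot>\<^bsub>A\<^esub> g X1 \<oplus>\<^bsub>A\<^esub> \<zero>\<^bsub>R\<^esub> \<odot>\<^bsub>A\<^esub> g X2"
    "g X2 = \<zero>\<^bsub>R\<^esub> \<odot>\<^bsub>A\<^esub> g X1 \<oplus>\<^bsub>A\<^esub> \<one>\<^bsub>R\<^esub> \<odot>\<^bsub>A\<^esub> g X2"
    using g by simp_all
  then have "g X1 \<in> left_normed R A g 1" "g X2 \<in> left_normed R A g 1"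
    unfolding One_nat_def left_normed.simps using R.zero_closed R.one_closed by (simp, blast)+
  then show ?thesis by (cases i) auto
qed

lemma homogeneous_component_eq:
  assumes g: "\<And>i. g i \<in> carrier A" and "k > 0"
  shows "homogeneous_component R A g k = left_normed R A g k"
proof
  let ?M = "\<lambda>k. {eval_monomial A g t |t. degree_of t = k}"
  note sub = submodule_left_normed[of g, OF g]
  have monomial: "eval_monomial A g t \<in> left_normed R A g (degree_of t)" for t
  proof (induction t)
    case (Gen i)
    show ?case
      unfolding eval_monomial.simps degree_of.simps by (rule gen_left_normed[of g, OF g])
  next
    case (Br s t)
    then show ?case
      unfolding eval_monomial.simps degree_of.simps by (rule left_normed_mult[OF g])
  qed
  then show "homogeneous_component R A g k \<subseteq> left_normed R A g k"
    unfolding homogeneous_component_def using sub by (intro span_of_least) auto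
  have M: "?M k \<subseteq> carrier A" for k
    using monomial submodule_in_carrier[OF sub] by blast
  note span = submodule_span_of[OF M]
  show "left_normed R A g k \<subseteq> homogeneous_component R A g k"
    unfolding homogeneous_component_def using \<open>k > 0\<close>
  proof (induction k rule: nat_induct_non_zero)
    case 1
    have "g i \<in> span_of R A (?M 1)" for i
    proof -
      have "eval_monomial A g (Gen i) \<in> ?M 1"
        by (intro CollectI exI[of _ "Gen i"]) simp
      then show ?thesis
        using subsetD[OF span_of_superset] by simp
    qed
    then show ?case
      using submoduleE(4,5)[OF span[of 1]] by auto
  next
    case (Suc k)
    have "u \<otimes>\<^bsub>A\<^esub> g i \<in> span_of R A (?M (Suc k))" if "u \<in> left_normed R A g k" for u i
    proof -
      have "span_of R A (?M k) \<subseteq> {u \<in> carrier A. u \<otimes>\<^bsub>A\<^esub> g i \<in> span_of R A (?M (Suc k))}"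
      proof (intro span_of_least submodule_vimage_mult_left span g subsetI)
        fix a assume "a \<in> ?M k"
        then obtain t where t: "a = eval_monomial A g t" "degree_of t = k"
          by blast
        then have "eval_monomial A g (Br t (Gen i)) \<in> ?M (Suc k)"
          by (intro CollectI exI[of _ "Br t (Gen i)"]) simp
        then have "a \<otimes>\<^bsub>A\<^esub> g i \<in> span_of R A (?M (Suc k))"
          using subsetD[OF span_of_superset, of _ "?M (Suc k)"] t by simp
        then show "a \<in> {u \<in> carrier A. u \<otimes>\<^bsub>A\<^esub> g i \<in> span_of R A (?M (Suc k))}"
          using monomial[of t] submodule_in_carrier[OF sub] t by blast
      qed
      then show ?thesis using that Suc.IH by blast
    qed
    then show ?case
      using Suc.hyps submoduleE(5)[OF span] by (auto simp: ad_gens_def)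
  qed
qed

text \<open>
  The elements whose bracket maps \<open>I\<close> into itself form a subalgebra, so it suffices to look at generators.
\<close>

lemma alg_ideal_of_gens:
  assumes gen: "generates R A g" and I: "submodule I R A"
    and step: "\<And>a i. a \<in> I \<Longrightarrow> a \<otimes>\<^bsub>A\<^esub> g i \<in> I"
  shows "alg_ideal R A I"
proof (rule alg_idealI[OF I])
  let ?S = "{z \<in> carrier A. \<forall>a\<in>I. a \<otimes>\<^bsub>A\<^esub> z \<in> I}"
  note IA = submoduleE(1)[OF I]
  have "carrier A \<subseteq> ?S"
  proof (rule gen[unfolded generates_def, THEN conjunct2, rule_format], intro conjI ballI)
    show "submodule ?S R A"
      by (rule submodule_vimage_mult_right[OF I IA])
    show "range g \<subseteq> ?S"
      using gen step by (auto simp: generates_def)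
    fix z w assume z: "z \<in> ?S" and w: "w \<in> ?S"
    have "a \<otimes>\<^bsub>A\<^esub> (z \<otimes>\<^bsub>A\<^esub> w) \<in> I" if a: "a \<in> I" for a
    proof -
      have "(a \<otimes>\<^bsub>A\<^esub> z) \<otimes>\<^bsub>A\<^esub> w \<in> I" "(a \<otimes>\<^bsub>A\<^esub> w) \<otimes>\<^bsub>A\<^esub> z \<in> I"
        using a z w by blast+
      then show ?thesis
        using leibniz[of a z w] a z w IA submoduleE(3,5)[OF I] by auto
    qed
    then show "z \<otimes>\<^bsub>A\<^esub> w \<in> ?S" using z w by blast
  qed
  then show "a \<otimes>\<^bsub>A\<^esub> x \<in> I" if "a \<in> I" "x \<in> carrier A" for a x
    using that by blast
qed

text \<open>
  The sum of the left-normed parts is a subalgebra containing the generators. Only the degrees up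
  to \<open>c\<close> contribute, since the vanishing in degree \<open>c + 1\<close> propagates upwards.
\<close>

lemma carrier_eq_sum_set:
  assumes gen: "generates R A g" and nil: "left_normed R A g (Suc c) \<subseteq> {\<zero>\<^bsub>A\<^esub>}"
  shows "carrier A = sum_set A c (left_normed R A g)"
proof
  have g: "g i \<in> carrier A" for i
    using gen by (auto simp: generates_def)
  let ?S = "sum_set A c (left_normed R A g)"
  note sub = submodule_left_normed[of g, OF g]
  have S: "submodule ?S R A"
    by (intro submodule_sum_set sub)
  show "?S \<subseteq> carrier A"
    using submoduleE(1)[OF S] .
  have large: "left_normed R A g (Suc c + k) \<subseteq> {\<zero>\<^bsub>A\<^esub>}" for k
  proof (induction k)
    case (Suc k)
    have "left_normed R A g (Suc c + Suc k) = ad_gens A g (left_normed R A g (Suc c + k))"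
      by (simp only: add_Suc_right left_normed.simps) simp
    also have "\<dots> \<subseteq> ad_gens A g {\<zero>\<^bsub>A\<^esub>}"
      using Suc.IH by (rule ad_gens_mono)
    also have "\<dots> \<subseteq> {\<zero>\<^bsub>A\<^esub>}"
      using g by (auto simp: ad_gens_def)
    finally show ?case .
  qed (use nil in simp)
  have in_S: "left_normed R A g k \<subseteq> ?S" if "k > 0" for k
  proof (cases "k \<le> c")
    case True
    then show ?thesis using that by (intro sum_set_superset sub) auto
  next
    case False
    then have "left_normed R A g k \<subseteq> {\<zero>\<^bsub>A\<^esub>}"
      using large[of "k - Suc c"] by simp
    then show ?thesis using submodule_zero[OF S] by auto
  qed
  show "carrier A \<subseteq> ?S"
  proof (rule gen[unfolded generates_def, THEN conjunct2, rule_format], intro conjI ballI)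
    show "submodule ?S R A" by (rule S)
    show "range g \<subseteq> ?S"
      using gen_left_normed[of g, OF g] in_S[of 1] by auto
    have left: "u \<otimes>\<^bsub>A\<^esub> v \<in> ?S" if u: "u \<in> ?S" and v: "v \<in> left_normed R A g j" and "j \<in> {1..c}" for u v j
    proof -
      have vA: "v \<in> carrier A" using submodule_in_carrier[OF sub v] .
      have "?S \<subseteq> {u \<in> carrier A. u \<otimes>\<^bsub>A\<^esub> v \<in> ?S}"
      proof (rule sum_set_least[OF submodule_vimage_mult_left[OF S vA]], clarify)
        fix k u assume "k \<in> {1..c}" "u \<in> left_normed R A g k"
        then show "u \<in> carrier A \<and> u \<otimes>\<^bsub>A\<^esub> v \<in> ?S"
          using left_normed_mult[OF g _ v] in_S[of "k + j"] submodule_in_carrier[OF sub] by auto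
      qed
      then show ?thesis using u by blast
    qed
    fix u v assume u: "u \<in> ?S" and v: "v \<in> ?S"
    have uA: "{u} \<subseteq> carrier A" using u submodule_in_carrier[OF S] by blast
    have "?S \<subseteq> {v \<in> carrier A. \<forall>u\<in>{u}. u \<otimes>\<^bsub>A\<^esub> v \<in> ?S}"
      using left[OF u] submodule_in_carrier[OF sub]
      by (intro sum_set_least submodule_vimage_mult_right[OF S uA]) auto
    then show "u \<otimes>\<^bsub>A\<^esub> v \<in> ?S" using v by blast
  qed
qed

end

lemma (in algebra_quotient) left_normed_Q:
  assumes g: "\<And>i. g i \<in> carrier A"
  shows "left_normed R Q (\<lambda>i. proj (g i)) k \<subseteq> proj ` left_normed R A g k"
proof (induction k)
  case 0
  show ?case by (simp add: zero_Q)
next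
  case (Suc k)
  note carrier = submodule_in_carrier[OF submodule_left_normed[of g, OF g]]
  show ?case
  proof (cases "k = 0")
    case True
    then show ?thesis using g by (auto simp: Q_simps intro!: image_eqI[OF refl]; blast)
  next
    case False
    have "ad_gens Q (\<lambda>i. proj (g i)) (proj ` left_normed R A g k) \<subseteq> proj ` ad_gens A g (left_normed R A g k)"
      using carrier g by (auto simp: ad_gens_def Q_simps intro!: image_eqI[OF refl]; blast)
    then show ?thesis
      using False subset_trans[OF ad_gens_mono[OF Suc.IH]] by simp
  qed
qed

section \<open>The order filtration\<close>

lemma conv_zero:
  assumes "\<And>u v. w = u @ v \<Longrightarrow> [f u = 0] (mod m) \<or> [h v = 0] (mod m)"
  shows "[conv f h w = 0] (mod m)"
  using assms
proof (induction w arbitrary: f)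
  case Nil
  then show ?case using Nil[of "[]" "[]"] by (auto simp: cong_0_iff)
next
  case (Cons x w)
  have "[conv (\<lambda>u. f (x # u)) h w = 0] (mod m)"
    using Cons.prems by (intro Cons.IH) auto
  moreover have "[f [] * h (x # w) = 0] (mod m)"
    using Cons.prems[of "[]" "x # w"] by (auto simp: cong_0_iff)
  ultimately show ?case
    by (simp add: cong_0_iff)
qed

lemma comm_zero:
  assumes "\<And>u v. w = u @ v \<Longrightarrow> [f u = 0] (mod m) \<or> [h v = 0] (mod m)"
    and "\<And>u v. w = u @ v \<Longrightarrow> [h u = 0] (mod m) \<or> [f v = 0] (mod m)"
  shows "[comm f h w = 0] (mod m)"
  using cong_diff[OF conv_zero[of w f m h] conv_zero[of w h m f]] assms by (simp add: comm_def)

locale word_rep_algebra = bilinear_algebra "residue_ring m" A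
  for m :: int and A :: "(int, 'b, 'm) module_scheme" (structure) +
  fixes c :: nat and g :: "'x \<Rightarrow> 'b" and \<Phi> :: "'b \<Rightarrow> 'x list \<Rightarrow> int"
  assumes rep: "word_rep m c A g \<Phi>" and m_gt_1: "m > 1"
begin

abbreviation F :: "int ring"
  where "F \<equiv> residue_ring m"

lemma carrier_F: "carrier F = {0..m - 1}"
  by (simp add: residue_ring_def)

lemma zero_F: "\<zero>\<^bsub>F\<^esub> = 0" and one_F: "\<one>\<^bsub>F\<^esub> = 1"
  by (simp_all add: residue_ring_def)

lemma \<Phi>_add: "\<lbrakk>length w \<le> c; a \<in> carrier A; b \<in> carrier A\<rbrakk> \<Longrightarrow> [\<Phi> (a \<oplus> b) w = \<Phi> a w + \<Phi> b w] (mod m)"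
  and \<Phi>_mult: "\<lbrakk>length w \<le> c; a \<in> carrier A; b \<in> carrier A\<rbrakk> \<Longrightarrow> [\<Phi> (a \<otimes> b) w = comm (\<Phi> a) (\<Phi> b) w] (mod m)"
  and \<Phi>_smult: "\<lbrakk>length w \<le> c; r \<in> carrier F; a \<in> carrier A\<rbrakk> \<Longrightarrow> [\<Phi> (r \<odot> a) w = r * \<Phi> a w] (mod m)"
  and \<Phi>_gen: "length w \<le> c \<Longrightarrow> [\<Phi> (g x) w = (if w = [x] then 1 else 0)] (mod m)"
  using word_repD[OF rep] unfolding carrier_F by simp_all

lemma \<Phi>_Nil: "a \<in> carrier A \<Longrightarrow> [\<Phi> a [] = 0] (mod m)"
  using word_repD(4)[OF rep, of "[]"] by simp

lemma \<Phi>_zero: "length w \<le> c \<Longrightarrow> [\<Phi> \<zero> w = 0] (mod m)"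
  using \<Phi>_smult[of w 0 \<zero>] m_gt_1 smult_r_null[of 0] by (simp add: carrier_F)

text \<open>
  The elements whose expansion has no words of length below \<open>k\<close>. This filtration contains the lower
  central series, so the expansion survives the passage to the nilpotent quotient.
\<close>

definition order_ge :: "nat \<Rightarrow> 'b set"
  where "order_ge k = {a \<in> carrier A. \<forall>w. length w \<le> c \<longrightarrow> length w < k \<longrightarrow> [\<Phi> a w = 0] (mod m)}"

lemma submodule_order_ge: "submodule (order_ge k) F A"
proof (rule submoduleI)
  show "order_ge k \<subseteq> carrier A"
    by (auto simp: order_ge_def)
  show "\<zero> \<in> order_ge k"
    using \<Phi>_zero by (auto simp: order_ge_def)
  show "a \<oplus> b \<in> order_ge k" if ab: "a \<in> order_ge k" "b \<in> order_ge k" for a b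
  proof -
    have "[\<Phi> (a \<oplus> b) w = 0] (mod m)" if w: "length w \<le> c" "length w < k" for w
    proof -
      have "[\<Phi> (a \<oplus> b) w = \<Phi> a w + \<Phi> b w] (mod m)"
        using ab w by (intro \<Phi>_add) (auto simp: order_ge_def)
      also have "[\<Phi> a w + \<Phi> b w = 0 + 0] (mod m)"
        using ab w by (intro cong_add) (auto simp: order_ge_def)
      finally show ?thesis by simp
    qed
    then show ?thesis using ab by (simp add: order_ge_def)
  qed
  show smult: "r \<odot> a \<in> order_ge k" if r: "r \<in> carrier F" and a: "a \<in> order_ge k" for r a
  proof -
    have "[\<Phi> (r \<odot> a) w = 0] (mod m)" if w: "length w \<le> c" "length w < k" for w
    proof -
      have "[\<Phi> (r \<odot> a) w = r * \<Phi> a w] (mod m)"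
        using r a w by (intro \<Phi>_smult) (auto simp: order_ge_def)
      also have "[r * \<Phi> a w = r * 0] (mod m)"
        using a w by (intro cong_mult) (auto simp: order_ge_def)
      finally show ?thesis by simp
    qed
    then show ?thesis using r a by (simp add: order_ge_def)
  qed
  show "\<ominus> a \<in> order_ge k" if a: "a \<in> order_ge k" for a
  proof -
    have "a \<in> carrier A"
      using a by (simp add: order_ge_def)
    then have "\<ominus> a = (\<ominus>\<^bsub>F\<^esub> \<one>\<^bsub>F\<^esub>) \<odot> a"
      by (simp add: smult_l_minus)
    then show ?thesis
      using smult[OF R.a_inv_closed[OF R.one_closed] a] by simp
  qed
qed

lemma order_ge_mult:
  assumes a: "a \<in> order_ge k" and b: "b \<in> carrier A"
  shows "a \<otimes> b \<in> order_ge (Suc k)" and "b \<otimes> a \<in> order_ge (Suc k)"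
proof -
  have aA: "a \<in> carrier A" using a by (simp add: order_ge_def)
  have "[comm (\<Phi> a) (\<Phi> b) w = 0] (mod m) \<and> [comm (\<Phi> b) (\<Phi> a) w = 0] (mod m)"
    if w: "length w \<le> c" "length w < Suc k" for w
  proof -
    \<comment> \<open>In a factorisation of \<open>w\<close>, either the factor for \<open>a\<close> is shorter than \<open>k\<close> or the one for \<open>b\<close> is empty.\<close>
    have factor: "[\<Phi> a u = 0] (mod m) \<or> [\<Phi> b v = 0] (mod m)" if "length u + length v = length w" for u v
    proof (cases "v = []")
      case True
      then show ?thesis using \<Phi>_Nil[OF b] by simp
    next
      case False
      then have "length u < k" "length u \<le> c"
        using that w by (cases v; simp)+
      then show ?thesis using a by (simp add: order_ge_def)
    qed
    have "[\<Phi> a u = 0] (mod m) \<or> [\<Phi> b v = 0] (mod m)" "[\<Phi> b u = 0] (mod m) \<or> [\<Phi> a v = 0] (mod m)"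
      if "w = u @ v" for u v
      using factor[of u v] factor[of v u] that by auto
    then show ?thesis
      by (intro conjI comm_zero) blast+
  qed
  then show "a \<otimes> b \<in> order_ge (Suc k)" "b \<otimes> a \<in> order_ge (Suc k)"
    using cong_trans[OF \<Phi>_mult[of _ a b]] cong_trans[OF \<Phi>_mult[of _ b a]] aA b
    by (auto simp: order_ge_def)
qed

lemma lower_central_order_ge: "lower_central F A k \<subseteq> order_ge k"
proof (induction k)
  case 0
  show ?case by (simp add: order_ge_def)
next
  case (Suc k)
  show ?case
  proof (cases "k = 0")
    case True
    then show ?thesis using \<Phi>_Nil by (auto simp: order_ge_def)
  next
    case False
    have "span_of F A {x \<otimes> y |x y. x \<in> lower_central F A k \<and> y \<in> carrier A} \<subseteq> order_ge (Suc k)"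
      using Suc.IH order_ge_mult(1) by (intro span_of_least submodule_order_ge) blast
    then show ?thesis using False by simp
  qed
qed

lemma order_ge_mono: "k \<le> l \<Longrightarrow> order_ge l \<subseteq> order_ge k"
  by (auto simp: order_ge_def)

text \<open>
  Up to length \<open>c\<close>, the words see nothing of the Lie relations: a commutator \<open>ff - ff\<close> vanishes, and
  the Jacobi expression vanishes by \<open>comm_jacobi\<close>.
\<close>

lemma lie_ideal_order_ge: "alg_ideal F A hull lie_relations A \<subseteq> order_ge (Suc c)"
proof (rule hull_minimal)
  show "alg_ideal F A (order_ge (Suc c))"
    unfolding alg_ideal_def
    using submodule_order_ge subsetD[OF order_ge_mono[of "Suc c" "Suc (Suc c)"]]
    by (auto intro: order_ge_mult)
  have sq: "x \<otimes> x \<in> order_ge (Suc c)" if x: "x \<in> carrier A" for x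
    using x \<Phi>_mult[OF _ x x] by (simp add: order_ge_def comm_def)
  have jac: "x \<otimes> (y \<otimes> z) \<oplus> y \<otimes> (z \<otimes> x) \<oplus> z \<otimes> (x \<otimes> y) \<in> order_ge (Suc c)"
    if xyz: "x \<in> carrier A" "y \<in> carrier A" "z \<in> carrier A" for x y z
  proof -
    have double: "[\<Phi> (a \<otimes> (b \<otimes> d)) w = comm (\<Phi> a) (comm (\<Phi> b) (\<Phi> d)) w] (mod m)"
      if "length w \<le> c" "a \<in> carrier A" "b \<in> carrier A" "d \<in> carrier A" for a b d w
    proof -
      have "[\<Phi> (a \<otimes> (b \<otimes> d)) w = comm (\<Phi> a) (\<Phi> (b \<otimes> d)) w] (mod m)"
        using that by (intro \<Phi>_mult) auto
      also have "[comm (\<Phi> a) (\<Phi> (b \<otimes> d)) w = comm (\<Phi> a) (comm (\<Phi> b) (\<Phi> d)) w] (mod m)"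
        using that by (intro comm_cong cong_refl \<Phi>_mult) auto
      finally show ?thesis .
    qed
    have "[\<Phi> (x \<otimes> (y \<otimes> z) \<oplus> y \<otimes> (z \<otimes> x) \<oplus> z \<otimes> (x \<otimes> y)) w = 0] (mod m)" if w: "length w \<le> c" for w
    proof -
      have "[\<Phi> (x \<otimes> (y \<otimes> z) \<oplus> y \<otimes> (z \<otimes> x) \<oplus> z \<otimes> (x \<otimes> y)) w =
          \<Phi> (x \<otimes> (y \<otimes> z) \<oplus> y \<otimes> (z \<otimes> x)) w + \<Phi> (z \<otimes> (x \<otimes> y)) w] (mod m)"
        using w xyz by (intro \<Phi>_add) auto
      also have "[\<Phi> (x \<otimes> (y \<otimes> z) \<oplus> y \<otimes> (z \<otimes> x)) w + \<Phi> (z \<otimes> (x \<otimes> y)) w =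
          (\<Phi> (x \<otimes> (y \<otimes> z)) w + \<Phi> (y \<otimes> (z \<otimes> x)) w) + \<Phi> (z \<otimes> (x \<otimes> y)) w] (mod m)"
        using w xyz by (intro cong_add \<Phi>_add) auto
      also have "[(\<Phi> (x \<otimes> (y \<otimes> z)) w + \<Phi> (y \<otimes> (z \<otimes> x)) w) + \<Phi> (z \<otimes> (x \<otimes> y)) w =
          comm (\<Phi> x) (comm (\<Phi> y) (\<Phi> z)) w + comm (\<Phi> y) (comm (\<Phi> z) (\<Phi> x)) w
          + comm (\<Phi> z) (comm (\<Phi> x) (\<Phi> y)) w] (mod m)"
        using w xyz by (intro cong_add double) auto
      finally show ?thesis
        by (simp add: comm_jacobi)
    qed
    then show ?thesis using xyz by (auto simp: order_ge_def)
  qed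
  show "lie_relations A \<subseteq> order_ge (Suc c)"
    using sq jac by (auto simp: lie_relations_def)
qed

end

section \<open>The free nilpotent Lie algebra of class at most five\<close>

definition letter :: "'x \<Rightarrow> 'x list \<Rightarrow> int"
  where "letter x w = (if w = [x] then 1 else 0)"

lemma conv_empty_left: "conv (\<lambda>u. if u = [] then a else 0) f w = a * f w"
proof (induction w)
  case (Cons x w)
  have "conv (\<lambda>u. 0) f w = 0"
    using conv_scale_left[of 0 "\<lambda>_. 0" f w] by simp
  then show ?case by simp
qed simp

lemma conv_letter_left: "w \<noteq> [] \<Longrightarrow> conv (letter x) f w = (if hd w = x then f (tl w) else 0)"
proof (cases w)
  case (Cons y v)
  have "(\<lambda>u. letter x (y # u)) = (\<lambda>u. if u = [] then (if y = x then 1 else 0) else 0)"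
    by (auto simp: letter_def)
  then show ?thesis
    by (simp add: Cons conv_empty_left) (simp add: letter_def)
qed simp

lemma conv_letter_right: "w \<noteq> [] \<Longrightarrow> conv f (letter x) w = (if last w = x then f (butlast w) else 0)"
proof (induction w arbitrary: f)
  case (Cons y w)
  then show ?case by (cases "w = []") (simp_all add: letter_def)
qed simp

text \<open>
  Bracketing with a generator appends or prepends one letter, so single coefficients of
  left-normed brackets are computed by peeling off letters at both ends.
\<close>

lemma comm_letter:
  "w \<noteq> [] \<Longrightarrow> comm f (letter x) w =
    (if last w = x then f (butlast w) else 0) - (if hd w = x then f (tl w) else 0)"
  by (simp add: comm_def conv_letter_left conv_letter_right)

text \<open>
  The dimensions of the homogeneous components in degrees \<open>1, \<dots>, 5\<close>; the entry for degree 0 is a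
  placeholder.
\<close>

definition lie_dim :: "nat \<Rightarrow> nat"
  where "lie_dim k = [0, 2, 1, 2, 3, 6] ! k"

text \<open>
  The dimension of \<open>[U, x] + [U, y]\<close> for a subspace \<open>U\<close> of dimension \<open>d\<close> of the component of degree
  \<open>k \<le> 4\<close>.
\<close>

definition ad_dim :: "nat \<Rightarrow> nat \<Rightarrow> nat"
  where "ad_dim k d = (if k = 1 then min d 1 else if k = 3 \<and> d > 0 then d + 1 else 2 * d)"

text \<open>
  What is used about the free nilpotent Lie algebra of class \<open>c\<close>: it is generated by two elements,
  left-normed brackets of degree \<open>c + 1\<close> vanish, and its elements can be expanded into words of
  length at most \<open>c\<close>. The first two properties bound the algebra from above, the third from below.
\<close>

locale free_nilp_two = lie_algebra "residue_ring (int p)" L + word_rep_algebra "int p" L c g \<Phi>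
  for p :: nat and L :: "(int, 'b, 'm) module_scheme" (structure) and c and g :: "two_gens \<Rightarrow> 'b" and \<Phi> +
  assumes prime: "prime p" and gen: "generates (residue_ring (int p)) L g"
    and nil: "left_normed (residue_ring (int p)) L g (Suc c) \<subseteq> {\<zero>}"
    and c_pos: "1 \<le> c" and c_le: "c \<le> 5"

sublocale free_nilp_two \<subseteq> finite_field_module "residue_ring (int p)" L
proof (intro finite_field_module.intro finite_field_module_axioms.intro)
  interpret residues_prime p F
    using prime by unfold_locales simp_all
  show "field F" by (rule is_field)
  show "finite (carrier F)" by (simp add: carrier_F)
qed (rule module_axioms)

context free_nilp_two
begin

lemma q_eq: "q = p"
  by (simp add: q_def carrier_F)

abbreviation D :: "nat \<Rightarrow> 'b set"
  where "D \<equiv> left_normed F L g"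

abbreviation x :: 'b
  where "x \<equiv> g X1"

abbreviation y :: 'b
  where "y \<equiv> g X2"

lemma g [simp, intro]: "g i \<in> carrier L"
  using gen by (auto simp: generates_def)

lemma sub_D: "sub (D k)"
  by (rule submodule_left_normed) (rule g)

lemma D_carrier: "u \<in> D k \<Longrightarrow> u \<in> carrier L"
  using submodule_in_carrier[OF sub_D] .

lemma D_Suc: "k > 0 \<Longrightarrow> D (Suc k) = ad_gens L g (D k)"
  by simp

lemma D_step: "u \<in> D k \<Longrightarrow> k > 0 \<Longrightarrow> u \<otimes> g i \<in> D (Suc k)"
  using left_normed_step[of g, OF g] .

text \<open>
  Left-normed brackets spanning degrees 2, 3 and 4. The bracket \<open>[b, x]\<close> is missing in degree 4: it
  equals \<open>[a, y]\<close> because \<open>[z, [x, y]] = [z, z] = 0\<close>.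
\<close>

definition z :: 'b where "z = x \<otimes> y"
definition a :: 'b where "a = z \<otimes> x"
definition b :: 'b where "b = z \<otimes> y"
definition e1 :: 'b where "e1 = a \<otimes> x"
definition e2 :: 'b where "e2 = a \<otimes> y"
definition e3 :: 'b where "e3 = b \<otimes> y"

lemma basis_carrier [simp, intro]:
  "z \<in> carrier L" "a \<in> carrier L" "b \<in> carrier L"
  "e1 \<in> carrier L" "e2 \<in> carrier L" "e3 \<in> carrier L"
  by (simp_all add: z_def a_def b_def e1_def e2_def e3_def)

lemma basis_D:
  "x \<in> D 1" "y \<in> D 1" "z \<in> D 2" "a \<in> D 3" "b \<in> D 3" "e1 \<in> D 4" "e2 \<in> D 4" "e3 \<in> D 4"
proof -
  show xy: "x \<in> D 1" "y \<in> D 1"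
    using gen_left_normed[of g, OF g] by blast+
  show z: "z \<in> D 2"
    using D_step[OF xy(1), of X2] by (simp add: z_def numeral_2_eq_2 del: left_normed.simps)
  show ab: "a \<in> D 3" "b \<in> D 3"
    using D_step[OF z, of X1] D_step[OF z, of X2]
    by (simp_all add: a_def b_def eval_nat_numeral del: left_normed.simps)
  show "e1 \<in> D 4" "e2 \<in> D 4" "e3 \<in> D 4"
    using D_step[OF ab(1), of X1] D_step[OF ab(1), of X2] D_step[OF ab(2), of X2]
    by (simp_all add: e1_def e2_def e3_def eval_nat_numeral del: left_normed.simps)
qed

lemma b_x: "b \<otimes> x = e2"
proof -
  have "\<zero> = a \<otimes> y \<oplus> \<ominus> (b \<otimes> x)"
    using leibniz[of z x y] alternating[of z] by (simp add: z_def[symmetric] a_def b_def)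
  then have "e2 = \<ominus> (\<ominus> (b \<otimes> x))"
    unfolding e2_def by (intro M.minus_equality[symmetric]) simp_all
  then show ?thesis by simp
qed

lemma D1E:
  assumes "u \<in> D 1"
  obtains r s where "r \<in> carrier F" "s \<in> carrier F" "u = r \<odot> x \<oplus> s \<odot> y"
  using assms by auto

lemma D2_eq: "D 2 = adjoin {\<zero>} z"
proof
  have sub: "sub (adjoin {\<zero>} z)"
    by (intro sub_adjoin sub_singleton_zero) simp
  have *: "u \<otimes> x \<in> adjoin {\<zero>} z" "u \<otimes> y \<in> adjoin {\<zero>} z" if uD: "u \<in> D 1" for u
  proof -
    obtain r s where u: "r \<in> carrier F" "s \<in> carrier F" "u = r \<odot> x \<oplus> s \<odot> y"
      using uD by (rule D1E)
    have zS: "r \<odot> z \<in> adjoin {\<zero>} z" if "r \<in> carrier F" for r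
      using that by (auto simp: mem_adjoin_zero)
    have "u \<otimes> x = \<ominus> (s \<odot> z)"
      using u anticommute[of y x] alternating[of x]
      by (simp add: mult_add_left mult_smult_left smult_r_minus z_def)
    then show "u \<otimes> x \<in> adjoin {\<zero>} z"
      using submoduleE(3)[OF sub zS[OF u(2)]] by simp
    have "u \<otimes> y = r \<odot> z"
      using u alternating[of y] by (simp add: mult_add_left mult_smult_left z_def)
    then show "u \<otimes> y \<in> adjoin {\<zero>} z"
      using zS[OF u(1)] by simp
  qed
  have "D 2 = ad_gens L g (D 1)"
    using D_Suc[of 1] by (simp add: eval_nat_numeral del: left_normed.simps)
  also have "\<dots> \<subseteq> adjoin {\<zero>} z"
    unfolding ad_gens_def using * submoduleE(5)[OF sub] by blast
  finally show "D 2 \<subseteq> adjoin {\<zero>} z" .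
  show "adjoin {\<zero>} z \<subseteq> D 2"
    using basis_D(3) submodule_zero[OF sub_D] by (intro adjoin_least sub_D) auto
qed

lemma D2E:
  assumes "u \<in> D 2"
  obtains r where "r \<in> carrier F" "u = r \<odot> z"
  using assms unfolding D2_eq by (auto simp: mem_adjoin_zero)

lemma D3_eq: "D 3 = ad_gens L g (D 2)"
  using D_Suc[of 2] by (simp add: eval_nat_numeral del: left_normed.simps)

lemma D3E:
  assumes "u \<in> D 3"
  obtains r s where "r \<in> carrier F" "s \<in> carrier F" "u = r \<odot> a \<oplus> s \<odot> b"
proof -
  obtain v w where "v \<in> D 2" "w \<in> D 2" and u: "u = v \<otimes> x \<oplus> w \<otimes> y"
    using assms unfolding D3_eq ad_gens_def by blast
  then obtain r s where "r \<in> carrier F" "s \<in> carrier F" "v = r \<odot> z" "w = s \<odot> z"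
    by (metis D2E)
  then show ?thesis
    using that[of r s] u by (simp add: mult_smult_left a_def b_def)
qed

lemma D4_eq: "D 4 = ad_gens L g (D 3)"
  using D_Suc[of 3] by (simp add: eval_nat_numeral del: left_normed.simps)

lemma D4_adjoin: "D 4 = adjoin (adjoin (adjoin {\<zero>} e1) e2) e3" (is "_ = ?S")
proof
  have sub1: "sub (adjoin {\<zero>} e1)" and sub2: "sub (adjoin (adjoin {\<zero>} e1) e2)" and sub: "sub ?S"
    by (intro sub_adjoin sub_singleton_zero basis_carrier)+
  have e: "e1 \<in> ?S" "e2 \<in> ?S" "e3 \<in> ?S"
    using adjoin_superset[OF sub_singleton_zero basis_carrier(4)]
      adjoin_superset[OF sub1 basis_carrier(5)] adjoin_superset[OF sub2 basis_carrier(6)] by blast+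
  have *: "u \<otimes> x \<in> ?S" "u \<otimes> y \<in> ?S" if uD: "u \<in> D 3" for u
  proof -
    obtain r s where u: "r \<in> carrier F" "s \<in> carrier F" "u = r \<odot> a \<oplus> s \<odot> b"
      using uD by (rule D3E)
    have "u \<otimes> x = r \<odot> e1 \<oplus> s \<odot> e2"
      using u by (simp add: mult_add_left mult_smult_left b_x e1_def)
    then show "u \<otimes> x \<in> ?S"
      using e u submoduleE(4,5)[OF sub] by simp
    have "u \<otimes> y = r \<odot> e2 \<oplus> s \<odot> e3"
      using u by (simp add: mult_add_left mult_smult_left e2_def e3_def)
    then show "u \<otimes> y \<in> ?S"
      using e u submoduleE(4,5)[OF sub] by simp
  qed
  show "D 4 \<subseteq> ?S"
    unfolding D4_eq ad_gens_def using * by (auto intro!: submoduleE(5)[OF sub])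
  show "?S \<subseteq> D 4"
    using basis_D(6,7,8) submodule_zero[OF sub_D, of 4] by (intro adjoin_least sub_D; simp)
qed

lemma D4E:
  assumes "u \<in> D 4"
  obtains r s t where "r \<in> carrier F" "s \<in> carrier F" "t \<in> carrier F"
    "u = r \<odot> e1 \<oplus> s \<odot> e2 \<oplus> t \<odot> e3"
proof -
  obtain v t where v: "v \<in> adjoin (adjoin {\<zero>} e1) e2" and t: "t \<in> carrier F" and u: "u = v \<oplus> t \<odot> e3"
    using assms unfolding D4_adjoin mem_adjoin[of u _ e3] by (elim bexE)
  obtain w s where w: "w \<in> adjoin {\<zero>} e1" and s: "s \<in> carrier F" and v: "v = w \<oplus> s \<odot> e2"
    using v unfolding mem_adjoin[of v _ e2] by (elim bexE)
  obtain r where r: "r \<in> carrier F" and w: "w = r \<odot> e1"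
    using w unfolding mem_adjoin_zero[OF basis_carrier(4)] by (elim bexE)
  show ?thesis
    using that[OF r s t] u v w by simp
qed

lemma D5_eq: "D 5 = ad_gens L g (D 4)"
  using D_Suc[of 4] by (simp add: eval_nat_numeral del: left_normed.simps)

text \<open>
  The expansion of \<open>u\<close> is \<open>f\<close> up to length \<open>c\<close>. The rules below compute such an \<open>f\<close> along the way an
  element is built from the generators.
\<close>

definition rep_by :: "'b \<Rightarrow> (two_gens list \<Rightarrow> int) \<Rightarrow> bool"
  where "rep_by u f \<longleftrightarrow> u \<in> carrier L \<and> (\<forall>w. length w \<le> c \<longrightarrow> [\<Phi> u w = f w] (mod int p))"

lemma rep_by_gen: "rep_by (g i) (letter i)"
  using \<Phi>_gen by (simp add: rep_by_def letter_def)

lemma rep_by_\<Phi>: "u \<in> carrier L \<Longrightarrow> rep_by u (\<Phi> u)"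
  by (simp add: rep_by_def)

lemma rep_by_add: "rep_by u f \<Longrightarrow> rep_by v h \<Longrightarrow> rep_by (u \<oplus> v) (\<lambda>w. f w + h w)"
  unfolding rep_by_def using cong_trans[OF \<Phi>_add cong_add] by simp

lemma rep_by_mult:
  assumes "rep_by u f" "rep_by v h"
  shows "rep_by (u \<otimes> v) (comm f h)"
  unfolding rep_by_def
proof (intro conjI allI impI)
  show "u \<otimes> v \<in> carrier L" using assms by (simp add: rep_by_def)
  fix w :: "two_gens list" assume w: "length w \<le> c"
  have "[\<Phi> (u \<otimes> v) w = comm (\<Phi> u) (\<Phi> v) w] (mod int p)"
    using assms w by (intro \<Phi>_mult) (auto simp: rep_by_def)
  also have "[comm (\<Phi> u) (\<Phi> v) w = comm f h w] (mod int p)"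
    using assms w by (intro comm_cong) (auto simp: rep_by_def)
  finally show "[\<Phi> (u \<otimes> v) w = comm f h w] (mod int p)" .
qed

lemma rep_by_smult: "r \<in> carrier F \<Longrightarrow> rep_by u f \<Longrightarrow> rep_by (r \<odot> u) (\<lambda>w. r * f w)"
  unfolding rep_by_def using cong_trans[OF \<Phi>_smult cong_scalar_left] by simp

definition vanishes :: "nat \<Rightarrow> 'b \<Rightarrow> bool"
  where "vanishes k u \<longleftrightarrow> (\<forall>w. length w = k \<longrightarrow> [\<Phi> u w = 0] (mod int p))"

lemma vanishes_zero: "k \<le> c \<Longrightarrow> vanishes k \<zero>"
  using \<Phi>_zero by (simp add: vanishes_def)

lemma vanishesD:
  assumes "vanishes k u" "rep_by u f" "length w = k" "k \<le> c"
  shows "int p dvd f w"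
  using assms cong_trans[OF cong_sym, of "\<Phi> u w" "f w" "int p" 0]
  by (simp add: vanishes_def rep_by_def cong_0_iff)

lemma scalar_zero: "r \<in> carrier F \<Longrightarrow> int p dvd r \<Longrightarrow> r = 0"
  using zdvd_not_zless[of r "int p"] by (force simp: carrier_F)

abbreviation (input) "wz \<equiv> comm (letter X1) (letter X2)"
abbreviation (input) "wa \<equiv> comm wz (letter X1)"
abbreviation (input) "wb \<equiv> comm wz (letter X2)"
abbreviation (input) "we1 \<equiv> comm wa (letter X1)"
abbreviation (input) "we2 \<equiv> comm wa (letter X2)"
abbreviation (input) "we3 \<equiv> comm wb (letter X2)"

lemma rep_by_basis:
  "rep_by z wz" "rep_by a wa" "rep_by b wb" "rep_by e1 we1" "rep_by e2 we2" "rep_by e3 we3"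
  unfolding e1_def e2_def e3_def a_def b_def z_def by (intro rep_by_mult rep_by_gen)+

text \<open>
  The following five lemmas recover the coordinates of an element of degree \<open>k\<close> from the
  coefficients of words of length \<open>k\<close>. Up to degree 4 there is one word per spanning
  element that has coefficient 1 in it and 0 in the others, since the spanning elements have different
  multidegrees.
\<close>

lemma coeffs1:
  assumes "r \<in> carrier F" "s \<in> carrier F" "vanishes 1 (r \<odot> x \<oplus> s \<odot> y)"
  shows "r = 0 \<and> s = 0"
proof -
  have rep: "rep_by (r \<odot> x \<oplus> s \<odot> y) (\<lambda>w. r * letter X1 w + s * letter X2 w)"
    using assms by (intro rep_by_add rep_by_smult rep_by_gen)
  note d = vanishesD[OF assms(3) rep _ c_pos]
  have "int p dvd r" using d[of "[X1]"] by (simp add: letter_def)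
  moreover have "int p dvd s" using d[of "[X2]"] by (simp add: letter_def)
  ultimately show ?thesis using scalar_zero assms by blast
qed

lemma coeffs2:
  assumes "2 \<le> c" "r \<in> carrier F" "vanishes 2 (r \<odot> z)"
  shows "r = 0"
proof -
  have rep: "rep_by (r \<odot> z) (\<lambda>w. r * wz w)"
    using assms by (intro rep_by_smult rep_by_basis)
  have "int p dvd r"
    using vanishesD[OF assms(3) rep _ assms(1), of "[X1, X2]"] by (simp add: comm_letter letter_def)
  then show ?thesis using scalar_zero assms by blast
qed

lemma coeffs3:
  assumes "3 \<le> c" "r \<in> carrier F" "s \<in> carrier F" "vanishes 3 (r \<odot> a \<oplus> s \<odot> b)"
  shows "r = 0 \<and> s = 0"
proof -
  have rep: "rep_by (r \<odot> a \<oplus> s \<odot> b) (\<lambda>w. r * wa w + s * wb w)"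
    using assms by (intro rep_by_add rep_by_smult rep_by_basis)
  note d = vanishesD[OF assms(4) rep _ assms(1)]
  have "int p dvd r" using d[of "[X1, X1, X2]"] by (simp add: comm_letter letter_def)
  moreover have "int p dvd s" using d[of "[X1, X2, X2]"] by (simp add: comm_letter letter_def)
  ultimately show ?thesis using scalar_zero assms by blast
qed

lemma coeffs4:
  assumes "4 \<le> c" "r \<in> carrier F" "s \<in> carrier F" "t \<in> carrier F"
    and "vanishes 4 (r \<odot> e1 \<oplus> s \<odot> e2 \<oplus> t \<odot> e3)"
  shows "r = 0 \<and> s = 0 \<and> t = 0"
proof -
  have rep: "rep_by (r \<odot> e1 \<oplus> s \<odot> e2 \<oplus> t \<odot> e3) (\<lambda>w. r * we1 w + s * we2 w + t * we3 w)"
    using assms by (intro rep_by_add rep_by_smult rep_by_basis)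
  note d = vanishesD[OF assms(5) rep _ assms(1)]
  have "int p dvd r" using d[of "[X1, X1, X1, X2]"] by (simp add: comm_letter letter_def)
  moreover have "int p dvd s" using d[of "[X2, X2, X1, X1]"] by (simp add: comm_letter letter_def)
  moreover have "int p dvd t" using d[of "[X1, X2, X2, X2]"] by (simp add: comm_letter letter_def)
  ultimately show ?thesis using scalar_zero assms by blast
qed

text \<open>
  In degree 5 there are two multidegrees, \<open>(3, 2)\<close> and \<open>(2, 3)\<close>, with two spanning brackets each. For
  these the coefficients of two words are needed; the resulting \<open>2 \<times> 2\<close> systems have determinant
  \<open>1\<close> or \<open>-1\<close>, which is why the argument works for every prime.
\<close>

lemma coeffs5:
  assumes "5 \<le> c" "u \<in> D 4" "v \<in> D 4" "vanishes 5 (u \<otimes> x \<oplus> v \<otimes> y)"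
  shows "u = \<zero> \<and> v = \<zero>"
proof -
  obtain r1 r2 r3 where r: "r1 \<in> carrier F" "r2 \<in> carrier F" "r3 \<in> carrier F"
    and u: "u = r1 \<odot> e1 \<oplus> r2 \<odot> e2 \<oplus> r3 \<odot> e3"
    using assms(2) by (rule D4E)
  obtain s1 s2 s3 where s: "s1 \<in> carrier F" "s2 \<in> carrier F" "s3 \<in> carrier F"
    and v: "v = s1 \<odot> e1 \<oplus> s2 \<odot> e2 \<oplus> s3 \<odot> e3"
    using assms(3) by (rule D4E)
  define fu where "fu w = r1 * we1 w + r2 * we2 w + r3 * we3 w" for w
  define fv where "fv w = s1 * we1 w + s2 * we2 w + s3 * we3 w" for w
  have "rep_by u fu"
    unfolding u fu_def[abs_def] using r by (intro rep_by_add rep_by_smult rep_by_basis)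
  moreover have "rep_by v fv"
    unfolding v fv_def[abs_def] using s by (intro rep_by_add rep_by_smult rep_by_basis)
  ultimately have rep: "rep_by (u \<otimes> x \<oplus> v \<otimes> y) (\<lambda>w. comm fu (letter X1) w + comm fv (letter X2) w)"
    by (intro rep_by_add rep_by_mult rep_by_gen)
  note d = vanishesD[OF assms(4) rep _ assms(1)]
  have fu: "fu [X1, X1, X1, X2] = r1" "fu [X1, X1, X2, X2] = - r2" "fu [X1, X2, X1, X2] = 2 * r2"
    "fu [X1, X2, X2, X2] = r3" "fu [X2, X1, X2, X2] = - 3 * r3"
    "fu [X2, X2, X2, X2] = 0"
    unfolding fu_def by (simp_all add: comm_letter letter_def)
  have fv: "fv [X1, X1, X1, X2] = s1" "fv [X1, X1, X2, X1] = - 3 * s1" "fv [X1, X1, X2, X2] = - s2"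
    "fv [X1, X2, X1, X2] = 2 * s2" "fv [X1, X2, X2, X2] = s3"
    "fv [X1, X1, X1, X1] = 0"
    unfolding fv_def by (simp_all add: comm_letter letter_def)
  have "int p dvd r1"
    using d[of "[X1, X1, X1, X1, X2]"] fu fv by (simp add: comm_letter)
  moreover have "int p dvd s3"
    using d[of "[X1, X2, X2, X2, X2]"] fu fv by (simp add: comm_letter)
  moreover have "int p dvd r2 \<and> int p dvd s1"
  proof -
    have 1: "int p dvd r2 + s1"
      using d[of "[X1, X1, X1, X2, X2]"] fu fv by (simp add: comm_letter)
    have 2: "int p dvd - 2 * r2 - 3 * s1"
      using d[of "[X1, X1, X2, X1, X2]"] fu fv by (simp add: comm_letter)
    show ?thesis
      using dvd_add[OF dvd_mult[OF 1, of 3] 2] dvd_diff[OF dvd_mult[OF 1, of "- 2"] 2] by simp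
  qed
  moreover have "int p dvd r3 \<and> int p dvd s2"
  proof -
    have 1: "int p dvd - r3 - s2"
      using d[of "[X1, X1, X2, X2, X2]"] fu fv by (simp add: comm_letter)
    have 2: "int p dvd 3 * r3 + 2 * s2"
      using d[of "[X1, X2, X1, X2, X2]"] fu fv by (simp add: comm_letter)
    show ?thesis
      using dvd_add[OF dvd_mult[OF 1, of 2] 2] dvd_diff[OF dvd_mult[OF 1, of "- 3"] 2] by simp
  qed
  ultimately have "r1 = 0" "r2 = 0" "r3 = 0" "s1 = 0" "s2 = 0" "s3 = 0"
    using r s scalar_zero by blast+
  then show ?thesis
    unfolding u v using smult_l_null[unfolded zero_F] by simp
qed

lemma vanishes_D:
  assumes k: "1 \<le> k" "k \<le> c" and u: "u \<in> D k" and van: "vanishes k u"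
  shows "u = \<zero>"
proof -
  note null = smult_l_null[unfolded zero_F]
  consider "k = 1" | "k = 2" | "k = 3" | "k = 4" | "k = 5"
    using k c_le by linarith
  then show ?thesis
  proof cases
    case 1
    then obtain r s where "r \<in> carrier F" "s \<in> carrier F" "u = r \<odot> x \<oplus> s \<odot> y"
      using u D1E by blast
    then show ?thesis using coeffs1[of r s] van 1 null by simp
  next
    case 2
    then obtain r where "r \<in> carrier F" "u = r \<odot> z"
      using u D2E by blast
    then show ?thesis using coeffs2[of r] van 2 k null by simp
  next
    case 3
    then obtain r s where "r \<in> carrier F" "s \<in> carrier F" "u = r \<odot> a \<oplus> s \<odot> b"
      using u D3E by blast
    then show ?thesis using coeffs3[of r s] van 3 k null by simp
  next
    case 4
    then obtain r s t where "r \<in> carrier F" "s \<in> carrier F" "t \<in> carrier F"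
      "u = r \<odot> e1 \<oplus> s \<odot> e2 \<oplus> t \<odot> e3"
      using u D4E by blast
    then show ?thesis using coeffs4[of r s t] van 4 k null by simp
  next
    case 5
    then obtain v w where "v \<in> D 4" "w \<in> D 4" "u = v \<otimes> x \<oplus> w \<otimes> y"
      using u D5_eq unfolding ad_gens_def by blast
    then show ?thesis using coeffs5[of v w] van 5 k by simp
  qed
qed

text \<open>
  Degree is visible in the length of words; this separates the components of different degree.
\<close>

lemma homogeneous:
  assumes "u \<in> D k" "length w \<le> c" "length w \<noteq> k"
  shows "[\<Phi> u w = 0] (mod int p)"
  using assms
proof (induction k arbitrary: u w)
  case 0
  then show ?case using \<Phi>_zero by simp
next
  case (Suc k)
  show ?case
  proof (cases "k = 0")
    case True
    then obtain r s where u: "r \<in> carrier F" "s \<in> carrier F" "u = r \<odot> x \<oplus> s \<odot> y"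
      using Suc.prems(1) D1E[of u] by auto
    then have "rep_by u (\<lambda>w. r * letter X1 w + s * letter X2 w)"
      by (auto intro!: rep_by_add rep_by_smult rep_by_gen)
    then have "[\<Phi> u w = r * letter X1 w + s * letter X2 w] (mod int p)"
      using Suc.prems by (simp add: rep_by_def)
    moreover have "letter i w = 0" for i
      using Suc.prems(3) True by (auto simp: letter_def)
    ultimately show ?thesis by simp
  next
    case False
    then obtain v1 v2 where v: "v1 \<in> D k" "v2 \<in> D k" "u = v1 \<otimes> x \<oplus> v2 \<otimes> y"
      using Suc.prems(1) D_Suc[of k] by (auto simp: ad_gens_def)
    have "rep_by u (\<lambda>w. comm (\<Phi> v1) (letter X1) w + comm (\<Phi> v2) (letter X2) w)"
      unfolding v(3) using v by (intro rep_by_add rep_by_mult rep_by_gen rep_by_\<Phi> D_carrier)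
    then have "[\<Phi> u w = comm (\<Phi> v1) (letter X1) w + comm (\<Phi> v2) (letter X2) w] (mod int p)"
      using Suc.prems by (simp add: rep_by_def)
    also have "[comm (\<Phi> v1) (letter X1) w + comm (\<Phi> v2) (letter X2) w = 0 + 0] (mod int p)"
    proof -
      have zero: "[\<Phi> v s = 0] (mod int p) \<or> [letter i t = 0] (mod int p)"
        if "v \<in> D k" "length s + length t = length w" for v s t i
      proof (cases "length s = k")
        case True
        then have "letter i t = 0"
          using that Suc.prems(3) by (auto simp: letter_def)
        then show ?thesis by simp
      next
        case False
        then show ?thesis
          using Suc.IH[OF that(1) _ False] that(2) Suc.prems(2) by simp
      qed
      have "[comm (\<Phi> v) (letter i) w = 0] (mod int p)" if "v \<in> D k" for v i
      proof (rule comm_zero)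
        fix s t assume w: "w = s @ t"
        show "[\<Phi> v s = 0] (mod int p) \<or> [letter i t = 0] (mod int p)"
          using zero[OF that, of s t i] w by simp
        show "[letter i s = 0] (mod int p) \<or> [\<Phi> v t = 0] (mod int p)"
          using zero[OF that, of t s i] w by auto
      qed
      then show ?thesis using v by (intro cong_add) auto
    qed
    finally show ?thesis by simp
  qed
qed

section \<open>Graded ideals and the zeta function\<close>

lemma card_ad_gens:
  assumes U: "sub U"
    and inj: "\<And>u v. u \<in> U \<Longrightarrow> v \<in> U \<Longrightarrow> u \<otimes> x \<oplus> v \<otimes> y = \<zero> \<Longrightarrow> u = \<zero> \<and> v = \<zero>"
  shows "card (ad_gens L g U) = card U ^ 2"
proof -
  have "inj_on (\<lambda>(u, v). u \<otimes> x \<oplus> v \<otimes> y) (U \<times> U)"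
  proof (rule inj_onI, clarify)
    fix u v u' v'
    assume uv: "u \<in> U" "v \<in> U" "u' \<in> U" "v' \<in> U"
      and eq: "u \<otimes> x \<oplus> v \<otimes> y = u' \<otimes> x \<oplus> v' \<otimes> y"
    note carrier = uv[THEN submodule_in_carrier[OF U]]
    have "(u \<oplus> \<ominus> u') \<otimes> x \<oplus> (v \<oplus> \<ominus> v') \<otimes> y = (u \<otimes> x \<oplus> v \<otimes> y) \<oplus> \<ominus> (u' \<otimes> x \<oplus> v' \<otimes> y)"
      using carrier by (simp add: mult_add_left mult_minus_left M.minus_add M.a_ac)
    also have "\<dots> = \<zero>"
      unfolding eq using carrier by (simp add: M.r_neg)
    finally have "u \<oplus> \<ominus> u' = \<zero> \<and> v \<oplus> \<ominus> v' = \<zero>"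
      using uv submoduleE(3,5)[OF U] by (intro inj) auto
    then show "u = u' \<and> v = v'"
      using carrier eq_if_diff_zero by blast
  qed
  moreover have "ad_gens L g U = (\<lambda>(u, v). u \<otimes> x \<oplus> v \<otimes> y) ` (U \<times> U)"
    by (auto simp: ad_gens_def)
  ultimately show ?thesis
    by (simp add: card_image card_cartesian_product power2_eq_square)
qed

lemma scalars: "0 \<in> carrier F" "1 \<in> carrier F"
  using R.zero_closed R.one_closed by (simp_all only: zero_F one_F)

lemma card_D1: "card (D 1) = p ^ 2"
proof -
  have sub1: "sub (adjoin {\<zero>} x)"
    by (intro sub_adjoin sub_singleton_zero g)
  have "D 1 = adjoin (adjoin {\<zero>} x) y"
  proof
    show "D 1 \<subseteq> adjoin (adjoin {\<zero>} x) y"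
    proof
      fix u assume "u \<in> D 1"
      then obtain r s where u: "r \<in> carrier F" "s \<in> carrier F" "u = r \<odot> x \<oplus> s \<odot> y"
        by (rule D1E)
      then have "r \<odot> x \<in> adjoin {\<zero>} x"
        by (auto simp: mem_adjoin_zero)
      then show "u \<in> adjoin (adjoin {\<zero>} x) y"
        using u(2,3) by (subst mem_adjoin) blast
    qed
    show "adjoin (adjoin {\<zero>} x) y \<subseteq> D 1"
      using basis_D(1,2) submodule_zero[OF sub_D[of 1]]
      by (intro adjoin_least sub_D) (simp_all del: left_normed.simps)
  qed
  moreover have "card (adjoin {\<zero>} x) = card {\<zero>} * q"
  proof (rule card_adjoin_indep[OF sub_singleton_zero g])
    fix w r assume "w \<in> {\<zero>}" "r \<in> carrier F" "w \<oplus> r \<odot> x = \<zero>"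
    then show "r = \<zero>\<^bsub>F\<^esub>"
      using coeffs1[of r 0] vanishes_zero[OF c_pos] scalars smult_l_null[of y] by (simp add: zero_F)
  qed
  moreover have "card (adjoin (adjoin {\<zero>} x) y) = card (adjoin {\<zero>} x) * q"
  proof (rule card_adjoin_indep[OF sub1 g])
    fix w r assume "w \<in> adjoin {\<zero>} x" "r \<in> carrier F" "w \<oplus> r \<odot> y = \<zero>"
    then show "r = \<zero>\<^bsub>F\<^esub>"
      using coeffs1[of _ r] vanishes_zero[OF c_pos] by (auto simp: zero_F mem_adjoin_zero)
  qed
  ultimately show ?thesis
    by (simp add: q_eq power2_eq_square)
qed

lemma card_D2:
  assumes "2 \<le> c"
  shows "card (D 2) = p"
proof -
  have "card (adjoin {\<zero>} z) = card {\<zero>} * q"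
  proof (rule card_adjoin_indep[OF sub_singleton_zero basis_carrier(1)])
    fix w r assume "w \<in> {\<zero>}" "r \<in> carrier F" "w \<oplus> r \<odot> z = \<zero>"
    then show "r = \<zero>\<^bsub>F\<^esub>"
      using coeffs2[of r] vanishes_zero[OF assms] assms by (simp add: zero_F)
  qed
  then show ?thesis
    by (simp add: D2_eq q_eq)
qed

lemma ad_gens_inj_2:
  assumes "3 \<le> c" "u \<in> D 2" "v \<in> D 2" "u \<otimes> x \<oplus> v \<otimes> y = \<zero>"
  shows "u = \<zero> \<and> v = \<zero>"
proof -
  obtain r s where rs: "r \<in> carrier F" "s \<in> carrier F" "u = r \<odot> z" "v = s \<odot> z"
    using assms D2E by metis
  then have "r \<odot> a \<oplus> s \<odot> b = \<zero>"
    using assms(4) by (simp add: mult_smult_left a_def b_def)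
  then have "r = 0 \<and> s = 0"
    using coeffs3[of r s] rs assms vanishes_zero[of 3] by simp
  then show ?thesis
    using rs smult_l_null[of z] by (simp add: zero_F)
qed

lemma ad_gens_inj_4:
  assumes "5 \<le> c" "u \<in> D 4" "v \<in> D 4" "u \<otimes> x \<oplus> v \<otimes> y = \<zero>"
  shows "u = \<zero> \<and> v = \<zero>"
  using coeffs5[of u v] assms vanishes_zero[of 5] by simp

lemma card_D4:
  assumes "4 \<le> c"
  shows "card (D 4) = p ^ 3"
proof -
  have sub1: "sub (adjoin {\<zero>} e1)" and sub2: "sub (adjoin (adjoin {\<zero>} e1) e2)"
    by (intro sub_adjoin sub_singleton_zero basis_carrier)+
  note c4 = coeffs4[OF assms] and van = vanishes_zero[OF assms]
  note null = smult_l_null[unfolded zero_F]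
  have "card (adjoin {\<zero>} e1) = card {\<zero>} * q"
  proof (rule card_adjoin_indep[OF sub_singleton_zero basis_carrier(4)])
    fix w r assume "w \<in> {\<zero>}" "r \<in> carrier F" "w \<oplus> r \<odot> e1 = \<zero>"
    then show "r = \<zero>\<^bsub>F\<^esub>"
      using c4[of r 0 0] van scalars null by (simp add: zero_F)
  qed
  moreover have "card (adjoin (adjoin {\<zero>} e1) e2) = card (adjoin {\<zero>} e1) * q"
  proof (rule card_adjoin_indep[OF sub1 basis_carrier(5)])
    fix w r assume "w \<in> adjoin {\<zero>} e1" "r \<in> carrier F" "w \<oplus> r \<odot> e2 = \<zero>"
    then show "r = \<zero>\<^bsub>F\<^esub>"
      using c4[of _ r 0] van scalars null by (auto simp: zero_F mem_adjoin_zero)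
  qed
  moreover have "card (adjoin (adjoin (adjoin {\<zero>} e1) e2) e3) = card (adjoin (adjoin {\<zero>} e1) e2) * q"
  proof (rule card_adjoin_indep[OF sub2 basis_carrier(6)])
    fix w r assume w: "w \<in> adjoin (adjoin {\<zero>} e1) e2" and r: "r \<in> carrier F" "w \<oplus> r \<odot> e3 = \<zero>"
    obtain s t where "s \<in> carrier F" "t \<in> carrier F" "w = s \<odot> e1 \<oplus> t \<odot> e2"
      using w by (auto simp: mem_adjoin[of _ _ e2] mem_adjoin_zero)
    then show "r = \<zero>\<^bsub>F\<^esub>"
      using c4[of s t r] r van by (simp add: zero_F)
  qed
  ultimately show ?thesis
    by (simp add: D4_adjoin q_eq power3_eq_cube)
qed

lemma card_D:
  assumes "1 \<le> k" "k \<le> c"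
  shows "card (D k) = p ^ lie_dim k"
proof -
  consider "k = 1" | "k = 2" | "k = 3" | "k = 4" | "k = 5"
    using assms c_le by linarith
  then show ?thesis
  proof cases
    case 1
    then show ?thesis using card_D1 by (simp add: lie_dim_def)
  next
    case 2
    then show ?thesis using card_D2 assms by (simp add: lie_dim_def)
  next
    case 3
    then have "3 \<le> c" using assms by simp
    then have "card (D k) = card (D 2) ^ 2"
      unfolding 3 D3_eq using ad_gens_inj_2 by (intro card_ad_gens sub_D) auto
    then show ?thesis using card_D2 3 assms by (simp add: lie_dim_def)
  next
    case 4
    then show ?thesis using card_D4 assms by (simp add: lie_dim_def)
  next
    case 5
    then have "5 \<le> c" using assms by simp
    then have "card (D k) = card (D 4) ^ 2"
      unfolding 5 D5_eq using ad_gens_inj_4 by (intro card_ad_gens sub_D) auto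
    then show ?thesis using card_D4 5 assms by (simp add: lie_dim_def flip: power_mult)
  qed
qed

lemma finite_D: "1 \<le> k \<Longrightarrow> k \<le> c \<Longrightarrow> finite (D k)"
  using card_D[of k] prime_gt_0_nat[OF prime] by (intro card_ge_0_finite) simp

lemma ad_gens_zero: "ad_gens L g {\<zero>} = {\<zero>}"
  by (auto simp: ad_gens_def)

text \<open>
  Bracketing \<open>r x + s y\<close> with the generators gives \<open>-s z\<close> and \<open>r z\<close>, one of which is nonzero.
\<close>

lemma ad_gens_D1:
  assumes U: "sub U" "U \<subseteq> D 1" "u \<in> U" "u \<noteq> \<zero>"
  shows "ad_gens L g U = D 2"
proof
  have D2: "D 2 = ad_gens L g (D 1)"
    using D_Suc[of 1] by (simp add: eval_nat_numeral del: left_normed.simps)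
  show "ad_gens L g U \<subseteq> D 2"
    unfolding D2 by (rule ad_gens_mono) (rule U(2))
  have sub: "sub (ad_gens L g U)"
    by (rule submodule_ad_gens[OF g U(1)])
  obtain r s where u: "r \<in> carrier F" "s \<in> carrier F" "u = r \<odot> x \<oplus> s \<odot> y"
    using U(2,3) D1E by blast
  have "u \<otimes> x \<oplus> \<zero> \<otimes> y \<in> ad_gens L g U" "\<zero> \<otimes> x \<oplus> u \<otimes> y \<in> ad_gens L g U"
    unfolding ad_gens_def using U(3) submodule_zero[OF U(1)] by blast+
  moreover have "u \<otimes> x = (\<ominus>\<^bsub>F\<^esub> s) \<odot> z"
    using u anticommute[of y x] alternating[of x]
    by (simp add: mult_add_left mult_smult_left smult_r_minus smult_l_minus z_def)
  moreover have "u \<otimes> y = r \<odot> z"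
    using u alternating[of y] by (simp add: mult_add_left mult_smult_left z_def)
  ultimately have "(\<ominus>\<^bsub>F\<^esub> s) \<odot> z \<in> ad_gens L g U" "r \<odot> z \<in> ad_gens L g U"
    using u by simp_all
  moreover have "r \<noteq> \<zero>\<^bsub>F\<^esub> \<or> \<ominus>\<^bsub>F\<^esub> s \<noteq> \<zero>\<^bsub>F\<^esub>"
  proof (rule ccontr)
    assume "\<not> ?thesis"
    then have "r = \<zero>\<^bsub>F\<^esub>" "s = \<zero>\<^bsub>F\<^esub>"
      using u R.minus_minus[of s] R.minus_zero by auto
    then show False using u(3) U(4) by simp
  qed
  moreover have "\<ominus>\<^bsub>F\<^esub> s \<in> carrier F"
    using u by simp
  ultimately have "z \<in> ad_gens L g U"
    using sub_cancel_scalar[OF sub u(1) _ basis_carrier(1)]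
      sub_cancel_scalar[OF sub _ _ basis_carrier(1), of "\<ominus>\<^bsub>F\<^esub> s"] by blast
  then show "D 2 \<subseteq> ad_gens L g U"
    unfolding D2_eq using submodule_zero[OF sub] by (intro adjoin_least sub) auto
qed

text \<open>
  For \<open>v = \<alpha> a + \<beta> b\<close> the bracket \<open>[v, s x + t y]\<close> has coordinates \<open>s \<alpha>\<close>, \<open>s \<beta> + t \<alpha>\<close>, \<open>t \<beta>\<close>, that is, the
  coefficients of the product of two linear forms, and such a product vanishes only if a factor does.
\<close>

lemma ad_gens_inj_line:
  assumes "4 \<le> c" and v: "v \<in> D 3" "v \<noteq> \<zero>" and st: "s \<in> carrier F" "t \<in> carrier F"
    and eq: "(s \<odot> v) \<otimes> x \<oplus> (t \<odot> v) \<otimes> y = \<zero>"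
  shows "s = 0 \<and> t = 0"
proof -
  interpret field F by (rule field)
  obtain \<alpha> \<beta> where ab: "\<alpha> \<in> carrier F" "\<beta> \<in> carrier F" "v = \<alpha> \<odot> a \<oplus> \<beta> \<odot> b"
    using v D3E by blast
  have "(s \<odot> v) \<otimes> x \<oplus> (t \<odot> v) \<otimes> y =
      (s \<otimes>\<^bsub>F\<^esub> \<alpha>) \<odot> e1 \<oplus> (s \<otimes>\<^bsub>F\<^esub> \<beta> \<oplus>\<^bsub>F\<^esub> t \<otimes>\<^bsub>F\<^esub> \<alpha>) \<odot> e2 \<oplus> (t \<otimes>\<^bsub>F\<^esub> \<beta>) \<odot> e3"
    using ab st by (simp add: mult_smult_left mult_add_left smult_r_distr smult_l_distr smult_assoc1
        b_x M.a_ac flip: e1_def e2_def e3_def)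
  then have "s \<otimes>\<^bsub>F\<^esub> \<alpha> = 0 \<and> s \<otimes>\<^bsub>F\<^esub> \<beta> \<oplus>\<^bsub>F\<^esub> t \<otimes>\<^bsub>F\<^esub> \<alpha> = 0 \<and> t \<otimes>\<^bsub>F\<^esub> \<beta> = 0"
    using eq ab st vanishes_zero[OF assms(1)] by (intro coeffs4[OF assms(1)]) auto
  then have rel: "s \<otimes>\<^bsub>F\<^esub> \<alpha> = \<zero>\<^bsub>F\<^esub>" "s \<otimes>\<^bsub>F\<^esub> \<beta> \<oplus>\<^bsub>F\<^esub> t \<otimes>\<^bsub>F\<^esub> \<alpha> = \<zero>\<^bsub>F\<^esub>" "t \<otimes>\<^bsub>F\<^esub> \<beta> = \<zero>\<^bsub>F\<^esub>"
    by (simp_all add: zero_F)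
  have "s = \<zero>\<^bsub>F\<^esub> \<and> t = \<zero>\<^bsub>F\<^esub>"
  proof (cases "\<alpha> = \<zero>\<^bsub>F\<^esub>")
    case True
    then have "\<beta> \<noteq> \<zero>\<^bsub>F\<^esub>" using ab(3) v(2) by auto
    then show ?thesis using rel True ab st integral by auto
  next
    case False
    then have "s = \<zero>\<^bsub>F\<^esub>" using rel(1) ab st integral by auto
    then show ?thesis using rel(2) False ab st integral by auto
  qed
  then show ?thesis by (simp add: zero_F)
qed

text \<open>
  In degrees 2 and 4 bracketing with the two generators is jointly injective, so the dimension doubles. In
  degree 1 a single nonzero vector produces all of \<open>D 2\<close>. In degree 3 the doubling holds for lines by
  \<open>ad_gens_inj_line\<close>, while the full plane is mapped onto the three-dimensional \<open>D 4\<close>.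
\<close>

lemma card_ad_gens_dim:
  assumes j: "1 \<le> j" "Suc j \<le> c" and U: "sub U" "U \<subseteq> D j" "card U = p ^ d"
  shows "card (ad_gens L g U) = p ^ ad_dim j d"
proof -
  have p1: "p > 1" using prime_gt_1_nat[OF prime] .
  have triv: "U = {\<zero>}" if "d = 0"
    using sub_card_1[OF U(1)] U(3) that by simp
  have zero: "card (ad_gens L g U) = 1" if "d = 0"
    unfolding triv[OF that] ad_gens_zero by simp
  have "card U = q ^ d"
    using U(3) by (simp add: q_eq)
  then have nontrivial: "\<exists>u\<in>U. u \<noteq> \<zero>" if "d > 0"
    using sub_nontrivial[OF U(1) _ that] by blast
  consider "j = 1" | "j = 2" | "j = 3" | "j = 4"
    using j c_le by linarith
  then show ?thesis
  proof cases
    case 1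
    show ?thesis
    proof (cases "d = 0")
      case False
      then obtain u where "u \<in> U" "u \<noteq> \<zero>"
        using nontrivial by blast
      then have "ad_gens L g U = D 2"
        using ad_gens_D1 U 1 by simp
      then show ?thesis using card_D2 1 j False by (simp add: ad_dim_def)
    qed (use zero 1 in \<open>simp add: ad_dim_def\<close>)
  next
    case 2
    have "card (ad_gens L g U) = card U ^ 2"
      using ad_gens_inj_2 U 2 j by (intro card_ad_gens) auto
    then show ?thesis using U 2 by (simp add: ad_dim_def mult.commute flip: power_mult)
  next
    case 4
    have "card (ad_gens L g U) = card U ^ 2"
      using ad_gens_inj_4 U 4 j by (intro card_ad_gens) auto
    then show ?thesis using U 4 by (simp add: ad_dim_def mult.commute flip: power_mult)
  next
    case 3
    have fin: "finite (D 3)" using finite_D 3 j by simp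
    have c3: "card (D 3) = p ^ 2" using card_D[of 3] 3 j by (simp add: lie_dim_def)
    have "p ^ d \<le> p ^ 2"
      using card_mono[OF fin] U 3 c3 by metis
    then have "d \<le> 2" using p1 by simp
    then consider "d = 0" | "d = 1" | "d = 2" by linarith
    then show ?thesis
    proof cases
      case 1
      then show ?thesis using zero by (simp add: ad_dim_def)
    next
      case 2
      obtain v where v: "v \<in> U" "v \<noteq> \<zero>"
        using nontrivial 2 by auto
      have U_eq: "U = adjoin {\<zero>} v"
        using sub_card_q[OF U(1) _ v] U(3) 2 q_eq by simp
      have v3: "v \<in> D 3" using v U 3 by auto
      have "card (ad_gens L g U) = card U ^ 2"
      proof (rule card_ad_gens[OF U(1)])
        fix u w assume uw: "u \<in> U" "w \<in> U" "u \<otimes> x \<oplus> w \<otimes> y = \<zero>"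
        obtain s t where st: "s \<in> carrier F" "t \<in> carrier F" "u = s \<odot> v" "w = t \<odot> v"
          using uw(1,2) D_carrier[OF v3] unfolding U_eq by (auto simp: mem_adjoin_zero)
        have "s = 0 \<and> t = 0"
          using ad_gens_inj_line[OF _ v3 v(2) st(1,2)] st uw 3 j by simp
        then show "u = \<zero> \<and> w = \<zero>"
          using st smult_l_null[OF D_carrier[OF v3]] by (simp add: zero_F)
      qed
      then show ?thesis using U 2 3 by (simp add: ad_dim_def power2_eq_square)
    next
      case d2: 3
      have "U = D 3"
        using card_subset_eq[OF fin] U 3 c3 d2 by simp
      then have "ad_gens L g U = D 4" by (simp only: D4_eq)
      then show ?thesis using card_D4 3 j d2 by (simp add: ad_dim_def)
    qed
  qed
qed

lemma \<Phi>_finsum: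
  assumes "finite K" "\<And>k. k \<in> K \<Longrightarrow> u k \<in> carrier L" "length w \<le> c"
  shows "[\<Phi> (finsum L u K) w = (\<Sum>k\<in>K. \<Phi> (u k) w)] (mod int p)"
  using assms
proof (induction K)
  case empty
  then show ?case using \<Phi>_zero by simp
next
  case (insert k K)
  have fin: "finsum L u (insert k K) = u k \<oplus> finsum L u K"
    using insert by (intro M.finsum_insert) auto
  have "[\<Phi> (u k \<oplus> finsum L u K) w = \<Phi> (u k) w + \<Phi> (finsum L u K) w] (mod int p)"
    using insert by (intro \<Phi>_add M.finsum_closed) auto
  also have "[\<Phi> (u k) w + \<Phi> (finsum L u K) w = \<Phi> (u k) w + (\<Sum>k\<in>K. \<Phi> (u k) w)] (mod int p)"
    using insert by (intro cong_add) auto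
  finally show ?case
    unfolding fin using insert by simp
qed

text \<open>
  Only the summand of degree \<open>k\<close> contributes to the coefficients of words of length \<open>k\<close>, and
  \<open>vanishes_D\<close> says that these coefficients determine it.
\<close>

lemma finsum_D_zero:
  assumes u: "\<And>k. k \<in> {1..c} \<Longrightarrow> u k \<in> D k" and sum: "finsum L u {1..c} = \<zero>" and k: "k \<in> {1..c}"
  shows "u k = \<zero>"
proof -
  have "[\<Phi> (u k) w = 0] (mod int p)" if w: "length w = k" for w
  proof -
    have wc: "length w \<le> c" using w k by simp
    have "[\<Phi> (finsum L u {1..c}) w = (\<Sum>j\<in>{1..c}. \<Phi> (u j) w)] (mod int p)"
      using u D_carrier wc by (intro \<Phi>_finsum) auto
    also have "[(\<Sum>j\<in>{1..c}. \<Phi> (u j) w) = (\<Sum>j\<in>{1..c}. if j = k then \<Phi> (u k) w else 0)] (mod int p)"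
      using u homogeneous[OF _ wc] w by (intro cong_sum) auto
    also have "(\<Sum>j\<in>{1..c}. if j = k then \<Phi> (u k) w else 0) = \<Phi> (u k) w"
      using k by simp
    finally have "[\<Phi> \<zero> w = \<Phi> (u k) w] (mod int p)"
      unfolding sum .
    then show ?thesis
      using \<Phi>_zero[OF wc] cong_trans cong_sym by blast
  qed
  then show ?thesis
    using vanishes_D[of k "u k"] u[OF k] k by (simp add: vanishes_def)
qed

lemma finsum_D_inj:
  assumes u: "\<And>k. k \<in> {1..c} \<Longrightarrow> u k \<in> D k" and v: "\<And>k. k \<in> {1..c} \<Longrightarrow> v k \<in> D k"
    and eq: "finsum L u {1..c} = finsum L v {1..c}" and k: "k \<in> {1..c}"
  shows "u k = v k"
proof -
  define d where "d k = u k \<oplus> \<ominus> v k" for k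
  have uc: "u k \<in> carrier L" and vc: "v k \<in> carrier L" if "k \<in> {1..c}" for k
    using u v D_carrier that by blast+
  have d: "d k \<in> D k" if "k \<in> {1..c}" for k
    unfolding d_def using u v that submoduleE(3,5)[OF sub_D] by blast
  have dc: "d k \<in> carrier L" if "k \<in> {1..c}" for k
    using d[OF that] D_carrier by blast
  have "finsum L d {1..c} \<oplus> finsum L v {1..c} = finsum L (\<lambda>k. d k \<oplus> v k) {1..c}"
    using dc vc by (intro M.finsum_addf[symmetric]) auto
  also have "\<dots> = finsum L u {1..c}"
    using uc vc by (intro M.finsum_cong') (auto simp: d_def M.a_assoc M.l_neg)
  also have "\<dots> = \<zero> \<oplus> finsum L v {1..c}"
    using eq vc by (simp add: Pi_def M.finsum_closed)
  finally have "finsum L d {1..c} = \<zero>"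
    using dc vc M.finsum_closed[of d "{1..c}"] M.finsum_closed[of v "{1..c}"]
    by (simp add: Pi_def)
  then have "d k = \<zero>"
    using finsum_D_zero[OF d] k by blast
  then show ?thesis
    unfolding d_def using uc[OF k] vc[OF k] eq_if_diff_zero by blast
qed

lemma inj_on_finsum:
  assumes "\<And>k. k \<in> {1..c} \<Longrightarrow> J k \<subseteq> D k"
  shows "inj_on (\<lambda>u. finsum L u {1..c}) (\<Pi>\<^sub>E k\<in>{1..c}. J k)"
proof (rule inj_onI)
  fix u v assume u: "u \<in> (\<Pi>\<^sub>E k\<in>{1..c}. J k)" and v: "v \<in> (\<Pi>\<^sub>E k\<in>{1..c}. J k)"
    and eq: "finsum L u {1..c} = finsum L v {1..c}"
  have "u k = v k" if "k \<in> {1..c}" for k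
    using finsum_D_inj[OF _ _ eq that] u v assms by blast
  then show "u = v"
    using u v by (auto intro: PiE_ext)
qed

lemma card_sum_set:
  assumes "\<And>k. k \<in> {1..c} \<Longrightarrow> J k \<subseteq> D k"
  shows "card (sum_set L c J) = (\<Prod>k = 1..c. card (J k))"
  unfolding sum_set_def using inj_on_finsum[OF assms] by (simp add: card_image card_PiE)

lemma carrier_eq: "carrier L = sum_set L c D"
  by (rule carrier_eq_sum_set[OF gen nil])

lemma sum_set_Int_D:
  assumes J: "\<And>k. k \<in> {1..c} \<Longrightarrow> sub (J k)" "\<And>k. k \<in> {1..c} \<Longrightarrow> J k \<subseteq> D k" and k: "k \<in> {1..c}"
  shows "sum_set L c J \<inter> D k = J k"
proof
  show "J k \<subseteq> sum_set L c J \<inter> D k"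
    using sum_set_superset[of c J k, OF J(1) k] J(2)[OF k] by blast
  show "sum_set L c J \<inter> D k \<subseteq> J k"
  proof
    fix u assume u: "u \<in> sum_set L c J \<inter> D k"
    then have "u \<in> sum_set L c J" by blast
    then obtain f where f: "\<And>k. k \<in> {1..c} \<Longrightarrow> f k \<in> J k" "u = finsum L f {1..c}"
      by (rule sum_setE) auto
    let ?h = "\<lambda>j. if k = j then u else \<zero>"
    have "u = finsum L ?h {1..c}"
      using k u D_carrier M.finsum_singleton[of k "{1..c}" "\<lambda>_. u"] by auto
    then have "f k = ?h k"
      using f J(2) u submodule_zero[OF sub_D] k
      by (intro finsum_D_inj[of f ?h]) auto
    then show "u \<in> J k" using f(1)[OF k] by simp
  qed
qed

abbreviation graded :: "'b set \<Rightarrow> bool"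
  where "graded I \<equiv> graded_ideal F L g c I"

lemma graded_iff:
  "graded I \<longleftrightarrow> alg_ideal F L I \<and>
    bij_betw (\<lambda>u. finsum L u {1..c}) (\<Pi>\<^sub>E k\<in>{1..c}. I \<inter> D k) I"
proof -
  have "(\<Pi>\<^sub>E k\<in>{1..c}. I \<inter> homogeneous_component F L g k) = (\<Pi>\<^sub>E k\<in>{1..c}. I \<inter> D k)"
    by (intro PiE_cong) (simp add: homogeneous_component_eq)
  then show ?thesis
    by (simp add: graded_ideal_def internal_direct_sum_def)
qed

abbreviation ideal_chains :: "(nat \<Rightarrow> 'b set) set"
  where "ideal_chains \<equiv> chains D (ad_gens L g) c 1 {\<zero>}"

lemma ideal_chainsD:
  assumes "J \<in> ideal_chains"
  shows "k \<in> {1..c} \<Longrightarrow> sub (J k)" "k \<in> {1..c} \<Longrightarrow> J k \<subseteq> D k" "k \<notin> {1..c} \<Longrightarrow> J k = {}"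
    "1 \<le> k \<Longrightarrow> Suc k \<le> c \<Longrightarrow> ad_gens L g (J k) \<subseteq> J (Suc k)"
  using assms unfolding chains_def by auto

lemma ad_gens_mem:
  assumes "sub U" "u \<in> U"
  shows "u \<otimes> g i \<in> ad_gens L g U"
proof -
  have "u \<otimes> x \<oplus> \<zero> \<otimes> y \<in> ad_gens L g U" "\<zero> \<otimes> x \<oplus> u \<otimes> y \<in> ad_gens L g U"
    unfolding ad_gens_def using assms submodule_zero by blast+
  then show ?thesis
    using submodule_in_carrier[OF assms] by (cases i) simp_all
qed

text \<open>
  The sum of a chain is stable under bracketing with the generators, the last member because
  degree \<open>c + 1\<close> is zero; \<open>alg_ideal_of_gens\<close> does the rest.
\<close>

lemma chain_graded:
  assumes J: "J \<in> ideal_chains"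
  shows "graded (sum_set L c J)"
proof -
  note J' = ideal_chainsD[OF J]
  let ?I = "sum_set L c J"
  have I: "sub ?I" by (rule submodule_sum_set) (rule J'(1))
  have "alg_ideal F L ?I"
  proof (rule alg_ideal_of_gens[OF gen I])
    fix u i assume u: "u \<in> ?I"
    have "?I \<subseteq> {u \<in> carrier L. u \<otimes> g i \<in> ?I}"
    proof (intro sum_set_least submodule_vimage_mult_left I g subsetI)
      fix k v assume k: "k \<in> {1..c}" and v: "v \<in> J k"
      have vD: "v \<in> D k" using v J'(2)[OF k] by blast
      have "v \<otimes> g i \<in> ?I"
      proof (cases "k = c")
        case True
        have "v \<otimes> g i \<in> D (Suc c)" using D_step[OF vD] k True by simp
        then show ?thesis using nil submodule_zero[OF I] by auto
      next
        case False
        then have "v \<otimes> g i \<in> J (Suc k)"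
          using ad_gens_mem[OF J'(1)[OF k] v] J'(4)[of k] k by auto
        then show ?thesis
          using sum_set_superset[of c J "Suc k", OF J'(1)] False k by auto
      qed
      then show "v \<in> {u \<in> carrier L. u \<otimes> g i \<in> ?I}"
        using D_carrier[OF vD] by simp
    qed
    then show "u \<otimes> g i \<in> ?I" using u by blast
  qed
  moreover have "(\<Pi>\<^sub>E k\<in>{1..c}. ?I \<inter> D k) = (\<Pi>\<^sub>E k\<in>{1..c}. J k)"
    using sum_set_Int_D[of J, OF J'(1,2)] by (intro PiE_cong) auto
  ultimately show ?thesis
    unfolding graded_iff bij_betw_def using inj_on_finsum[of J, OF J'(2)]
    by (simp add: sum_set_def)
qed

lemma graded_chain:
  assumes I: "graded I"
  shows "\<exists>J\<in>ideal_chains. sum_set L c J = I"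
proof
  let ?J = "\<lambda>k. if k \<in> {1..c} then I \<inter> D k else {}"
  have ideal: "alg_ideal F L I" and sub: "sub I"
    using I by (auto simp: graded_iff alg_ideal_def)
  have "(\<Pi>\<^sub>E k\<in>{1..c}. ?J k) = (\<Pi>\<^sub>E k\<in>{1..c}. I \<inter> D k)"
    by (intro PiE_cong) simp
  then show "sum_set L c ?J = I"
    using I unfolding graded_iff bij_betw_def sum_set_def by simp
  have sub_Int: "sub (I \<inter> D k)" for k
    using submodule_Inter[of "{I, D k}"] sub sub_D by auto
  have step: "ad_gens L g (I \<inter> D k) \<subseteq> I \<inter> D (Suc k)" if "1 \<le> k" for k
  proof
    fix w assume "w \<in> ad_gens L g (I \<inter> D k)"
    then obtain u v where u: "u \<in> I" "u \<in> D k" and v: "v \<in> I" "v \<in> D k" and w: "w = u \<otimes> x \<oplus> v \<otimes> y"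
      by (auto simp: ad_gens_def)
    have "u \<otimes> x \<in> I" "v \<otimes> y \<in> I"
      using ideal u v g unfolding alg_ideal_def by blast+
    moreover have "u \<otimes> x \<in> D (Suc k)" "v \<otimes> y \<in> D (Suc k)"
      using D_step u v that by auto
    ultimately show "w \<in> I \<inter> D (Suc k)"
      unfolding w using submoduleE(5)[OF sub] submoduleE(5)[OF sub_D] by blast
  qed
  show "?J \<in> ideal_chains"
    unfolding chains_def mem_Collect_eq
  proof (intro conjI allI ballI impI)
    fix j
    show "?J j = {}" if "j \<notin> {1..<1 + c}" using that by auto
    show "sub (?J j)" "?J j \<subseteq> D j" if "j \<in> {1..<1 + c}"
      using that sub_Int by simp_all
    show "ad_gens L g (?J j) \<subseteq> ?J (Suc j)" if "1 \<le> j \<and> Suc j < 1 + c"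
      using that step[of j] by (simp del: left_normed.simps)
    show "{\<zero>} \<subseteq> ?J 1" if "0 < c"
      using that submodule_zero[OF sub_Int, of 1] by (simp del: left_normed.simps)
  qed
qed

lemma bij_betw_chains_graded: "bij_betw (sum_set L c) ideal_chains {I. graded I}"
  unfolding bij_betw_def
proof
  show "inj_on (sum_set L c) ideal_chains"
  proof (rule inj_onI, rule ext)
    fix J J' k assume J: "J \<in> ideal_chains" and J': "J' \<in> ideal_chains"
      and eq: "sum_set L c J = sum_set L c J'"
    show "J k = J' k"
    proof (cases "k \<in> {1..c}")
      case True
      then show ?thesis
        using sum_set_Int_D[of J, OF ideal_chainsD(1,2)[OF J] True]
          sum_set_Int_D[of J', OF ideal_chainsD(1,2)[OF J'] True] eq by simp
    next
      case False
      then show ?thesis using ideal_chainsD(3)[OF J] ideal_chainsD(3)[OF J'] by simp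
    qed
  qed
  show "sum_set L c ` ideal_chains = {I. graded I}"
    using chain_graded graded_chain by blast
qed

text \<open>
  The index is computed componentwise; the quotients are exact by \<open>card_sub_power\<close>.
\<close>

lemma card_rcosets_chain:
  assumes J: "J \<in> ideal_chains"
  shows "card (a_rcosets (sum_set L c J)) = (\<Prod>k = 1..c. p ^ lie_dim k div card (J k))"
proof -
  note J' = ideal_chainsD[OF J]
  have p0: "p > 0" using prime_gt_0_nat[OF prime] .
  have sub: "sub (sum_set L c J)" by (rule submodule_sum_set) (rule J'(1))
  have factor: "p ^ lie_dim k div card (J k) * card (J k) = p ^ lie_dim k" and pos: "card (J k) > 0"
    if k: "k \<in> {1..c}" for k
  proof -
    have "finite (D k)" using finite_D k by simp
    then obtain d where d: "card (D k) = card (J k) * q ^ d"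
      using card_sub_power[OF J'(1)[OF k] sub_D J'(2)[OF k]] by blast
    then have eq: "p ^ lie_dim k = card (J k) * p ^ d"
      using card_D[of k] k q_eq by simp
    then show "card (J k) > 0" using p0 by (metis gr0I mult_is_0 power_not_zero less_irrefl)
    then show "p ^ lie_dim k div card (J k) * card (J k) = p ^ lie_dim k"
      using eq by simp
  qed
  have "card (a_rcosets (sum_set L c J)) * card (sum_set L c J) = card (carrier L)"
    using group.lagrange[OF M.a_group submodule.axioms(1)[OF sub]]
    by (simp add: A_RCOSETS_def Coset.order_def)
  moreover have "card (carrier L) = (\<Prod>k = 1..c. p ^ lie_dim k)"
    unfolding carrier_eq using card_D by (subst card_sum_set) auto
  moreover have "card (sum_set L c J) = (\<Prod>k = 1..c. card (J k))"
    using J'(2) by (rule card_sum_set)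
  moreover have "(\<Prod>k = 1..c. p ^ lie_dim k) =
      (\<Prod>k = 1..c. p ^ lie_dim k div card (J k)) * (\<Prod>k = 1..c. card (J k))"
    unfolding prod.distrib[symmetric] using factor by (intro prod.cong) auto
  ultimately have "card (a_rcosets (sum_set L c J)) * (\<Prod>k = 1..c. card (J k)) =
      (\<Prod>k = 1..c. p ^ lie_dim k div card (J k)) * (\<Prod>k = 1..c. card (J k))"
    by metis
  moreover have "(\<Prod>k = 1..c. card (J k)) > 0"
    using pos by (intro prod_pos) auto
  ultimately show ?thesis
    by (metis mult_right_cancel less_irrefl)
qed

theorem graded_ideal_zeta_eq_chain_sum:
  "graded_ideal_zeta F L g c s = chain_sum (of_nat p) (of_nat p powr (- s)) lie_dim ad_dim c 1 0"
proof -
  define h :: "nat \<Rightarrow> nat \<Rightarrow> complex" where "h k m = of_nat (p ^ lie_dim k div m) powr (- s)" for k m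
  have "graded_ideal_zeta F L g c s =
      (\<Sum>J\<in>ideal_chains. of_nat (card (a_rcosets (sum_set L c J))) powr (- s))"
    unfolding graded_ideal_zeta_def by (rule sum.reindex_bij_betw[OF bij_betw_chains_graded, symmetric])
  also have "\<dots> = (\<Sum>J\<in>ideal_chains. \<Prod>k\<in>{1..<1 + c}. h k (card (J k)))"
    by (intro sum.cong refl)
      (simp add: card_rcosets_chain of_nat_prod_powr h_def atLeastLessThanSuc_atLeastAtMost del: of_nat_prod)
  also have "\<dots> = chain_sum (of_nat q) (of_nat p powr (- s)) lie_dim ad_dim c 1 0"
  proof (rule sum_chains)
    show "sub (D j) \<and> finite (D j) \<and> card (D j) = q ^ lie_dim j" if "j \<in> {1..<1 + c}" for j
      using that sub_D finite_D[of j] card_D[of j] q_eq by (simp del: left_normed.simps)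
    show "sub (ad_gens L g U) \<and> ad_gens L g U \<subseteq> D (Suc j) \<and> card (ad_gens L g U) = q ^ ad_dim j d"
      if "1 \<le> j" "Suc j < 1 + c" "sub U" "U \<subseteq> D j" "card U = q ^ d" for j U d
      using that submodule_ad_gens[of g, OF g] card_ad_gens_dim[of j U d] ad_gens_mono[of U "D j"]
        D_Suc[of j] q_eq by (simp del: left_normed.simps)
    show "h j (q ^ d) = (of_nat p powr (- s)) ^ (lie_dim j - d)" if "d \<le> lie_dim j" for j d
      using that prime_gt_0_nat[OF prime]
      by (simp add: h_def q_eq power_diff[symmetric] of_nat_power_powr del: of_nat_power)
    show "sub {\<zero>} \<and> {\<zero>} \<subseteq> D 1 \<and> card {\<zero>} = q ^ 0"
      using sub_singleton_zero submodule_zero[OF sub_D, of 1] by (simp del: left_normed.simps)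
  qed
  finally show ?thesis by (simp add: q_eq)
qed

end

text \<open>
  The presentation is followed step by step: the free nonassociative algebra, its quotient by the
  Lie relations, and the quotient by the lower central series. Generation and the expansion into
  words are carried along, and the last quotient is shown to be an instance of \<open>free_nilp_two\<close>.
\<close>

theorem zeta_free_nilp_2_eq_chain_sum:
  assumes "prime p" "1 \<le> c" "c \<le> 5"
  shows "zeta_free_nilp_2 c p s = chain_sum (of_nat p) (of_nat p powr (- s)) lie_dim ad_dim c 1 0"
proof -
  define F where "F = residue_ring (int p)"
  define A where "A = (free_na_alg F :: (int, two_gens fmagma \<Rightarrow> int) module)"
  define I where "I = (lie_relation_ideal F :: (two_gens fmagma \<Rightarrow> int) set)"
  define L' where "L' = (free_lie F :: (int, (two_gens fmagma \<Rightarrow> int) set) module)"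
  define K where "K = lower_central F L' (Suc c)"
  define g0 where "g0 = (free_na_gen F :: two_gens \<Rightarrow> _)"
  define g1 where "g1 i = I +>\<^bsub>A\<^esub> g0 i" for i
  define g where "g i = K +>\<^bsub>L'\<^esub> g1 i" for i
  have L': "L' = quot_alg A I"
    by (simp add: L'_def A_def I_def free_lie_def)
  have p1: "int p > 1" using prime_gt_1_nat[OF assms(1)] by simp
  interpret residues "int p" F
    using p1 by (unfold_locales) (simp_all add: F_def)
  have cring: "cring F" by (rule cring)
  have bilinear: "bilinear_algebra F A"
    unfolding A_def by (rule cring.bilinear_algebra_free_na[OF cring])
  have rep0: "word_rep (int p) c A g0 free_rep"
    unfolding A_def g0_def by (rule word_rep_free_na)
  interpret A: word_rep_algebra "int p" A c g0 free_rep
    using bilinear rep0 p1 by (simp add: word_rep_algebra_def word_rep_algebra_axioms_def F_def)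
  have genA: "generates F A g0"
    unfolding A_def g0_def by (rule cring.generates_free_na[OF cring])
  have relations: "lie_relations A \<subseteq> carrier A"
    by (auto simp: lie_relations_def)
  have idealI: "alg_ideal F A I"
    using A.alg_ideal_hull[OF relations] by (simp add: I_def A_def lie_relation_ideal_def F_def)
  interpret AI: algebra_quotient F A I
    using A.bilinear_algebra_axioms idealI
    by (simp add: algebra_quotient_def algebra_quotient_axioms_def F_def)
  have "lie_relations A \<subseteq> I"
    unfolding I_def lie_relation_ideal_def A_def by (rule hull_subset)
  then have lie1: "lie_algebra F L'"
    unfolding L' by (rule AI.lie_algebra_Q)
  have gen1: "generates F L' g1"
    unfolding L' g1_def[abs_def] by (rule AI.generates_Q[OF genA])
  have g0: "g0 i \<in> carrier A" for i
    using genA by (auto simp: generates_def)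
  have I_order: "[free_rep a w = 0] (mod int p)" if "a \<in> I" "length w \<le> c" for a w
  proof -
    have "I = alg_ideal F A hull lie_relations A"
      by (simp add: I_def lie_relation_ideal_def A_def)
    then have "I \<subseteq> A.order_ge (Suc c)"
      using A.lie_ideal_order_ge by (simp add: F_def)
    then show ?thesis
      using that by (auto simp: A.order_ge_def)
  qed
  obtain \<Psi> where \<Psi>: "word_rep (int p) c L' g1 \<Psi>"
    using word_rep_quot[OF AI.algebra_quotient_axioms[unfolded F_def] A.rep g0 I_order]
    unfolding L' g1_def[abs_def] by blast
  interpret L1: lie_algebra F L' by (rule lie1)
  interpret W1: word_rep_algebra "int p" L' c g1 \<Psi>
    using L1.bilinear_algebra_axioms \<Psi> p1
    by (simp add: word_rep_algebra_def word_rep_algebra_axioms_def F_def)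
  interpret LK: algebra_quotient F L' K
    using L1.bilinear_algebra_axioms L1.alg_ideal_lower_central
    by (simp add: algebra_quotient_def algebra_quotient_axioms_def K_def del: lower_central.simps)
  have g1: "g1 i \<in> carrier L'" for i
    using gen1 by (auto simp: generates_def)
  have K_order: "[\<Psi> a w = 0] (mod int p)" if "a \<in> K" "length w \<le> c" for a w
    using W1.lower_central_order_ge[of "Suc c"] that by (auto simp: K_def F_def W1.order_ge_def)
  obtain \<Phi> where \<Phi>: "word_rep (int p) c LK.Q g \<Phi>"
    using word_rep_quot[OF LK.algebra_quotient_axioms[unfolded F_def] \<Psi> g1 K_order]
    unfolding g_def[abs_def] by blast
  have "lie_relations L' \<subseteq> {\<zero>\<^bsub>L'\<^esub>}"
    using L1.alternating L1.jacobi by (auto simp: lie_relations_def)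
  also have "\<dots> \<subseteq> K"
    using L1.submodule_zero[OF LK.sub] by simp
  finally have lie2: "lie_algebra F LK.Q"
    by (rule LK.lie_algebra_Q)
  have gen2: "generates F LK.Q g"
    unfolding g_def[abs_def] by (rule LK.generates_Q[OF gen1])
  have "left_normed F LK.Q g (Suc c) \<subseteq> LK.proj ` K"
    using LK.left_normed_Q[of g1 "Suc c", OF g1] L1.left_normed_lower_central[of g1 "Suc c", OF g1]
    unfolding g_def[abs_def] K_def by blast
  also have "\<dots> \<subseteq> {\<zero>\<^bsub>LK.Q\<^esub>}"
    using LK.proj_eq_zero LK.a_subset by (auto simp: LK.zero_Q')
  finally have nil: "left_normed F LK.Q g (Suc c) \<subseteq> {\<zero>\<^bsub>LK.Q\<^esub>}" .
  have "free_nilp_two p LK.Q c g \<Phi>"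
    unfolding free_nilp_two_def free_nilp_two_axioms_def word_rep_algebra_def word_rep_algebra_axioms_def
    using lie2 gen2 nil assms \<Phi> p1 LK.bilinear_algebra_Q unfolding F_def by blast
  then interpret free_nilp_two p LK.Q c g \<Phi> .
  have "zeta_free_nilp_2 c p s = graded_ideal_zeta F LK.Q g c s"
    unfolding zeta_free_nilp_2_def Let_def free_nilp_lie_def free_nilp_gen_def[abs_def] free_lie_gen_def
    by (simp add: g_def[abs_def] g1_def g0_def K_def I_def A_def L'_def F_def)
  then show ?thesis
    using graded_ideal_zeta_eq_chain_sum[of s] by (simp add: F_def)
qed

theorem theorem1p5:
  fixes c :: nat
  assumes "1 \<le> c" and "c \<le> 5"
  shows "\<exists>W :: rat poly poly. \<exists>E :: nat set. finite E \<and>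
    (\<forall>p. prime p \<and> p \<notin> E \<longrightarrow>
      (\<forall>s :: complex. zeta_free_nilp_2 c p s = eval_XY W (of_nat p) (of_nat p powr (- s))))"
proof (intro exI conjI allI impI)
  show "finite ({} :: nat set)" by simp
  fix p s assume "prime p \<and> p \<notin> ({} :: nat set)"
  then show "zeta_free_nilp_2 c p s =
      eval_XY (chain_sum [:[:0, 1:]:] [:0, 1:] lie_dim ad_dim c 1 0) (of_nat p) (of_nat p powr (- s))"
    using zeta_free_nilp_2_eq_chain_sum assms
    by (simp add: chain_sum_hom[of "\<lambda>W. eval_XY W _ _", OF eval_XY_ring_hom(1-4)] eval_XY_ring_hom(5,6))
qed

end
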